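(* Let $\Sigma$ be a two-holed cross-surface and $\mathfrak F(\Sigma)$ its Fricke space of marked complete hyperbolic structures. For a structure in $\mathfrak F(\Sigma)$ let $\ell_A,\ell_B\ge 0$ be the lengths of the closed geodesics in the free homotopy classes of the two boundary curves $A,B$ (with length $0$ if the corresponding end is a cusp), and let $\ell_X,\ell_Y>0$ be the lengths of the closed geodesics representing the two orientation-reversing simple closed curves $X,Y$. Then the map $\mathfrak F(\Sigma)\to\mathbb R^4$, $S\mapsto(\ell_A,\ell_B,\ell_X,\ell_Y)$, is a bijection onto the set of quadruples with $\ell_A,\ell_B\ge 0$, $\ell_X,\ell_Y>0$ satisfying $$\cosh\frac{\ell_A}{2}+\cosh\frac{\ell_B}{2}=2\sinh\frac{\ell_X}{2}\sinh\frac{\ell_Y}{2};$$ in particular these lengths provide coordinates on $\mathfrak F(\Sigma)$, which is thus identified with $[0,\infty)\times[0,\infty)\times\mathbb R_+$ via $(\ell_A,\ell_B,\ell_X)$.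
   Context: A two-holed cross-surface $\Sigma$ is $\mathbb RP^2$ minus two disjoint open discs; $\pi_1(\Sigma)$ is free of rank two with elements $A,B$ (boundary curves) and $X,Y$ (orientation-reversing simple loops meeting transversally once) satisfying $XY=A$, $Y^{-1}X=B$. The Fricke space $\mathfrak F(\Sigma)$ is the space of marked complete hyperbolic structures on $\Sigma$ (homotopy classes of homeomorphisms $\Sigma\to S$ with $S$ a complete hyperbolic surface, up to isometry), whose ends corresponding to $A,B$ are funnels or cusps; equivalently conjugacy classes of discrete faithful holonomy representations into $\mathrm{Isom}(\mathsf H^2)$. *)

theory Defs
  imports "HOL-Analysis.Analysis"
begin

definition H2 :: "complex set" where
  "H2 = {z. Im z > 0}"

definition hdist :: "complex \<Rightarrow> complex \<Rightarrow> real" where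
  "hdist z w = arcosh (1 + (cmod (z - w))\<^sup>2 / (2 * Im z * Im w))"

definition isom_H2 :: "(complex \<Rightarrow> complex) \<Rightarrow> bool" where
  "isom_H2 f \<longleftrightarrow> f ` H2 = H2 \<and> (\<forall>z\<in>H2. \<forall>w\<in>H2. hdist (f z) (f w) = hdist z w)"

text \<open>Translation length (minimal displacement) of an isometry; equals the length
  of the closed geodesic in the corresponding free homotopy class, and 0 for a parabolic.\<close>

definition tlen :: "(complex \<Rightarrow> complex) \<Rightarrow> real" where
  "tlen f = Inf ((\<lambda>z. hdist z (f z)) ` H2)"

text \<open>A representation of pi_1(Sigma) = free group on X, Y into Isom(H2) is given by the
  pair (rho X, rho Y).  Holonomies of the peripheral elements A = XY, B = Y^-1 X.\<close>

definition holA :: "(complex \<Rightarrow> complex) \<times> (complex \<Rightarrow> complex) \<Rightarrow> (complex \<Rightarrow> complex)" where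
  "holA r = fst r \<circ> snd r"

definition holB :: "(complex \<Rightarrow> complex) \<times> (complex \<Rightarrow> complex) \<Rightarrow> (complex \<Rightarrow> complex)" where
  "holB r = inv_into H2 (snd r) \<circ> fst r"

text \<open>Reference marked structure on the two-holed cross-surface: the glide reflections
  with matrices [[2,1],[1,0]] and [[0,1],[1,2]] pair opposite sides of the ideal
  quadrilateral with vertices -1, 0, 1, infinity; by Poincare's polygon theorem the
  quotient is RP^2 minus two points, with cusps XY (z -> z+4) and Y^-1 X.\<close>

definition X0 :: "complex \<Rightarrow> complex" where
  "X0 z = (2 * cnj z + 1) / cnj z"

definition Y0 :: "complex \<Rightarrow> complex" where
  "Y0 z = 1 / (cnj z + 2)"

text \<open>Fricke space (before taking conjugacy classes): holonomies of marked complete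
  hyperbolic structures on Sigma, i.e. representations whose action on H2 is
  conjugate to the reference action by an equivariant homeomorphism of H2
  (the lift of a marking-preserving homeomorphism of the quotient surfaces).\<close>

definition fricke :: "((complex \<Rightarrow> complex) \<times> (complex \<Rightarrow> complex)) set" where
  "fricke = {(g, h). isom_H2 g \<and> isom_H2 h \<and>
     (\<exists>D D'. homeomorphism H2 H2 D D' \<and>
        (\<forall>z\<in>H2. D (X0 z) = g (D z)) \<and> (\<forall>z\<in>H2. D (Y0 z) = h (D z)))}"

text \<open>Two representations define the same point of the Fricke space iff they are
  conjugate in Isom(H2).\<close>

definition conj_rep ::
  "(complex \<Rightarrow> complex) \<times> (complex \<Rightarrow> complex) \<Rightarrow> (complex \<Rightarrow> complex) \<times> (complex \<Rightarrow> complex) \<Rightarrow> bool" where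
  "conj_rep r s \<longleftrightarrow> (\<exists>\<phi>. isom_H2 \<phi> \<and>
     (\<forall>z\<in>H2. \<phi> (fst r z) = fst s (\<phi> z)) \<and> (\<forall>z\<in>H2. \<phi> (snd r z) = snd s (\<phi> z)))"

definition lengths :: "(complex \<Rightarrow> complex) \<times> (complex \<Rightarrow> complex) \<Rightarrow> real \<times> real \<times> real \<times> real" where
  "lengths r = (tlen (holA r), tlen (holB r), tlen (fst r), tlen (snd r))"

definition admissible :: "(real \<times> real \<times> real \<times> real) set" where
  "admissible = {(a, b, x, y). a \<ge> 0 \<and> b \<ge> 0 \<and> x > 0 \<and> y > 0 \<and>
     cosh (a / 2) + cosh (b / 2) = 2 * sinh (x / 2) * sinh (y / 2)}"

end

theory Submission
  imports Defs
begin

text \<open>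
  Let \<open>X\<close> and \<open>Y\<close> have determinant \<open>- 1\<close>, and put \<open>A = X Y\<close>, \<open>B = Y\<^sup>-\<^sup>1 X\<close>. Then
  \<open>tr A - tr B = tr X * tr Y\<close> and \<open>A B = X\<^sup>2\<close>. In a Fricke representation \<open>A\<close> and \<open>B\<close> have no fixed points, so
  \<open>\<bar>tr A\<bar>\<close> and \<open>\<bar>tr B\<bar>\<close> are \<open>2 cosh\<close> of half the lengths, and the length relation amounts to
  \<open>tr A\<close> and \<open>tr B\<close> having opposite signs. This is a topological fact. A fixed-point-free isometry \<open>f\<close> has
  a canonical lift to the universal cover of the space of pairs of distinct points, the one that
  preserves the lift of \<open>p \<mapsto> (p, f p)\<close>, and this lift comes from the matrix of positive trace. The lifts of
  \<open>A\<close>, \<open>B\<close> and \<open>A B\<close> compose up to a number of deck transformations whose parity is the sign of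
  \<open>tr A * tr B\<close>, and a conjugating homeomorphism changes this number at most by a sign; so the sign
  can be read off from the reference structure.

  The traces determine the pair up to conjugation. In the normal form the two axes cross at \<open>\<i>\<close>, and
  \<open>X\<close> and \<open>Y\<close> are the half-turn about \<open>\<i>\<close> followed by reflections in sides of the Dirichlet domain
  centred at \<open>\<i>\<close>. The inequalities \<open>tr A \<ge> 2\<close>, \<open>tr B \<le> - 2\<close> say precisely that the four sides of this
  domain are disjoint. Hence its images under the group generated by the four reflections tile the
  plane, and any homeomorphism between two such domains that respects the sides and commutes with the
  half-turn extends to an equivariant homeomorphism of the plane.
\<close>

section \<open>Isometries of the upper half-plane as real matrices\<close>

text \<open>An isometry determines its matrix only up to sign, but negating \<open>X\<close> or
  \<open>Y\<close> negates both \<open>tr A\<close> and \<open>tr B\<close>, so the sign of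
  \<open>tr A * tr B\<close> belongs to the representation. Lengths see only absolute values; with
  equal signs the trace identity would yield a difference of hyperbolic cosines instead of their
  sum. The sign has to be extracted from a conjugating map that is merely continuous. Such a map has
  no derivative and does not act on unit tangent vectors, the usual place for lifting isometries; it
  does act on pairs of distinct points, a space of the same homotopy type.

  Boundary lengths may vanish, so sides of the Dirichlet domain may share an ideal endpoint and come
  arbitrarily close. The covering by tiles is therefore derived from a closest orbit point, not from
  a collar of uniform width.

  The reference structure is itself conjugate to a normal form. Realising prescribed lengths thus
  means comparing two normal forms, and one construction of homeomorphisms serves all cases.\<close>

type_synonym mat2 = "real \<times> real \<times> real \<times> real"

fun mdet :: "mat2 \<Rightarrow> real" where "mdet (a, b, c, d) = a * d - b * c"
fun mtr :: "mat2 \<Rightarrow> real" where "mtr (a, b, c, d) = a + d"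
fun mmul :: "mat2 \<Rightarrow> mat2 \<Rightarrow> mat2" where
  "mmul (a, b, c, d) (a', b', c', d') =
    (a * a' + b * c', a * b' + b * d', c * a' + d * c', c * b' + d * d')"
fun mscale :: "real \<Rightarrow> mat2 \<Rightarrow> mat2" where
  "mscale k (a, b, c, d) = (k * a, k * b, k * c, k * d)"
fun madj :: "mat2 \<Rightarrow> mat2" where "madj (a, b, c, d) = (d, - b, - c, a)"
fun jac :: "mat2 \<Rightarrow> complex \<Rightarrow> complex" where
  "jac (a, b, c, d) z = of_real c * z + of_real d"
fun mob :: "mat2 \<Rightarrow> complex \<Rightarrow> complex" where
  "mob (a, b, c, d) z = (of_real a * z + of_real b) / (of_real c * z + of_real d)"

text \<open>Matrices of negative determinant act through complex conjugation, hence reverse the orientation.\<close>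
definition mact :: "mat2 \<Rightarrow> complex \<Rightarrow> complex" where
  "mact M z = mob M (if mdet M > 0 then z else cnj z)"

text \<open>\<open>hq z w = 2 * (cosh (hdist z w) - 1)\<close>\<close>
definition hq :: "complex \<Rightarrow> complex \<Rightarrow> real" where
  "hq z w = (cmod (z - w))\<^sup>2 / (Im z * Im w)"

lemma H2_iff [simp]: "z \<in> H2 \<longleftrightarrow> Im z > 0"
  by (simp add: H2_def)

lemma open_H2: "open H2"
  unfolding H2_def by (rule open_halfspace_Im_gt)

lemma convex_H2: "convex H2"
  unfolding H2_def by (rule convex_halfspace_Im_gt)

lemma mdet_mmul: "mdet (mmul M N) = mdet M * mdet N"
  by (cases M; cases N) (simp add: algebra_simps)

lemma mmul_assoc: "mmul (mmul L M) N = mmul L (mmul M N)"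
  by (cases L; cases M; cases N) (simp add: algebra_simps)

lemma mdet_mscale: "mdet (mscale k M) = k\<^sup>2 * mdet M"
  by (cases M) (simp add: algebra_simps power2_eq_square)

lemma mdet_madj [simp]: "mdet (madj M) = mdet M"
  by (cases M) (simp add: algebra_simps)

lemma mmul_madj: "mmul (madj M) M = (mdet M, 0, 0, mdet M)" "mmul M (madj M) = (mdet M, 0, 0, mdet M)"
  by (cases M; simp add: algebra_simps)+

lemma mmul_one: "mmul (k, 0, 0, k) M = mscale k M" "mmul M (k, 0, 0, k) = mscale k M"
  by (cases M; simp)+

lemma mmul_mscale: "mmul (mscale k M) N = mscale k (mmul M N)" "mmul M (mscale k N) = mscale k (mmul M N)"
  by (cases M; cases N; simp add: algebra_simps)+

lemma mscale_mscale: "mscale k (mscale l M) = mscale (k * l) M"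
  by (cases M) simp

lemma mscale_one [simp]: "mscale 1 M = M"
  by (cases M) simp

lemma mtr_mscale: "mtr (mscale k M) = k * mtr M"
  by (cases M) (simp add: algebra_simps)

lemma mtr_mmul_comm: "mtr (mmul M N) = mtr (mmul N M)"
  by (cases M; cases N) (simp add: algebra_simps)

lemma jac_nonzero:
  assumes "Im w \<noteq> 0" "mdet M \<noteq> 0" shows "jac M w \<noteq> 0"
proof -
  obtain a b c d where M: "M = (a, b, c, d)" by (cases M) auto
  show ?thesis
  proof
    assume "jac M w = 0"
    then have "c * Re w + d = 0 \<and> c * Im w = 0" by (auto simp: M complex_eq_iff)
    with assms M show False by auto
  qed
qed

lemma cnj_mob: "cnj (mob M w) = mob M (cnj w)"
  by (cases M) simp

lemma cnj_jac: "cnj (jac M w) = jac M (cnj w)"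
  by (cases M) simp

lemma mob_diff:
  assumes "jac M z \<noteq> 0" "jac M w \<noteq> 0"
  shows "mob M z - mob M w = of_real (mdet M) * (z - w) / (jac M z * jac M w)"
  using assms by (cases M) (simp add: divide_simps, simp add: algebra_simps)

lemma Im_mob:
  assumes "jac M w \<noteq> 0"
  shows "Im (mob M w) = mdet M * Im w / (cmod (jac M w))\<^sup>2"
proof -
  have n: "jac M (cnj w) \<noteq> 0" using assms cnj_jac[of M w] by force
  have "mob M w - cnj (mob M w) = of_real (mdet M) * (w - cnj w) / (jac M w * cnj (jac M w))"
    using mob_diff[OF assms n] by (simp add: cnj_mob cnj_jac)
  also have "\<dots> = of_real (mdet M) * (w - cnj w) / of_real ((cmod (jac M w))\<^sup>2)"
    by (simp only: complex_norm_square)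
  finally have "Im (mob M w - cnj (mob M w)) = Im (of_real (mdet M) * (w - cnj w) / of_real ((cmod (jac M w))\<^sup>2))"
    by simp
  then show ?thesis
    using assms by (simp add: Im_divide_of_real field_simps)
qed

lemma jac_mmul:
  assumes "jac N w \<noteq> 0"
  shows "jac (mmul M N) w = jac M (mob N w) * jac N w"
  using assms by (cases M; cases N) (simp add: divide_simps, simp add: algebra_simps)

lemma mob_mmul:
  assumes "jac N w \<noteq> 0"
  shows "mob (mmul M N) w = mob M (mob N w)"
proof -
  obtain a b c d where M: "M = (a, b, c, d)" by (cases M) auto
  obtain a' b' c' d' where N: "N = (a', b', c', d')" by (cases N) auto
  have frac: "(A * (n / j) + B) / (C * (n / j) + D) = (A * n + B * j) / (C * n + D * j)"
    if "j \<noteq> 0" for A B C D n j :: complex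
  proof -
    have "A * (n / j) + B = (A * n + B * j) / j" "C * (n / j) + D = (C * n + D * j) / j"
      using that by (simp_all add: field_simps)
    then show ?thesis using that by simp
  qed
  show ?thesis
    using frac[of "jac N w" a "of_real a' * w + of_real b'" b c d] assms by (simp add: M N algebra_simps)
qed

lemma mob_mscale: "k \<noteq> 0 \<Longrightarrow> mob (mscale k M) w = mob M w"
proof (cases M)
  case (fields a b c d)
  assume "k \<noteq> 0"
  have "mob (mscale k M) w = (of_real k * (of_real a * w + of_real b)) / (of_real k * (of_real c * w + of_real d))"
    by (simp add: fields algebra_simps)
  then show ?thesis using \<open>k \<noteq> 0\<close> by (simp add: fields)
qed

lemma mact_mscale: "k \<noteq> 0 \<Longrightarrow> mact (mscale k M) z = mact M z"
  by (simp add: mact_def mdet_mscale mob_mscale zero_less_mult_iff)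

lemma mact_H2:
  assumes "mdet M \<noteq> 0" "z \<in> H2" shows "mact M z \<in> H2"
proof -
  have "jac M z \<noteq> 0" "jac M (cnj z) \<noteq> 0" using assms by (simp_all add: jac_nonzero)
  with assms show ?thesis by (auto simp: mact_def Im_mob zero_less_mult_iff divide_neg_pos zero_less_divide_iff)
qed

lemma mact_mmul:
  assumes "mdet M \<noteq> 0" "mdet N \<noteq> 0" "z \<in> H2"
  shows "mact (mmul M N) z = mact M (mact N z)"
proof -
  have "jac N z \<noteq> 0" "jac N (cnj z) \<noteq> 0" using assms by (simp_all add: jac_nonzero)
  with assms show ?thesis
    by (auto simp: mact_def mdet_mmul mob_mmul cnj_mob zero_less_mult_iff mult_less_0_iff)
qed

lemma mact_one [simp]: "k \<noteq> 0 \<Longrightarrow> mact (k, 0, 0, k) z = z"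
  using not_real_square_gt_zero[of k] by (simp add: mact_def)

lemma mact_madj:
  assumes "mdet M \<noteq> 0" "z \<in> H2"
  shows "mact (madj M) (mact M z) = z" "mact M (mact (madj M) z) = z"
  using assms by (simp_all flip: mact_mmul add: mmul_madj)

text \<open>By \<open>mob_diff\<close> the numerator is multiplied by
  \<open>(mdet M)\<^sup>2\<close> over the squared moduli of the two Jacobians, and by
  \<open>Im_mob\<close> so is the denominator. The auxiliary fact covers all non-real points because
  reversing matrices act on conjugates, which lie in the lower half-plane.\<close>

lemma hq_mact:
  assumes "mdet M \<noteq> 0" "z \<in> H2" "w \<in> H2"
  shows "hq (mact M z) (mact M w) = hq z w"
proof -
  have *: "hq (mob M u) (mob M v) = hq u v" if "Im u \<noteq> 0" "Im v \<noteq> 0" for u v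
  proof -
    have n: "jac M u \<noteq> 0" "jac M v \<noteq> 0" using that assms by (simp_all add: jac_nonzero)
    show ?thesis unfolding hq_def
      using n assms that
      by (simp add: mob_diff Im_mob norm_mult norm_divide power_mult_distrib power_divide
          divide_simps) (simp add: power2_eq_square)
  qed
  have "hq (cnj z) (cnj w) = hq z w"
    by (simp add: hq_def flip: complex_cnj_diff)
  with * assms show ?thesis by (auto simp: mact_def)
qed

lemma hq_nonneg: "z \<in> H2 \<Longrightarrow> w \<in> H2 \<Longrightarrow> 0 \<le> hq z w"
  by (simp add: hq_def)

lemma hq_eq_0: "z \<in> H2 \<Longrightarrow> w \<in> H2 \<Longrightarrow> hq z w = 0 \<longleftrightarrow> z = w"
  by (auto simp: hq_def)

lemma hdist_hq: "hdist z w = arcosh (1 + hq z w / 2)"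
  by (simp add: hdist_def hq_def mult_ac)

lemma cosh_hdist: "z \<in> H2 \<Longrightarrow> w \<in> H2 \<Longrightarrow> cosh (hdist z w) = 1 + hq z w / 2"
  using hq_nonneg[of z w] by (simp add: hdist_hq)

lemma hdist_nonneg: "z \<in> H2 \<Longrightarrow> w \<in> H2 \<Longrightarrow> hdist z w \<ge> 0"
  using hq_nonneg[of z w] by (simp add: hdist_hq)

lemma hdist_eq_iff:
  assumes "z \<in> H2" "w \<in> H2" "z' \<in> H2" "w' \<in> H2"
  shows "hdist z w = hdist z' w' \<longleftrightarrow> hq z w = hq z' w'"
proof
  assume "hdist z w = hdist z' w'"
  then have "1 + hq z w / 2 = 1 + hq z' w' / 2"
    using cosh_hdist assms by metis
  then show "hq z w = hq z' w'" by simp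
qed (simp add: hdist_hq)

section \<open>Isometries and matrices correspond\<close>

lemma isom_H2_mact:
  assumes "mdet M \<noteq> 0" shows "isom_H2 (mact M)"
  unfolding isom_H2_def
proof (intro conjI ballI)
  show "mact M ` H2 = H2"
  proof
    show "mact M ` H2 \<subseteq> H2" using mact_H2[OF assms] by blast
    show "H2 \<subseteq> mact M ` H2"
    proof
      fix z assume z: "z \<in> H2"
      have "mact (madj M) z \<in> H2" using z assms by (intro mact_H2) auto
      moreover have "z = mact M (mact (madj M) z)" using mact_madj(2)[OF assms z] by simp
      ultimately show "z \<in> mact M ` H2" by blast
    qed
  qed
next
  fix z w assume zw: "z \<in> H2" "w \<in> H2"
  show "hdist (mact M z) (mact M w) = hdist z w"
    by (simp only: hdist_hq hq_mact[OF assms zw])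
qed

lemma isom_H2_hq:
  assumes "isom_H2 f" "z \<in> H2" "w \<in> H2" shows "f z \<in> H2" "hq (f z) (f w) = hq z w"
proof -
  have *: "f v \<in> H2" if "v \<in> H2" for v using assms(1) that unfolding isom_H2_def by blast
  show "f z \<in> H2" using * assms by blast
  have "hdist (f z) (f w) = hdist z w" using assms by (auto simp: isom_H2_def)
  then show "hq (f z) (f w) = hq z w" using hdist_eq_iff * assms by blast
qed

lemma isom_H2_inj: "isom_H2 f \<Longrightarrow> inj_on f H2"
  by (rule inj_onI) (metis hq_eq_0 isom_H2_hq)

lemma isom_H2_image: "isom_H2 f \<Longrightarrow> f ` H2 = H2"
  by (simp add: isom_H2_def)

lemma isom_H2_comp:
  assumes "isom_H2 f" "isom_H2 g" shows "isom_H2 (f \<circ> g)"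
  using assms unfolding isom_H2_def by (metis comp_apply image_comp image_eqI)

lemma isom_H2_inv_into:
  assumes "isom_H2 f" shows "isom_H2 (inv_into H2 f)"
proof -
  have i: "f (inv_into H2 f z) = z \<and> inv_into H2 f z \<in> H2" if "z \<in> H2" for z
    using assms that by (metis f_inv_into_f inv_into_into isom_H2_image)
  have "inv_into H2 f ` H2 = H2"
    using inj_on_imp_bij_betw[OF isom_H2_inj[OF assms]] isom_H2_image[OF assms]
    by (metis bij_betw_imp_surj_on bij_betw_inv_into)
  with i assms show ?thesis unfolding isom_H2_def by metis
qed

text \<open>Both base points lie on the imaginary axis, and two circles centred on one line meet
  only in points symmetric about it. Subtracting the two equations leaves equal heights.\<close>

lemma hq_ii_2ii_determine:
  assumes "z \<in> H2" "w \<in> H2" "hq z \<i> = hq w \<i>" "hq z (2 * \<i>) = hq w (2 * \<i>)"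
  shows "w = z \<or> w = - cnj z"
proof -
  obtain x y where z: "z = Complex x y" by (cases z)
  obtain u v where w: "w = Complex u v" by (cases w)
  have y: "y > 0" "v > 0" using assms z w by auto
  have 1: "(x\<^sup>2 + (y - 1)\<^sup>2) * v = (u\<^sup>2 + (v - 1)\<^sup>2) * y"
    using assms(3) y by (simp add: hq_def z w cmod_def field_simps)
  have 2: "(x\<^sup>2 + (y - 2)\<^sup>2) * v = (u\<^sup>2 + (v - 2)\<^sup>2) * y"
    using assms(4) y by (simp add: hq_def z w cmod_def field_simps)
  have vy: "v = y" using 1 2 by (simp add: power2_eq_square algebra_simps)
  with 1 y have "x\<^sup>2 = u\<^sup>2" by simp
  then have "u = x \<or> u = - x" by (auto simp: power2_eq_iff)
  with vy show ?thesis by (auto simp: z w complex_eq_iff)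
qed

text \<open>Each point goes to itself or to its mirror image; the choice must not depend on the
  point. If \<open>z\<close> went to its mirror image and \<open>w\<close> stayed, then
  \<open>w\<close> would be equidistant from \<open>z\<close> and that image, so one of
  \<open>z\<close>, \<open>w\<close> would lie on the imaginary axis, where the two choices
  coincide.\<close>

lemma isom_fixing:
  assumes f: "isom_H2 f" and i: "f \<i> = \<i>" "f (2 * \<i>) = 2 * \<i>"
  shows "(\<forall>z\<in>H2. f z = z) \<or> (\<forall>z\<in>H2. f z = - cnj z)"
proof -
  have *: "f z = z \<or> f z = - cnj z" if z: "z \<in> H2" for z
  proof (rule hq_ii_2ii_determine[OF z])
    show "f z \<in> H2" using isom_H2_hq(1)[OF f z z] .
    show "hq z \<i> = hq (f z) \<i>" using isom_H2_hq(2)[OF f z, of \<i>] i by simp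
    show "hq z (2 * \<i>) = hq (f z) (2 * \<i>)" using isom_H2_hq(2)[OF f z, of "2 * \<i>"] i by simp
  qed
  show ?thesis
  proof (rule ccontr)
    assume "\<not> ?thesis"
    then obtain z w where zw: "z \<in> H2" "w \<in> H2" "f z \<noteq> z" "f w \<noteq> - cnj w" by auto
    with * have e: "f z = - cnj z" "f w = w" by auto
    obtain x y where z: "z = Complex x y" by (cases z)
    obtain u v where w: "w = Complex u v" by (cases w)
    have y: "y > 0" "v > 0" using zw z w by auto
    have "hq (- cnj z) w = hq z w" using isom_H2_hq(2)[OF f zw(1,2)] e by simp
    then have "x * u = 0"
      using y by (simp add: hq_def z w cmod_def field_simps) (simp add: power2_eq_square algebra_simps)
    with zw e show False by (auto simp: z w complex_eq_iff)
  qed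
qed

text \<open>After moving \<open>p\<close> to \<open>\<i>\<close>, the reflection in the bisector of the image \<open>r\<close> of \<open>q\<close>
  and of \<open>2 * \<i>\<close> does the rest: it fixes \<open>\<i>\<close>, which is equidistant from both.\<close>
lemma exists_mat_to_ii:
  assumes "p \<in> H2" "q \<in> H2" "hq p q = 1/2"
  shows "\<exists>M. mdet M \<noteq> 0 \<and> mact M p = \<i> \<and> mact M q = 2 * \<i>"
proof -
  define y where "y = Im p"
  have y: "y > 0" using assms by (simp add: y_def)
  define A :: mat2 where "A = (1, - Re p, 0, y)"
  have dA: "mdet A = y" by (simp add: A_def)
  have Ap: "mact A p = \<i>"
    using y by (simp add: mact_def dA A_def complex_eq_iff Re_divide_of_real Im_divide_of_real y_def)
  define r where "r = mact A q"
  have r: "r \<in> H2" unfolding r_def using assms dA y by (intro mact_H2) auto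
  have hr: "hq \<i> r = 1/2" using hq_mact[of A p q] assms dA y Ap by (simp add: r_def)
  show ?thesis
  proof (cases "r = 2 * \<i>")
    case True
    then show ?thesis using Ap dA y by (intro exI[of _ A]) (simp add: r_def)
  next
    case False
    obtain u v where uv: "r = Complex u v" by (cases r)
    have v: "v > 0" using r uv by simp
    have "2 * (u\<^sup>2 + (v - 1)\<^sup>2) = v"
      using hr v by (simp add: hq_def uv cmod_def field_simps power2_commute[of 1 v])
    then have uu: "2 * (u * u) = 5 * v - 2 - 2 * (v * v)" by (simp add: power2_eq_square algebra_simps)
    \<comment> \<open>The bisector of \<open>r\<close> and \<open>2 * \<i>\<close> is the zero set
      of \<open>(2 - v) * (cmod z)\<^sup>2 - 4 * u * Re z - (2 - v)\<close>, its constant term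
      simplified by \<open>uu\<close>; \<open>B\<close> is the matrix of the reflection in
      it.\<close>
    define B :: mat2 where "B = (2 * u, 2 - v, 2 - v, - 2 * u)"
    have "u \<noteq> 0 \<or> v \<noteq> 2" using False by (auto simp: uv complex_eq_iff)
    then have "4 * (u * u) + (2 - v) * (2 - v) > 0"
      by (metis add_nonneg_pos add_pos_nonneg eq_iff_diff_eq_0 mult_pos_pos not_real_square_gt_zero zero_le_square zero_less_numeral mult_nonneg_nonneg zero_le_numeral)
    then have dB: "mdet B < 0" by (simp add: B_def)
    have H: "jac B (cnj \<i>) \<noteq> 0" "jac B (cnj r) \<noteq> 0" using dB r by (simp_all add: jac_nonzero)
    have Bi: "mact B \<i> = \<i>" using dB H(1) by (simp add: mact_def B_def field_simps)
    have "of_real (2 * u) * cnj r + of_real (2 - v) = 2 * \<i> * jac B (cnj r)"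
      using uu by (simp add: B_def uv complex_eq_iff algebra_simps)
    then have Br: "mact B r = 2 * \<i>" using dB H(2) by (simp add: mact_def B_def)
    have "mdet (mmul B A) \<noteq> 0" using dA dB y by (simp add: mdet_mmul)
    then show ?thesis
      using Ap Bi Br dA dB y assms by (intro exI[of _ "mmul B A"]) (simp add: mact_mmul r_def)
  qed
qed

lemma mact_normalize:
  assumes "mdet N \<noteq> 0"
  obtains M where "mdet M = 1 \<or> mdet M = - 1" "\<And>z. mact M z = mact N z"
proof (rule that)
  show "mdet (mscale (1 / sqrt \<bar>mdet N\<bar>) N) = 1 \<or> mdet (mscale (1 / sqrt \<bar>mdet N\<bar>) N) = - 1"
    using assms by (auto simp: mdet_mscale power_divide abs_if)
  show "mact (mscale (1 / sqrt \<bar>mdet N\<bar>) N) z = mact N z" for z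
    using assms by (intro mact_mscale) simp
qed

text \<open>Moving the images of \<open>\<i>\<close> and \<open>2 * \<i>\<close> back leaves an
  isometry fixing both points, hence the identity or the mirror \<open>z \<mapsto> - cnj z\<close>,
  and each of these comes from a matrix.\<close>

lemma isom_H2_matrix:
  assumes "isom_H2 f"
  obtains M where "mdet M = 1 \<or> mdet M = - 1" "\<And>z. z \<in> H2 \<Longrightarrow> f z = mact M z"
proof -
  have H: "\<i> \<in> H2" "2 * \<i> \<in> H2" by auto
  have fH: "f z \<in> H2" if "z \<in> H2" for z using isom_H2_hq(1)[OF assms that that] .
  have "hq \<i> (2 * \<i>) = 1/2" by (simp add: hq_def cmod_def)
  then have "hq (f \<i>) (f (2 * \<i>)) = 1/2"
    using isom_H2_hq(2)[OF assms H] by simp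
  then obtain P where P: "mdet P \<noteq> 0" "mact P (f \<i>) = \<i>" "mact P (f (2 * \<i>)) = 2 * \<i>"
    using exists_mat_to_ii fH H by meson
  have "isom_H2 (mact P \<circ> f)" using isom_H2_comp[OF isom_H2_mact assms] P by simp
  then have "(\<forall>z\<in>H2. (mact P \<circ> f) z = z) \<or> (\<forall>z\<in>H2. (mact P \<circ> f) z = - cnj z)"
    using P by (intro isom_fixing[of "mact P \<circ> f"]) simp_all
  moreover have "mact (-1, 0, 0, 1) z = - cnj z" for z by (simp add: mact_def)
  ultimately have "\<exists>J. mdet J \<noteq> 0 \<and> (\<forall>z\<in>H2. mact P (f z) = mact J z)"
    by (elim disjE; intro exI[of _ "(1, 0, 0, 1)"] exI[of _ "(-1, 0, 0, 1)"]; simp)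
  then obtain J where J: "mdet J \<noteq> 0" "\<And>z. z \<in> H2 \<Longrightarrow> mact P (f z) = mact J z" by blast
  obtain M where M: "mdet M = 1 \<or> mdet M = - 1" "\<And>z. mact M z = mact (mmul (madj P) J) z"
    by (rule mact_normalize[of "mmul (madj P) J"]) (use P J in \<open>simp_all add: mdet_mmul\<close>)
  show ?thesis
  proof (rule that[OF M(1)])
    fix z assume z: "z \<in> H2"
    have "f z = mact (madj P) (mact J z)" using mact_madj(1)[OF P(1) fH[OF z]] J(2)[OF z] by simp
    then show "f z = mact M z" using P(1) J(1) z by (simp add: M(2) mact_mmul)
  qed
qed

section \<open>Translation lengths and traces\<close>

text \<open>The zero set of \<open>axf M\<close> in the upper half-plane is the axis of \<open>mact M\<close>.\<close>
fun axf :: "mat2 \<Rightarrow> complex \<Rightarrow> real" where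
  "axf (a, b, c, d) z = c * (cmod z)\<^sup>2 + (d - a) * Re z - b"

text \<open>Clearing the Jacobian turns \<open>z - mact M z\<close> into a polynomial whose squared
  modulus is a constant times \<open>(Im z)\<^sup>2\<close> plus the square of
  \<open>axf M z\<close>. The displacement is thus a constant plus a measure of the distance from
  the axis, and one formula serves both orientations.\<close>

lemma hq_mact_self:
  assumes M: "mdet M = 1 \<or> mdet M = - 1" and z: "z \<in> H2"
  shows "hq z (mact M z) = (mtr M)\<^sup>2 - 2 - 2 * mdet M + (axf M z / Im z)\<^sup>2"
proof -
  obtain a b c d where abcd: "M = (a, b, c, d)" by (cases M) auto
  obtain x y where xy: "z = Complex x y" by (cases z)
  have y: "y > 0" using z xy by simp
  have zz: "(cmod z)\<^sup>2 = x\<^sup>2 + y\<^sup>2" by (simp add: xy cmod_def)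
  have ax: "axf M z = c * (x\<^sup>2 + y\<^sup>2) + (d - a) * x - b"
    unfolding abcd axf.simps zz by (simp add: xy)
  define w where "w = (if mdet M > 0 then z else cnj z)"
  have j: "jac M w \<noteq> 0" using M z by (intro jac_nonzero) (auto simp: w_def)
  have nz: "z - mact M z = (z * jac M w - (of_real a * w + of_real b)) / jac M w"
  proof -
    have "mact M z = mob M w" by (simp add: mact_def w_def)
    then show ?thesis using j by (simp add: abcd diff_divide_distrib)
  qed
  have "Im (mact M z) = y / (cmod (jac M w))\<^sup>2"
    using M j by (auto simp: mact_def w_def Im_mob xy)
  moreover have "Im z = y" by (simp add: xy)
  ultimately have "hq z (mact M z) = (cmod (z * jac M w - (of_real a * w + of_real b)))\<^sup>2 / y\<^sup>2"
    using j y by (simp add: hq_def nz norm_divide power_divide power2_eq_square[of y])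
  also have "(cmod (z * jac M w - (of_real a * w + of_real b)))\<^sup>2
     = ((mtr M)\<^sup>2 - 2 - 2 * mdet M) * y\<^sup>2 + (axf M z)\<^sup>2"
  proof (cases "mdet M > 0")
    case True
    then have e: "a * d - b * c = 1" using M abcd by auto
    have "(cmod (z * jac M w - (of_real a * w + of_real b)))\<^sup>2
      = ((d - a)\<^sup>2 + 4 * b * c) * y\<^sup>2 + (axf M z)\<^sup>2"
      unfolding cmod_power2 ax using True
      by (simp add: w_def abcd xy power2_eq_square) algebra
    also have "(d - a)\<^sup>2 + 4 * b * c = (mtr M)\<^sup>2 - 2 - 2 * mdet M"
      using e by (simp add: abcd power2_eq_square algebra_simps)
    finally show ?thesis .
  next
    case False
    then have e: "a * d - b * c = - 1" using M abcd by auto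
    have "(cmod (z * jac M w - (of_real a * w + of_real b)))\<^sup>2
      = (a + d)\<^sup>2 * y\<^sup>2 + (axf M z)\<^sup>2"
      unfolding cmod_power2 ax using False
      by (simp add: w_def abcd xy power2_eq_square) algebra
    then show ?thesis using e by (simp add: abcd)
  qed
  finally show ?thesis using y by (simp add: xy add_divide_distrib power_divide)
qed

text \<open>A parabolic attains no minimum, so values are only made small: by descending vertically
  to its fixed point, or by going up when that point is infinity. In the remaining cases the top of
  the semicircular axis, or a point of the vertical axis, gives the value 0.\<close>

lemma axf_small:
  assumes disc: "(mtr M)\<^sup>2 \<ge> 4 * mdet M" and e: "e > 0"
  shows "\<exists>z\<in>H2. (axf M z / Im z)\<^sup>2 < e"
proof -
  obtain a b c d where abcd: "M = (a, b, c, d)" by (cases M) auto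
  define D where "D = (d - a)\<^sup>2 + 4 * b * c"
  have D: "D \<ge> 0" using disc by (simp add: abcd D_def power2_eq_square algebra_simps)
  show ?thesis
  proof (cases "c = 0")
    case False
    define x where "x = (a - d) / (2 * c)"
    have S: "axf M (Complex x y) = c * y\<^sup>2 - D / (4 * c)" for y
      using False unfolding abcd axf.simps cmod_power2
      by (simp add: x_def D_def field_simps) (simp add: power2_eq_square algebra_simps)
    show ?thesis
    proof (cases "D = 0")
      case True
      define y where "y = sqrt e / (2 * \<bar>c\<bar>)"
      have y: "y > 0" using False e by (simp add: y_def)
      have "(axf M (Complex x y) / y)\<^sup>2 = (c * y)\<^sup>2"
        using y by (simp add: S True power2_eq_square)
      also have "\<dots> = e / 4" using e False by (simp add: y_def power2_eq_square field_simps)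
      finally show ?thesis using y e by (intro bexI[of _ "Complex x y"]) auto
    next
      case False': False
      define y where "y = sqrt D / (2 * \<bar>c\<bar>)"
      have y: "y > 0" using False False' D by (simp add: y_def)
      have "y\<^sup>2 = D / (4 * c\<^sup>2)" using D by (simp add: y_def power_divide power_mult_distrib)
      then have "axf M (Complex x y) = 0" using False by (simp add: S power2_eq_square)
      then show ?thesis using y e by (intro bexI[of _ "Complex x y"]) auto
    qed
  next
    case c: True
    show ?thesis
    proof (cases "d = a")
      case True
      define y where "y = (\<bar>b\<bar> + 1) / sqrt e"
      have y: "y > 0" using e by (simp add: y_def)
      have "\<bar>b\<bar> / y = sqrt e * (\<bar>b\<bar> / (\<bar>b\<bar> + 1))" by (simp add: y_def)
      also have "\<dots> < sqrt e * 1" using e by (intro mult_strict_left_mono) auto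
      finally have "(\<bar>b\<bar> / y)\<^sup>2 < (sqrt e)\<^sup>2" using y by (intro power_strict_mono) auto
      then show ?thesis using y e c True
        by (intro bexI[of _ "Complex 0 y"]) (auto simp: abcd power_divide)
    next
      case False
      then show ?thesis using e c
        by (intro bexI[of _ "Complex (b / (d - a)) 1"]) (auto simp: abcd)
    qed
  qed
qed

lemma tlen_mact:
  assumes M: "mdet M = 1 \<or> mdet M = - 1" and k: "k = (mtr M)\<^sup>2 - 2 - 2 * mdet M" "k \<ge> 0"
  shows "tlen (mact M) = arcosh (1 + k / 2)"
  unfolding tlen_def
proof (rule cInf_eq_non_empty)
  show "(\<lambda>z. hdist z (mact M z)) ` H2 \<noteq> {}" by (auto simp: H2_def intro: exI[of _ \<i>])
next
  fix v assume "v \<in> (\<lambda>z. hdist z (mact M z)) ` H2"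
  then obtain z where z: "z \<in> H2" "v = arcosh (1 + hq z (mact M z) / 2)" by (auto simp: hdist_hq)
  have "arcosh (1 + k / 2) \<le> arcosh (1 + (k + (axf M z / Im z)\<^sup>2) / 2)"
    using k by (subst not_less[symmetric], subst arcosh_less_iff_real) auto
  then show "arcosh (1 + k / 2) \<le> v" using hq_mact_self[OF M z(1)] z(2) k by simp
next
  fix v assume v: "\<And>u. u \<in> (\<lambda>z. hdist z (mact M z)) ` H2 \<Longrightarrow> v \<le> u"
  show "v \<le> arcosh (1 + k / 2)"
  proof (rule ccontr)
    assume "\<not> v \<le> arcosh (1 + k / 2)"
    then have lt: "arcosh (1 + k / 2) < v" by simp
    have v0: "0 < v" using arcosh_nonneg_real[of "1 + k/2"] k lt by linarith
    have "cosh (arcosh (1 + k / 2)) < cosh v"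
      using lt k v0 by (subst cosh_real_nonneg_less_iff) auto
    then have c: "1 + k / 2 < cosh v" using k by simp
    define e where "e = 2 * (cosh v - 1 - k / 2)"
    have "e > 0" using c by (simp add: e_def)
    moreover have "(mtr M)\<^sup>2 \<ge> 4 * mdet M" using M k zero_le_power2[of "mtr M"] by linarith
    ultimately obtain z where z: "z \<in> H2" "(axf M z / Im z)\<^sup>2 < e" using axf_small by blast
    have Mz: "mact M z \<in> H2" using M z(1) by (intro mact_H2) auto
    define X where "X = (axf M z / Im z)\<^sup>2"
    have "cosh (hdist z (mact M z)) = 1 + (k + X) / 2"
      using cosh_hdist[OF z(1) Mz] hq_mact_self[OF M z(1)] k by (simp add: X_def)
    also have "\<dots> < cosh v" using z(2) unfolding e_def X_def[symmetric] by (simp add: field_simps)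
    finally have "hdist z (mact M z) < v"
      using v0 hdist_nonneg[OF z(1) Mz] by (subst (asm) cosh_real_nonneg_less_iff) auto
    with v[of "hdist z (mact M z)"] z(1) show False by auto
  qed
qed

lemma tlen_mact_pos:
  assumes "mdet M = 1" "\<bar>mtr M\<bar> \<ge> 2"
  shows "tlen (mact M) \<ge> 0" "cosh (tlen (mact M) / 2) = \<bar>mtr M\<bar> / 2"
proof -
  have t: "(mtr M)\<^sup>2 \<ge> 4" using assms(2) abs_le_square_iff[of 2 "mtr M"] by simp
  then have T: "tlen (mact M) = arcosh (1 + ((mtr M)\<^sup>2 - 4) / 2)"
    using assms by (intro tlen_mact) auto
  define u where "u = arcosh (\<bar>mtr M\<bar> / 2)"
  have u: "u \<ge> 0" "cosh u = \<bar>mtr M\<bar> / 2" using assms by (simp_all add: u_def)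
  have "cosh (2 * u) = 1 + ((mtr M)\<^sup>2 - 4) / 2"
    unfolding cosh_double_cosh u by (simp add: power_divide field_simps)
  then have "tlen (mact M) = 2 * u" using T u arcosh_cosh_real[of "2 * u"] by simp
  then show "tlen (mact M) \<ge> 0" "cosh (tlen (mact M) / 2) = \<bar>mtr M\<bar> / 2" using u by auto
qed

lemma tlen_mact_neg:
  assumes "mdet M = - 1"
  shows "tlen (mact M) \<ge> 0" "sinh (tlen (mact M) / 2) = \<bar>mtr M\<bar> / 2"
proof -
  have T: "tlen (mact M) = arcosh (1 + (mtr M)\<^sup>2 / 2)"
    using assms by (intro tlen_mact) auto
  define u where "u = arsinh (\<bar>mtr M\<bar> / 2)"
  have u: "u \<ge> 0" "sinh u = \<bar>mtr M\<bar> / 2" using arsinh_real_neg_iff[of "\<bar>mtr M\<bar> / 2"]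
    by (simp_all add: u_def not_less[symmetric] del: arsinh_real_neg_iff)
  have "cosh (2 * u) = 1 + (mtr M)\<^sup>2 / 2"
    unfolding cosh_double cosh_square_eq u by (simp add: power_divide field_simps)
  then have "tlen (mact M) = 2 * u" using T u arcosh_cosh_real[of "2 * u"] by simp
  then show "tlen (mact M) \<ge> 0" "sinh (tlen (mact M) / 2) = \<bar>mtr M\<bar> / 2" using u by auto
qed

section \<open>Conjugate representations have equal lengths\<close>

lemma tlen_cong: "(\<And>z. z \<in> H2 \<Longrightarrow> f z = g z) \<Longrightarrow> tlen f = tlen g"
  unfolding tlen_def by (metis (mono_tags, lifting) image_cong)

lemma tlen_conj:
  assumes phi: "isom_H2 \<phi>" and f: "\<And>z. z \<in> H2 \<Longrightarrow> f z \<in> H2" and eq: "\<And>z. z \<in> H2 \<Longrightarrow> \<phi> (f z) = g (\<phi> z)"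
  shows "tlen f = tlen g"
proof -
  have "(\<lambda>z. hdist z (g z)) ` H2 = (\<lambda>z. hdist z (g z)) ` (\<phi> ` H2)"
    by (simp add: isom_H2_image[OF phi])
  also have "\<dots> = (\<lambda>z. hdist z (f z)) ` H2"
    unfolding image_image
  proof (rule image_cong)
    fix z assume "z \<in> H2"
    with f eq phi show "hdist (\<phi> z) (g (\<phi> z)) = hdist z (f z)"
      unfolding isom_H2_def by metis
  qed simp
  finally show ?thesis by (simp add: tlen_def)
qed

lemma holA_H2: "isom_H2 (fst r) \<Longrightarrow> isom_H2 (snd r) \<Longrightarrow> z \<in> H2 \<Longrightarrow> holA r z \<in> H2"
  using isom_H2_image[OF isom_H2_comp] by (fastforce simp: holA_def)

lemma holB_isom: "isom_H2 (fst r) \<Longrightarrow> isom_H2 (snd r) \<Longrightarrow> isom_H2 (holB r)"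
  unfolding holB_def by (intro isom_H2_comp isom_H2_inv_into)

text \<open>This is \<open>Y B = X\<close>. Values of \<open>B\<close> are identified below by
  cancelling the injective map \<open>snd r\<close> in it.\<close>

lemma snd_holB:
  assumes "isom_H2 (fst r)" "isom_H2 (snd r)" "z \<in> H2"
  shows "snd r (holB r z) = fst r z"
proof -
  have "fst r z \<in> snd r ` H2" using assms isom_H2_image by blast
  then show ?thesis by (simp add: holB_def f_inv_into_f)
qed

lemma conj_rep_lengths:
  assumes r: "isom_H2 (fst r)" "isom_H2 (snd r)" and s: "isom_H2 (fst s)" "isom_H2 (snd s)"
    and c: "conj_rep r s"
  shows "lengths r = lengths s"
proof -
  obtain \<phi> where phi: "isom_H2 \<phi>"
    and 1: "\<And>z. z \<in> H2 \<Longrightarrow> \<phi> (fst r z) = fst s (\<phi> z)"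
    and 2: "\<And>z. z \<in> H2 \<Longrightarrow> \<phi> (snd r z) = snd s (\<phi> z)"
    using c by (auto simp: conj_rep_def)
  have m: "f z \<in> H2" if "isom_H2 f" "z \<in> H2" for f z using isom_H2_hq(1)[OF that that(2)] .
  have "tlen (holA r) = tlen (holA s)"
    using m[OF r(2)] holA_H2[OF r] 1 2 by (intro tlen_conj[OF phi]) (auto simp: holA_def)
  moreover have "tlen (holB r) = tlen (holB s)"
  proof (intro tlen_conj[OF phi])
    fix z assume z: "z \<in> H2"
    show "holB r z \<in> H2" using m[OF holB_isom[OF r] z] .
    then have "snd s (\<phi> (holB r z)) = fst s (\<phi> z)" using 1 2 z snd_holB[OF r z] by metis
    also have "\<dots> = snd s (holB s (\<phi> z))" using snd_holB[OF s m[OF phi z]] by simp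
    finally show "\<phi> (holB r z) = holB s (\<phi> z)"
      using isom_H2_inj[OF s(2)] m[OF phi \<open>holB r z \<in> H2\<close>] m[OF holB_isom[OF s] m[OF phi z]]
      by (meson inj_onD)
  qed
  moreover have "tlen (fst r) = tlen (fst s)" "tlen (snd r) = tlen (snd s)"
    using 1 2 m r by (auto intro!: tlen_conj[OF phi])
  ultimately show ?thesis by (simp add: lengths_def)
qed

section \<open>A topological invariant of fixed-point-free isometries\<close>

text \<open>The logarithms of 1 form a discrete set. Applied to the difference of two continuous
  logarithms, this is the uniqueness of lifts up to a deck transformation, on which all comparisons
  of lifts rest.\<close>

lemma exp_eq_one_constant:
  fixes \<delta> :: "'a::topological_space \<Rightarrow> complex"
  assumes "connected S" "continuous_on S \<delta>" "\<And>x. x \<in> S \<Longrightarrow> exp (\<delta> x) = 1"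
  obtains n :: int where "\<And>x. x \<in> S \<Longrightarrow> \<delta> x = 2 * pi * \<i> * n"
proof (cases "S = {}")
  case False
  then obtain a where a: "a \<in> S" by blast
  have int: "\<exists>n::int. \<delta> x = 2 * pi * \<i> * n" if x: "x \<in> S" for x
  proof -
    obtain n :: int where "Re (\<delta> x) = 0" "Im (\<delta> x) = of_int (2 * n) * pi"
      using assms(3)[OF x] unfolding exp_eq_1 by blast
    then show ?thesis by (intro exI[of _ n]) (simp add: complex_eq_iff)
  qed
  have "\<delta> constant_on S"
  proof (rule continuous_discrete_range_constant[OF assms(1,2)])
    fix x assume x: "x \<in> S"
    show "\<exists>e>0. \<forall>y. y \<in> S \<and> \<delta> y \<noteq> \<delta> x \<longrightarrow> e \<le> norm (\<delta> y - \<delta> x)"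
    proof (intro exI[of _ "2 * pi"] conjI allI impI)
      fix y assume y: "y \<in> S \<and> \<delta> y \<noteq> \<delta> x"
      obtain n m :: int where n: "\<delta> x = 2 * pi * \<i> * n" "\<delta> y = 2 * pi * \<i> * m"
        using int x y by meson
      then have "m \<noteq> n" using y by auto
      then have "1 \<le> \<bar>real_of_int (m - n)\<bar>" by linarith
      moreover have "\<delta> y - \<delta> x = 2 * pi * \<i> * of_int (m - n)" by (simp add: n algebra_simps)
      then have "norm (\<delta> y - \<delta> x) = 2 * pi * \<bar>real_of_int (m - n)\<bar>"
        by (simp only: norm_mult norm_of_int) simp
      ultimately show "2 * pi \<le> norm (\<delta> y - \<delta> x)" by simp
    qed simp
  qed
  then obtain k where "\<And>x. x \<in> S \<Longrightarrow> \<delta> x = k" by (auto simp: constant_on_def)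
  then show ?thesis using int[OF a] a that by metis
qed (use that in blast)

text \<open>The Cayley coordinate of \<open>q\<close> centred at \<open>p\<close>. An isometry multiplies it by a unimodular factor
  that depends on \<open>p\<close> alone (after conjugation if the isometry reverses orientation).\<close>
definition upair :: "complex \<Rightarrow> complex \<Rightarrow> complex" where
  "upair p q = (q - p) / (q - cnj p)"

text \<open>The point whose Cayley coordinate centred at \<open>p\<close> is \<open>exp s\<close>.
  Hence \<open>(p, s) \<mapsto> (p, qpt p s)\<close>, with \<open>Re s < 0\<close> since Cayley
  coordinates lie in the unit disc, is the universal cover of the pairs of distinct points; deck
  transformations add multiples of \<open>2 * pi * \<i>\<close> to \<open>s\<close>.\<close>

definition qpt :: "complex \<Rightarrow> complex \<Rightarrow> complex" where
  "qpt p s = (p - exp s * cnj p) / (1 - exp s)"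

definition pair_cover :: "(complex \<times> complex) set" where
  "pair_cover = H2 \<times> {s. Re s < 0}"

lemma H2_minus_cnj: "p \<in> H2 \<Longrightarrow> q \<in> H2 \<Longrightarrow> q - cnj p \<noteq> 0"
  by (auto simp: complex_eq_iff)

lemma upair_eq_0: "p \<in> H2 \<Longrightarrow> q \<in> H2 \<Longrightarrow> upair p q = 0 \<longleftrightarrow> q = p"
  using H2_minus_cnj by (auto simp: upair_def)

lemma norm_upair_less_1:
  assumes "p \<in> H2" "q \<in> H2" shows "norm (upair p q) < 1"
proof -
  have "Im p * Im q > 0" using assms by simp
  then have "(cmod (q - p))\<^sup>2 < (cmod (q - cnj p))\<^sup>2"
    unfolding cmod_power2 by (simp add: power2_eq_square algebra_simps)
  then have "cmod (q - p) < cmod (q - cnj p)"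
    by (rule power_less_imp_less_base) simp
  then show ?thesis by (simp add: upair_def norm_divide divide_simps)
qed

lemma exp_neq_1_of_Re: "Re s < 0 \<Longrightarrow> exp s \<noteq> 1"
  by (metis exp_eq_1 less_irrefl)

lemma qpt_H2:
  assumes "p \<in> H2" "Re s < 0" shows "qpt p s \<in> H2"
proof -
  define u where "u = exp s"
  have u: "cmod u < 1" using assms by (simp add: u_def)
  have u1: "u \<noteq> 1" using exp_neq_1_of_Re assms u_def by simp
  have "qpt p s = (p - u * cnj p) * cnj (1 - u) / of_real ((cmod (1 - u))\<^sup>2)"
    using complex_div_cnj[of "p - u * cnj p" "1 - u"] by (simp add: qpt_def u_def)
  then have "Im (qpt p s) = Im ((p - u * cnj p) * cnj (1 - u)) / (cmod (1 - u))\<^sup>2"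
    by (simp only: Im_divide_of_real)
  also have "Im ((p - u * cnj p) * cnj (1 - u)) = Im p * (1 - (cmod u)\<^sup>2)"
    unfolding cmod_power2 by (simp add: power2_eq_square algebra_simps)
  finally have e: "Im (qpt p s) = Im p * (1 - (cmod u)\<^sup>2) / (cmod (1 - u))\<^sup>2" .
  have "(cmod u)\<^sup>2 < 1" using u by (simp add: power_less_one_iff abs_square_less_1)
  then show ?thesis using assms u1 by (simp add: e)
qed

lemma upair_qpt:
  assumes "p \<in> H2" "Re s < 0" shows "upair p (qpt p s) = exp s"
proof -
  have "1 - exp s \<noteq> 0" using exp_neq_1_of_Re assms by force
  moreover have "p - cnj p \<noteq> 0" using assms H2_minus_cnj by blast
  moreover have "qpt p s - p = exp s * (p - cnj p) / (1 - exp s)"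
    "qpt p s - cnj p = (p - cnj p) / (1 - exp s)"
    using calculation(1) by (simp_all add: qpt_def divide_simps) (simp_all add: algebra_simps)
  ultimately show ?thesis by (simp add: upair_def)
qed

lemma qpt_unique:
  assumes "p \<in> H2" "q \<in> H2" "upair p q = exp s"
  shows "qpt p s = q" "Re s < 0"
proof -
  have "norm (exp s) < 1" using norm_upair_less_1 assms by metis
  then show s: "Re s < 0" by simp
  have n: "q - cnj p \<noteq> 0" using assms H2_minus_cnj by blast
  have "1 - exp s \<noteq> 0" using exp_neq_1_of_Re[OF s] by simp
  moreover have "q - p = exp s * (q - cnj p)" using assms(3) n by (simp add: upair_def field_simps)
  ultimately show "qpt p s = q" by (simp add: qpt_def field_simps)
qed

lemma qpt_neq: "p \<in> H2 \<Longrightarrow> Re s < 0 \<Longrightarrow> qpt p s \<noteq> p"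
  by (metis exp_not_eq_zero qpt_H2 upair_eq_0 upair_qpt)

lemma upair_mob:
  assumes "mdet M = 1" "p \<in> H2" "q \<in> H2"
  shows "upair (mob M p) (mob M q) = upair p q * (cnj (jac M p) / jac M p)"
proof -
  have j: "jac M p \<noteq> 0" "jac M q \<noteq> 0" "jac M (cnj p) \<noteq> 0" using assms by (simp_all add: jac_nonzero)
  have 1: "mob M q - mob M p = (q - p) / (jac M q * jac M p)" using mob_diff[OF j(2,1)] assms by simp
  have 2: "mob M q - cnj (mob M p) = (q - cnj p) / (jac M q * jac M (cnj p))"
    using mob_diff[OF j(2,3)] assms by (simp add: cnj_mob)
  show ?thesis using j H2_minus_cnj[OF assms(2,3)]
    unfolding upair_def 1 2 cnj_jac by (simp add: field_simps)
qed

lemma upair_mact_reversing: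
  assumes "mdet M = - 1" "p \<in> H2" "q \<in> H2"
  shows "upair (mact M p) (mact M q) = cnj (upair p q) * (jac M p / cnj (jac M p))"
proof -
  have j: "jac M p \<noteq> 0" "jac M (cnj q) \<noteq> 0" "jac M (cnj p) \<noteq> 0" using assms by (simp_all add: jac_nonzero)
  have 1: "mact M q - mact M p = - (cnj q - cnj p) / (jac M (cnj q) * jac M (cnj p))"
    using mob_diff[OF j(2,3)] assms by (simp add: mact_def)
  have 2: "mact M q - cnj (mact M p) = - (cnj q - p) / (jac M (cnj q) * jac M p)"
    using mob_diff[OF j(2,1)] assms by (simp add: cnj_mob mact_def)
  have n: "cnj q - p \<noteq> 0" using H2_minus_cnj[OF assms(2,3)] by (metis complex_cnj_cnj complex_cnj_diff complex_cnj_zero_iff)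
  have "- (cnj q - cnj p) / (a * b) / (- (cnj q - p) / (a * c)) = (cnj q - cnj p) / (cnj q - p) * (c / b)"
    if "a \<noteq> 0" "b \<noteq> 0" "c \<noteq> 0" for a b c
    using that n by (simp add: field_simps)
  then show ?thesis
    using j unfolding upair_def 1 2 by (simp add: cnj_jac)
qed

lemma continuous_on_upair [continuous_intros]:
  assumes "continuous_on S f" "continuous_on S g" "\<And>x. x \<in> S \<Longrightarrow> f x \<in> H2" "\<And>x. x \<in> S \<Longrightarrow> g x \<in> H2"
  shows "continuous_on S (\<lambda>x. upair (f x) (g x))"
  unfolding upair_def using assms H2_minus_cnj by (intro continuous_intros) blast+

lemma continuous_on_jac [continuous_intros]:
  "continuous_on S f \<Longrightarrow> continuous_on S (\<lambda>x. jac M (f x))"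
  by (cases M) (simp, intro continuous_intros)

lemma continuous_on_mact: "mdet M \<noteq> 0 \<Longrightarrow> continuous_on H2 (mact M)"
proof -
  assume "mdet M \<noteq> 0"
  then have *: "jac M z \<noteq> 0" "jac M (cnj z) \<noteq> 0" if "z \<in> H2" for z using that by (simp_all add: jac_nonzero)
  obtain a b c d where M: "M = (a, b, c, d)" by (cases M) auto
  have "continuous_on H2 (\<lambda>z. mob M z)" "continuous_on H2 (\<lambda>z. mob M (cnj z))"
    unfolding M mob.simps using * by (intro continuous_intros; simp add: M)+
  then show ?thesis unfolding mact_def by (cases "mdet M > 0") simp_all
qed

section \<open>Canonical logarithms for matrices of positive trace\<close>

definition ljac :: "mat2 \<Rightarrow> complex \<Rightarrow> real" where
  "ljac M p = Im (Ln (jac M p))"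

text \<open>\<open>M\<close> is the lift of positive trace of a parabolic or hyperbolic isometry.\<close>
definition ppos :: "mat2 \<Rightarrow> bool" where
  "ppos M \<longleftrightarrow> mdet M = 1 \<and> mtr M \<ge> 2 \<and> (\<forall>z\<in>H2. mob M z \<noteq> z)"

text \<open>A Jacobian with \<open>c \<noteq> 0\<close> is not real; with \<open>c = 0\<close> it is
  the eigenvalue \<open>d\<close>, positive because the trace is. So the principal branch is
  continuous for this lift, and it tells \<open>M\<close> from \<open>- M\<close>, although both act
  alike.\<close>

lemma jac_notin_nonpos:
  assumes "mdet M = 1" "mtr M \<ge> 2" "p \<in> H2" shows "jac M p \<notin> \<real>\<^sub>\<le>\<^sub>0"
proof -
  obtain a b c d where M: "M = (a, b, c, d)" by (cases M) auto
  show ?thesis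
  proof (cases "c = 0")
    case True
    then have "a * d = 1" "a + d \<ge> 2" using assms M by auto
    then have "d > 0" by (smt (verit) mult_le_0_iff)
    then show ?thesis using True by (simp add: M complex_nonpos_Reals_iff)
  next
    case False
    then show ?thesis using assms by (simp add: M complex_nonpos_Reals_iff)
  qed
qed

lemma phase_exp:
  assumes "jac M p \<noteq> 0" shows "cnj (jac M p) / jac M p = exp (- 2 * \<i> * ljac M p)"
proof -
  define l where "l = Ln (jac M p)"
  have l: "jac M p = exp l" using assms by (simp add: l_def)
  have "cnj (jac M p) / jac M p = exp (cnj l - l)" by (simp add: l exp_cnj exp_diff)
  also have "cnj l - l = - 2 * \<i> * Im l" by (simp add: complex_eq_iff)
  finally show ?thesis by (simp add: ljac_def l_def)
qed

lemma continuous_on_ljac: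
  assumes "mdet M = 1" "mtr M \<ge> 2" shows "continuous_on H2 (ljac M)"
  unfolding ljac_def using jac_notin_nonpos[OF assms] by (intro continuous_intros) auto

text \<open>At a real fixed point \<open>r\<close>, \<open>mob_diff\<close> writes
  \<open>mob M z - r\<close> as \<open>z - r\<close> divided by the Jacobians at \<open>z\<close>
  and at \<open>r\<close>. The branches fit: \<open>z - r\<close> and \<open>mob M z - r\<close> lie
  in the upper half-plane, so their arguments differ by less than \<open>pi\<close>, and the
  argument of \<open>jac M z\<close> is at most \<open>pi\<close> in absolute value.\<close>

lemma Ln_minus_root:
  assumes M: "M = (a, b, c, d)" "mdet M = 1" "mtr M \<ge> 2" and r: "c * r\<^sup>2 + (d - a) * r - b = 0"
    and mu: "c * r + d > 0" and z: "z \<in> H2"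
  shows "Ln (mob M z - of_real r) = Ln (z - of_real r) - Ln (jac M z) - of_real (ln (c * r + d))"
proof (rule exp_complex_eqI)
  let ?r = "complex_of_real r"
  have "jac M ?r = of_real (c * r + d)" by (simp add: M)
  then have jr: "jac M ?r \<noteq> 0" using mu by (metis less_irrefl of_real_eq_0_iff)
  have "mob M ?r = of_real (a * r + b) / of_real (c * r + d)" by (simp add: M)
  also have "a * r + b = r * (c * r + d)" using r by (simp add: power2_eq_square algebra_simps)
  finally have mr: "mob M ?r = ?r" using mu by (simp del: of_real_add)
  have jz: "jac M z \<noteq> 0" using M z by (intro jac_nonzero) auto
  have d: "mob M z - ?r = (z - ?r) / (jac M z * of_real (c * r + d))"
    using mob_diff[OF jz jr] unfolding mr M(2) \<open>jac M ?r = _\<close> by simp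
  have n: "z - ?r \<noteq> 0" using z by (auto simp: complex_eq_iff)
  have fz: "mob M z \<in> H2" using mact_H2[of M z] M z by (simp add: mact_def)
  then have n': "mob M z - ?r \<noteq> 0" by (auto simp: complex_eq_iff)
  have "exp (complex_of_real (ln (c * r + d))) = of_real (c * r + d)"
    using mu by (simp add: exp_of_real del: of_real_add of_real_mult)
  then show "exp (Ln (mob M z - ?r)) = exp (Ln (z - ?r) - Ln (jac M z) - of_real (ln (c * r + d)))"
    using n n' jz by (simp only: exp_diff exp_Ln d) (simp add: field_simps)
  have 1: "0 < Im (Ln (z - ?r))" "Im (Ln (z - ?r)) < pi"
    using Im_Ln_pos_lt_imp[of "z - ?r"] z by auto
  have 2: "0 < Im (Ln (mob M z - ?r))" "Im (Ln (mob M z - ?r)) < pi"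
    using Im_Ln_pos_lt_imp[of "mob M z - ?r"] fz by auto
  have "\<bar>Im (Ln (jac M z))\<bar> \<le> pi"
    using jz Im_Ln_le_pi[of "jac M z"] mpi_less_Im_Ln[of "jac M z"] by linarith
  then show "\<bar>Im (Ln (mob M z - ?r)) - Im (Ln (z - ?r) - Ln (jac M z) - of_real (ln (c * r + d)))\<bar> < 2 * pi"
    using 1 2 by simp
qed

text \<open>This is \<open>(z - mob M z) * jac M z\<close>; its roots are the finite fixed
  points.\<close>

fun fixq :: "mat2 \<Rightarrow> complex \<Rightarrow> complex" where
  "fixq (a, b, c, d) z = of_real c * z\<^sup>2 + of_real (d - a) * z - of_real b"

text \<open>All fixed points are real or infinite, so \<open>fixq M\<close> splits into real linear
  factors, and a sum of principal logarithms works on the half-plane. Two finite roots have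
  multipliers with product 1: their real terms in \<open>Ln_minus_root\<close> cancel, and each root
  contributes one \<open>Ln (jac M z)\<close>. If infinity is fixed, the Jacobian is the positive
  constant \<open>d\<close>, which is 1 when no finite root exists.\<close>

lemma fixq_log:
  assumes "ppos M"
  obtains L where "continuous_on H2 L" "\<And>z. z \<in> H2 \<Longrightarrow> exp (L z) = fixq M z"
    "\<And>z. z \<in> H2 \<Longrightarrow> L (mob M z) = L z - 2 * Ln (jac M z)"
proof -
  obtain a b c d where M: "M = (a, b, c, d)" by (cases M) auto
  have dt: "mdet M = 1" "mtr M \<ge> 2" and nf: "\<And>z. z \<in> H2 \<Longrightarrow> mob M z \<noteq> z"
    using assms by (auto simp: ppos_def)
  have e: "a * d - b * c = 1" "a + d \<ge> 2" using dt M by auto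
  have cont: "continuous_on H2 (\<lambda>z. Ln (z - of_real r))" for r
    by (intro continuous_intros) (auto simp: complex_nonpos_Reals_iff)
  have nz: "z - of_real r \<noteq> 0" if "z \<in> H2" for z r using that by (auto simp: complex_eq_iff)
  show ?thesis
  proof (cases "c = 0")
    case False
    define D where "D = (a + d)\<^sup>2 - 4"
    have "(a + d)\<^sup>2 \<ge> 2\<^sup>2" using e by (intro power_mono) auto
    then have D: "D \<ge> 0" by (simp add: D_def)
    have sD: "sqrt D < a + d" using e by (intro real_less_lsqrt) (auto simp: D_def)
    have sD2: "sqrt D * sqrt D = D" using D by simp
    have D': "D = (d - a)\<^sup>2 + 4 * b * c" using e by (simp add: D_def power2_eq_square algebra_simps)
    define r1 where "r1 = (a - d + sqrt D) / (2 * c)"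
    define r2 where "r2 = (a - d - sqrt D) / (2 * c)"
    have m1: "c * r1 + d = (a + d + sqrt D) / 2" and m2: "c * r2 + d = (a + d - sqrt D) / 2"
      using False by (auto simp: r1_def r2_def field_simps)
    have sum: "c * (r1 + r2) = a - d" and pr: "c * (r1 * r2) = - b"
      using False sD2 by (auto simp: r1_def r2_def field_simps D' power2_eq_square)
    have q1: "c * r1\<^sup>2 + (d - a) * r1 - b = 0" and q2: "c * r2\<^sup>2 + (d - a) * r2 - b = 0"
      using sum pr by algebra+
    have s0: "0 \<le> sqrt D" using D by simp
    have p1: "c * r1 + d > 0" unfolding m1 using s0 e(2) by (intro divide_pos_pos) linarith+
    have p2: "c * r2 + d > 0" unfolding m2 using sD by simp
    have "(c * r1 + d) * (c * r2 + d) = 1" unfolding m1 m2 using sD2 by (simp add: field_simps D_def power2_eq_square)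
    then have ln0: "ln (c * r1 + d) + ln (c * r2 + d) = 0" using p1 p2 by (metis ln_mult_pos ln_one)
    define L where "L z = Ln (of_real c) + (Ln (z - of_real r1) + Ln (z - of_real r2))" for z
    show ?thesis
    proof (rule that[of L])
      show "continuous_on H2 L" unfolding L_def by (intro continuous_on_add continuous_on_const cont)
      show "exp (L z) = fixq M z" if z: "z \<in> H2" for z
      proof -
        have "exp (L z) = of_real c * ((z - of_real r1) * (z - of_real r2))"
          using nz[OF z] False by (simp add: L_def exp_add)
        also have "\<dots> = of_real c * z\<^sup>2 - of_real (c * (r1 + r2)) * z + of_real (c * (r1 * r2))"
          by (simp add: power2_eq_square algebra_simps)
        also have "\<dots> = fixq M z" unfolding sum pr by (simp add: M algebra_simps)
        finally show ?thesis .
      qed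
      show "L (mob M z) = L z - 2 * Ln (jac M z)" if z: "z \<in> H2" for z
      proof -
        have "complex_of_real (ln (c * r1 + d)) + of_real (ln (c * r2 + d)) = 0"
          using ln0 by (metis of_real_0 of_real_add)
        then have "complex_of_real (ln (c * r2 + d)) = - of_real (ln (c * r1 + d))"
          by (simp add: eq_neg_iff_add_eq_0 add.commute)
        then show ?thesis
          unfolding L_def Ln_minus_root[OF M dt q1 p1 z] Ln_minus_root[OF M dt q2 p2 z] by simp
      qed
    qed
  next
    case c: True
    have ad: "a * d = 1" using e c by simp
    have d0: "d > 0" using jac_notin_nonpos[OF dt, of \<i>] c by (simp add: M complex_nonpos_Reals_iff)
    have j: "jac M z = of_real d" for z by (simp add: M c)
    show ?thesis
    proof (cases "d = a")
      case False
      define r where "r = b / (d - a)"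
      have q: "c * r\<^sup>2 + (d - a) * r - b = 0" using False c by (simp add: r_def)
      have p: "c * r + d > 0" using c d0 by simp
      define L where "L z = Ln (of_real (d - a)) + Ln (z - of_real r)" for z
      show ?thesis
      proof (rule that[of L])
        show "continuous_on H2 L" unfolding L_def by (intro continuous_on_add continuous_on_const cont)
        show "exp (L z) = fixq M z" if z: "z \<in> H2" for z
        proof -
          have "exp (L z) = of_real (d - a) * (z - of_real r)"
            using nz[OF z] False by (simp add: L_def exp_add del: of_real_diff)
          also have "\<dots> = of_real (d - a) * z - of_real ((d - a) * r)" by (simp add: algebra_simps)
          also have "(d - a) * r = b" using False by (simp add: r_def)
          finally show ?thesis by (simp add: M c)
        qed
        show "L (mob M z) = L z - 2 * Ln (jac M z)" if z: "z \<in> H2" for z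
          unfolding L_def Ln_minus_root[OF M dt q p z] using c d0 by (simp add: j Ln_of_real)
      qed
    next
      case True
      then have "d\<^sup>2 = 1" using ad by (simp add: power2_eq_square)
      then have "d = 1" using d0 by (simp add: power2_eq_1_iff)
      with True have a1: "a = 1" "d = 1" by auto
      then have b: "b \<noteq> 0" using nf[of \<i>] by (auto simp: M c)
      show ?thesis
      proof (rule that[of "\<lambda>z. Ln (of_real (- b))"])
        show "exp (Ln (of_real (- b))) = fixq M z" for z using b by (simp add: M c a1)
        show "Ln (of_real (- b)) = Ln (of_real (- b)) - 2 * Ln (jac M z)" for z
          by (simp add: j a1)
      qed simp
    qed
  qed
qed

text \<open>This form isolates the trace: for positive trace the denominator stays in the lower
  half-plane and so has a principal logarithm.\<close>

lemma upair_mob_self: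
  assumes "mdet M = 1" "z \<in> H2"
  shows "upair z (mob M z) = fixq M z / Complex (axf M z) (- mtr M * Im z)"
proof -
  obtain a b c d where M: "M = (a, b, c, d)" by (cases M) auto
  have j: "jac M z \<noteq> 0" using assms by (intro jac_nonzero) auto
  have 1: "mob M z - z = - fixq M z / jac M z"
    using j by (simp add: M field_simps power2_eq_square)
  have "mob M z - cnj z = (of_real a * z + of_real b - cnj z * jac M z) / jac M z"
    using j by (simp add: M diff_divide_distrib)
  also have "of_real a * z + of_real b - cnj z * jac M z = - Complex (axf M z) (- mtr M * Im z)"
    unfolding M axf.simps cmod_power2 by (simp add: complex_eq_iff power2_eq_square algebra_simps)
  finally show ?thesis using j by (simp add: upair_def 1)
qed

text \<open>For a lift of positive trace the change of a continuous logarithm of \<open>upair z (f z)\<close>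
  along \<open>z \<mapsto> f z\<close> is the one given by the principal branch of the Jacobian. The left-hand side is
  a topological notion; the right-hand side knows the sign of the matrix.\<close>
lemma canonical_log:
  assumes M: "ppos M" and s: "continuous_on H2 \<sigma>" "\<And>z. z \<in> H2 \<Longrightarrow> exp (\<sigma> z) = upair z (mob M z)"
    and z: "z \<in> H2"
  shows "\<sigma> (mob M z) = \<sigma> z - 2 * \<i> * ljac M z"
proof -
  have dt: "mdet M = 1" "mtr M \<ge> 2" using M by (auto simp: ppos_def)
  obtain L where L: "continuous_on H2 L" "\<And>z. z \<in> H2 \<Longrightarrow> exp (L z) = fixq M z"
    "\<And>z. z \<in> H2 \<Longrightarrow> L (mob M z) = L z - 2 * Ln (jac M z)" using fixq_log[OF M] by metis
  define T where "T z = Complex (axf M z) (- mtr M * Im z)" for z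
  have T0: "T z \<notin> \<real>\<^sub>\<le>\<^sub>0" if "z \<in> H2" for z
    using that dt by (simp add: T_def complex_nonpos_Reals_iff mult_le_0_iff)
  have axc: "continuous_on H2 (axf M)" by (cases M) (simp add: axf.simps, intro continuous_intros)
  have Tc: "continuous_on H2 T" unfolding T_def Complex_eq
    by (intro continuous_intros axc)
  define \<sigma>0 where "\<sigma>0 z = L z - Ln (T z)" for z
  have c0: "continuous_on H2 \<sigma>0" unfolding \<sigma>0_def using L(1) Tc T0 by (intro continuous_intros) auto
  have e0: "exp (\<sigma>0 z) = upair z (mob M z)" if z: "z \<in> H2" for z
  proof -
    have "T z \<noteq> 0" using T0[OF z] by auto
    then show ?thesis using L(2)[OF z] upair_mob_self[OF dt(1) z] by (simp add: \<sigma>0_def exp_diff T_def)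
  qed
  have f: "mob M z \<in> H2" if "z \<in> H2" for z using mact_H2[of M z] dt that by (simp add: mact_def)
  \<comment> \<open>The numerator changes the logarithm by \<open>- 2 * Ln (jac M z)\<close>. The
    denominator changes by a positive real factor, the squared modulus of the Jacobian, whose
    logarithm cancels the real part; only the phase remains.\<close>
  have r0: "\<sigma>0 (mob M z) = \<sigma>0 z - 2 * \<i> * ljac M z"
  proof -
    have j: "jac M z \<noteq> 0" using dt z by (intro jac_nonzero) auto
    have Tn: "T z \<noteq> 0" "T (mob M z) \<noteq> 0" using T0[OF z] T0[OF f[OF z]] by auto
    have q: "fixq M z \<noteq> 0" using L(2)[OF z] by (metis exp_not_eq_zero)
    have "exp (L (mob M z)) = exp (L z) / (jac M z)\<^sup>2"
      using j by (simp add: L(3)[OF z] exp_diff power2_eq_square exp_double)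
    then have q2: "fixq M z = (jac M z)\<^sup>2 * fixq M (mob M z)" using L(2) z f j by simp
    with q have q': "fixq M (mob M z) \<noteq> 0" by auto
    have "fixq M (mob M z) / T (mob M z) = fixq M z / T z * (cnj (jac M z) / jac M z)"
      using upair_mob[OF dt(1) z f[OF z]] upair_mob_self[OF dt(1) z] upair_mob_self[OF dt(1) f[OF z]]
      by (simp add: T_def)
    then have "T z = (jac M z * cnj (jac M z)) * T (mob M z)"
      using j q' Tn unfolding q2 by (simp add: field_simps power2_eq_square)
    also have "jac M z * cnj (jac M z) = of_real ((cmod (jac M z))\<^sup>2)" by (simp only: complex_norm_square)
    finally have Tz: "T z = of_real ((cmod (jac M z))\<^sup>2) * T (mob M z)" .
    have "0 < (cmod (jac M z))\<^sup>2" using j by simp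
    then have "Ln (T z) = ln ((cmod (jac M z))\<^sup>2) + Ln (T (mob M z))"
      unfolding Tz using Ln_times_of_real[OF _ Tn(2)] Ln_of_real by metis
    moreover have "Ln (jac M z) = ln (cmod (jac M z)) + \<i> * ljac M z"
      using j by (simp add: complex_eq_iff ljac_def)
    ultimately show ?thesis using j by (simp add: \<sigma>0_def L(3)[OF z] ln_realpow algebra_simps)
  qed
  have up0: "upair z (mob M z) \<noteq> 0" if "z \<in> H2" for z
    using e0[OF that] by (metis exp_not_eq_zero)
  obtain n :: int where n: "\<And>z. z \<in> H2 \<Longrightarrow> \<sigma> z - \<sigma>0 z = 2 * pi * \<i> * n"
    by (rule exp_eq_one_constant[of H2 "\<lambda>z. \<sigma> z - \<sigma>0 z"])
       (use s c0 e0 up0 in \<open>auto intro!: continuous_intros convex_connected convex_H2 simp: exp_diff\<close>)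
  have "\<sigma> (mob M z) - \<sigma>0 (mob M z) = \<sigma> z - \<sigma>0 z" using n z f by simp
  then show ?thesis using r0 by (simp add: algebra_simps)
qed

text \<open>\<open>\<Lambda>\<close> lifts the map induced by \<open>D\<close> on pairs of distinct points; \<open>d\<close> is the degree of \<open>D\<close>.\<close>
definition pair_lift :: "(complex \<Rightarrow> complex) \<Rightarrow> (complex \<times> complex \<Rightarrow> complex) \<Rightarrow> int \<Rightarrow> bool" where
  "pair_lift D \<Lambda> d \<longleftrightarrow> continuous_on pair_cover \<Lambda> \<and>
     (\<forall>p s. p \<in> H2 \<longrightarrow> Re s < 0 \<longrightarrow> exp (\<Lambda> (p, s)) = upair (D p) (D (qpt p s))) \<and>
     (\<forall>p s n. p \<in> H2 \<longrightarrow> Re s < 0 \<longrightarrow> \<Lambda> (p, s + 2 * pi * \<i> * of_int n) = \<Lambda> (p, s) + 2 * pi * \<i> * of_int (d * n))"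

section \<open>Lifting homeomorphisms to the cover of pairs\<close>

lemma pair_coverE:
  assumes "x \<in> pair_cover" obtains p s where "x = (p, s)" "p \<in> H2" "Re s < 0"
  using assms by (auto simp: pair_cover_def)

lemma convex_pair_cover: "convex pair_cover"
  unfolding pair_cover_def by (intro convex_Times convex_H2 convex_halfspace_Re_lt)

lemma continuous_on_qpt: "continuous_on pair_cover (\<lambda>x. qpt (fst x) (snd x))"
  unfolding qpt_def pair_cover_def using exp_neq_1_of_Re
  by (intro continuous_intros) (auto simp: mem_Times_iff)

lemma continuous_on_pair_cover_fst:
  "continuous_on H2 f \<Longrightarrow> continuous_on pair_cover (\<lambda>x. f (fst x))"
  by (rule continuous_on_compose2[OF _ continuous_on_fst[OF continuous_on_id]]) (auto simp: pair_cover_def)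

lemma homeomorphism_H2D:
  assumes "homeomorphism H2 H2 D D'"
  shows "\<And>z. z \<in> H2 \<Longrightarrow> D z \<in> H2" "\<And>z. z \<in> H2 \<Longrightarrow> D' z \<in> H2"
    "\<And>z. z \<in> H2 \<Longrightarrow> D' (D z) = z" "\<And>z. z \<in> H2 \<Longrightarrow> D (D' z) = z"
    "continuous_on H2 D" "continuous_on H2 D'"
  using assms unfolding homeomorphism_def by blast+

text \<open>The cover is convex, so the nowhere vanishing function \<open>F\<close> has a logarithm
  on it. As \<open>F\<close> is invariant under deck transformations, the logarithm changes under
  the generator by a constant multiple of \<open>2 * pi * \<i>\<close>, and this multiple is the
  degree.\<close>

lemma pair_lift_exists:
  assumes hom: "homeomorphism H2 H2 D D'"
  obtains \<Lambda> d where "pair_lift D \<Lambda> d"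
proof -
  note D = homeomorphism_H2D[OF hom]
  define F where "F x = upair (D (fst x)) (D (qpt (fst x) (snd x)))" for x
  have q: "qpt (fst x) (snd x) \<in> H2" if "x \<in> pair_cover" for x
    using that qpt_H2 by (auto simp: pair_cover_def)
  have "continuous_on pair_cover (\<lambda>x. D (qpt (fst x) (snd x)))"
    using q by (intro continuous_on_compose2[OF D(5) continuous_on_qpt]) auto
  then have cF: "continuous_on pair_cover F" unfolding F_def
    using D(1) q by (intro continuous_on_upair continuous_on_pair_cover_fst[OF D(5)])
      (auto simp: pair_cover_def simp del: H2_iff)
  have nF: "F x \<noteq> 0" if mx: "x \<in> pair_cover" for x
  proof -
    obtain p s where x: "x = (p, s)" "p \<in> H2" "Re s < 0" using pair_coverE[OF mx] by metis
    have "D (qpt p s) \<noteq> D p" using D(3) qpt_H2 qpt_neq x by metis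
    then show ?thesis using upair_eq_0 D x qpt_H2 by (simp add: F_def)
  qed
  obtain \<Lambda> where L: "continuous_on pair_cover \<Lambda>" "\<And>x. x \<in> pair_cover \<Longrightarrow> F x = exp (\<Lambda> x)"
    using continuous_logarithm_on_contractible[OF cF convex_imp_contractible[OF convex_pair_cover] nF] by metis
  let ?T = "\<lambda>x::complex \<times> complex. (fst x, snd x + 2 * pi * \<i>)"
  have T: "?T x \<in> pair_cover" if "x \<in> pair_cover" for x using that by (auto simp: pair_cover_def)
  have FT: "F (?T x) = F x" for x by (simp add: F_def qpt_def exp_add)
  have cc: "continuous_on pair_cover (\<lambda>x. \<Lambda> (?T x) - \<Lambda> x)"
    using T by (intro continuous_intros L continuous_on_compose2[OF L(1)]) auto
  have ee: "exp (\<Lambda> (?T x) - \<Lambda> x) = 1" if "x \<in> pair_cover" for x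
    using L(2)[OF that] L(2)[OF T[OF that]] FT[of x] nF[OF that] by (simp add: exp_diff)
  obtain d :: int where d: "\<And>x. x \<in> pair_cover \<Longrightarrow> \<Lambda> (?T x) - \<Lambda> x = 2 * pi * \<i> * d"
    using exp_eq_one_constant[OF convex_connected[OF convex_pair_cover] cc ee] by blast
  have step: "\<Lambda> (p, s + 2 * pi * \<i>) = \<Lambda> (p, s) + 2 * pi * \<i> * d" if "p \<in> H2" "Re s < 0" for p s
    using d[of "(p, s)"] that by (simp add: pair_cover_def algebra_simps)
  have stepn: "\<Lambda> (p, s + 2 * pi * \<i> * of_nat n) = \<Lambda> (p, s) + 2 * pi * \<i> * (d * of_nat n)"
    if "p \<in> H2" "Re s < 0" for p s n
  proof (induction n)
    case (Suc n)
    have "\<Lambda> (p, s + 2 * pi * \<i> * of_nat (Suc n)) = \<Lambda> (p, (s + 2 * pi * \<i> * of_nat n) + 2 * pi * \<i>)"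
      by (simp add: algebra_simps)
    then show ?case using step[of p "s + 2 * pi * \<i> * of_nat n"] that Suc by (simp add: algebra_simps)
  qed simp
  have "\<Lambda> (p, s + 2 * pi * \<i> * of_int n) = \<Lambda> (p, s) + 2 * pi * \<i> * of_int (d * n)"
    if "p \<in> H2" "Re s < 0" for p s n
  proof (cases n)
    case (nonneg m)
    then show ?thesis using stepn[of p s m] that by simp
  next
    case (neg m)
    show ?thesis using stepn[of p "s + 2 * pi * \<i> * of_int n" "Suc m"] that
      unfolding neg by (simp add: algebra_simps)
  qed
  then have "pair_lift D \<Lambda> d"
    unfolding pair_lift_def using L by (auto simp: pair_cover_def F_def)
  then show ?thesis by (rule that)
qed

lemma pair_lift_neg_Re:
  assumes "homeomorphism H2 H2 D D'" "pair_lift D \<Lambda> d" "p \<in> H2" "Re s < 0"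
  shows "Re (\<Lambda> (p, s)) < 0" "qpt (D p) (\<Lambda> (p, s)) = D (qpt p s)"
proof -
  note D = homeomorphism_H2D[OF assms(1)]
  have "upair (D p) (D (qpt p s)) = exp (\<Lambda> (p, s))" using assms by (auto simp: pair_lift_def)
  then show "Re (\<Lambda> (p, s)) < 0" "qpt (D p) (\<Lambda> (p, s)) = D (qpt p s)"
    using qpt_unique[OF D(1)[OF assms(3)] D(1)[OF qpt_H2[OF assms(3,4)]]] by auto
qed

text \<open>A lift of \<open>D\<close> followed by a lift of \<open>D'\<close> is a lift of the
  identity up to a deck transformation, which gives \<open>d' * d = 1\<close>.\<close>

lemma pair_lift_degree_nonzero:
  assumes hom: "homeomorphism H2 H2 D D'" and L: "pair_lift D \<Lambda> d"
  shows "d \<noteq> 0"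
proof -
  note D = homeomorphism_H2D[OF hom]
  obtain \<Lambda>' d' where L': "pair_lift D' \<Lambda>' d'"
    using pair_lift_exists[OF homeomorphism_symD[OF hom]] by blast
  have Lc: "continuous_on pair_cover \<Lambda>" "continuous_on pair_cover \<Lambda>'" using L L' by (auto simp: pair_lift_def)
  have Ld: "\<And>p s n. p \<in> H2 \<Longrightarrow> Re s < 0 \<Longrightarrow> \<Lambda> (p, s + 2 * pi * \<i> * of_int n) = \<Lambda> (p, s) + 2 * pi * \<i> * of_int (d * n)"
    and Ld': "\<And>p s n. p \<in> H2 \<Longrightarrow> Re s < 0 \<Longrightarrow> \<Lambda>' (p, s + 2 * pi * \<i> * of_int n) = \<Lambda>' (p, s) + 2 * pi * \<i> * of_int (d' * n)"
    using L L' by (auto simp: pair_lift_def)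
  define \<delta> where "\<delta> x = \<Lambda>' (D (fst x), \<Lambda> x) - snd x" for x
  have mem: "(D (fst x), \<Lambda> x) \<in> pair_cover" if "x \<in> pair_cover" for x
    using that pair_lift_neg_Re[OF hom L] D by (cases x) (auto simp: pair_cover_def)
  have cc: "continuous_on pair_cover \<delta>" unfolding \<delta>_def
    by (intro continuous_intros continuous_on_compose2[OF Lc(2)] image_subsetI[OF mem] Lc(1)
        continuous_on_pair_cover_fst[OF D(5)])
  have ee: "exp (\<delta> x) = 1" if mx: "x \<in> pair_cover" for x
  proof -
    obtain p s where x: "x = (p, s)" "p \<in> H2" "Re s < 0" using pair_coverE[OF mx] by metis
    have "exp (\<Lambda>' (D p, \<Lambda> (p, s))) = upair (D' (D p)) (D' (qpt (D p) (\<Lambda> (p, s))))"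
      using L' D x pair_lift_neg_Re[OF hom L x(2,3)] by (auto simp: pair_lift_def)
    also have "\<dots> = exp s" using pair_lift_neg_Re(2)[OF hom L x(2,3)] D x qpt_H2 upair_qpt by simp
    finally show ?thesis by (simp add: \<delta>_def x exp_diff)
  qed
  obtain n :: int where n: "\<And>x. x \<in> pair_cover \<Longrightarrow> \<delta> x = 2 * pi * \<i> * n"
    using exp_eq_one_constant[OF convex_connected[OF convex_pair_cover] cc ee] by blast
  have m: "(\<i>, -1) \<in> pair_cover" "(\<i>, -1 + 2 * pi * \<i> * of_int 1) \<in> pair_cover" by (auto simp: pair_cover_def)
  have "\<delta> (\<i>, -1 + 2 * pi * \<i> * of_int 1) = \<delta> (\<i>, -1)" using n m by metis
  moreover have "\<Lambda> (\<i>, -1 + 2 * pi * \<i> * of_int 1) = \<Lambda> (\<i>, -1) + 2 * pi * \<i> * of_int (d * 1)"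
    by (rule Ld) auto
  moreover have "\<Lambda>' (D \<i>, \<Lambda> (\<i>, -1) + 2 * pi * \<i> * of_int (d * 1)) =
      \<Lambda>' (D \<i>, \<Lambda> (\<i>, -1)) + 2 * pi * \<i> * of_int (d' * (d * 1))"
    using mem[OF m(1)] by (intro Ld') (auto simp: pair_cover_def)
  ultimately have "2 * pi * \<i> * of_int (d' * d) = 2 * pi * \<i>" by (simp add: \<delta>_def algebra_simps)
  then show ?thesis by auto
qed

text \<open>A homeomorphism cannot conjugate an orientation-preserving isometry to a reversing one:
  comparing the two sides after one turn around the base point gives \<open>d = - d\<close>.\<close>
lemma no_conj_preserving_reversing:
  assumes hom: "homeomorphism H2 H2 D D'" and M: "mdet M = 1" and M': "mdet M' = - 1"
    and eq: "\<And>z. z \<in> H2 \<Longrightarrow> D (mact M z) = mact M' (D z)"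
  shows False
proof -
  note D = homeomorphism_H2D[OF hom]
  obtain \<Lambda> d where L: "pair_lift D \<Lambda> d" using pair_lift_exists[OF hom] by blast
  have Lc: "continuous_on pair_cover \<Lambda>" and Le: "\<And>p s. p \<in> H2 \<Longrightarrow> Re s < 0 \<Longrightarrow> exp (\<Lambda> (p, s)) = upair (D p) (D (qpt p s))"
    and Ld: "\<And>p s n. p \<in> H2 \<Longrightarrow> Re s < 0 \<Longrightarrow> \<Lambda> (p, s + 2 * pi * \<i> * of_int n) = \<Lambda> (p, s) + 2 * pi * \<i> * of_int (d * n)"
    using L by (auto simp: pair_lift_def)
  have con: "contractible H2" by (rule convex_imp_contractible[OF convex_H2])
  have j: "jac M p \<noteq> 0" "jac M' p \<noteq> 0" if "p \<in> H2" for p using that M M' by (simp_all add: jac_nonzero)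
  \<comment> \<open>The trace is unrestricted here, so the phase of the Jacobian is lifted by
    contractibility of the half-plane instead of the principal branch.\<close>
  obtain \<theta> where th: "continuous_on H2 \<theta>" "\<And>p. p \<in> H2 \<Longrightarrow> cnj (jac M p) / jac M p = exp (\<theta> p)"
    by (rule continuous_logarithm_on_contractible[of H2 "\<lambda>p. cnj (jac M p) / jac M p"])
       (use con j in \<open>auto intro!: continuous_intros\<close>)
  obtain \<omega> where om: "continuous_on H2 \<omega>" "\<And>p. p \<in> H2 \<Longrightarrow> jac M' p / cnj (jac M' p) = exp (\<omega> p)"
    by (rule continuous_logarithm_on_contractible[of H2 "\<lambda>p. jac M' p / cnj (jac M' p)"])
       (use con j in \<open>auto intro!: continuous_intros\<close>)
  have th0: "Re (\<theta> p) = 0" if "p \<in> H2" for p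
  proof -
    have "norm (exp (\<theta> p)) = 1" using j[OF that] th(2)[OF that, symmetric] by (simp add: norm_divide)
    then show ?thesis by simp
  qed
  have fM: "mact M p \<in> H2" if "p \<in> H2" for p using mact_H2 M that by simp
  have mob: "mact M p = mob M p" for p using M by (simp add: mact_def)
  define f where "f x = (mact M (fst x), snd x + \<theta> (fst x))" for x
  have f: "f x \<in> pair_cover" if "x \<in> pair_cover" for x using that fM th0 by (auto simp: f_def pair_cover_def)
  define \<delta> where "\<delta> x = \<Lambda> (f x) - cnj (\<Lambda> x) - \<omega> (D (fst x))" for x
  have fc: "continuous_on pair_cover f" unfolding f_def
    by (intro continuous_intros continuous_on_pair_cover_fst[OF continuous_on_mact] continuous_on_pair_cover_fst[OF th(1)])
       (simp add: M)
  have cc: "continuous_on pair_cover \<delta>" unfolding \<delta>_def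
    by (intro continuous_intros continuous_on_compose2[OF Lc fc] image_subsetI[OF f] Lc
        continuous_on_pair_cover_fst[of "\<lambda>z. \<omega> (D z)"] continuous_on_compose2[OF om(1) D(5)] image_subsetI[OF D(1)])
  have ee: "exp (\<delta> x) = 1" if mx: "x \<in> pair_cover" for x
  proof -
    obtain p s where x: "x = (p, s)" "p \<in> H2" "Re s < 0" using pair_coverE[OF mx] by metis
    have q: "qpt p s \<in> H2" using qpt_H2 x by simp
    have u: "upair (mact M p) (mact M (qpt p s)) = exp (s + \<theta> p)"
      using upair_mob[OF M x(2) q] upair_qpt[OF x(2,3)] th(2)[OF x(2)] by (simp add: mob exp_add)
    have "qpt (mact M p) (s + \<theta> p) = mact M (qpt p s)"
      by (rule qpt_unique(1)[OF fM[OF x(2)] fM[OF q] u])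
    then have "exp (\<Lambda> (f x)) = upair (D (mact M p)) (D (mact M (qpt p s)))"
      using Le[of "mact M p" "s + \<theta> p"] fM x th0 by (simp add: f_def)
    also have "\<dots> = upair (mact M' (D p)) (mact M' (D (qpt p s)))" using eq x q by simp
    also have "\<dots> = cnj (exp (\<Lambda> x)) * exp (\<omega> (D p))"
      using upair_mact_reversing[OF M' D(1)[OF x(2)] D(1)[OF q]] om(2)[OF D(1)[OF x(2)]] Le[OF x(2,3)] by (simp add: x)
    finally show ?thesis by (simp add: \<delta>_def exp_diff exp_cnj x)
  qed
  obtain n :: int where n: "\<And>x. x \<in> pair_cover \<Longrightarrow> \<delta> x = 2 * pi * \<i> * n"
    using exp_eq_one_constant[OF convex_connected[OF convex_pair_cover] cc ee] by blast
  have m: "(\<i>, -1) \<in> pair_cover" "(\<i>, -1 + 2 * pi * \<i> * of_int 1) \<in> pair_cover" by (auto simp: pair_cover_def)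
  have "\<delta> (\<i>, -1 + 2 * pi * \<i> * of_int 1) = \<delta> (\<i>, -1)" using n m by metis
  moreover have "\<Lambda> (\<i>, -1 + 2 * pi * \<i> * of_int 1) = \<Lambda> (\<i>, -1) + 2 * pi * \<i> * of_int (d * 1)"
    by (rule Ld) auto
  moreover have "\<Lambda> (mact M \<i>, (-1 + \<theta> \<i>) + 2 * pi * \<i> * of_int 1) = \<Lambda> (mact M \<i>, -1 + \<theta> \<i>) + 2 * pi * \<i> * of_int (d * 1)"
    using fM th0 by (intro Ld) auto
  ultimately have "2 * pi * \<i> * of_int d = 2 * pi * cnj \<i> * of_int d" by (simp add: \<delta>_def f_def algebra_simps)
  then have "d = 0" by (simp add: complex_eq_iff)
  then show False using pair_lift_degree_nonzero[OF hom L] by simp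
qed

text \<open>Both sides lift the same map of pairs and so differ by a deck transformation. It is
  trivial because both sides agree over the pairs \<open>(p, mob M p)\<close>: there
  \<open>canonical_log\<close> gives the shift for \<open>M\<close> and, applied to the logarithm
  transported by \<open>D\<close>, the shift for \<open>M'\<close>.\<close>

lemma pair_lift_equivariant:
  assumes hom: "homeomorphism H2 H2 D D'" and L: "pair_lift D \<Lambda> d"
    and M: "ppos M" and M': "ppos M'"
    and eq: "\<And>z. z \<in> H2 \<Longrightarrow> D (mob M z) = mob M' (D z)"
    and p: "p \<in> H2" and s: "Re s < 0"
  shows "\<Lambda> (mob M p, s - 2 * \<i> * ljac M p) = \<Lambda> (p, s) - 2 * \<i> * ljac M' (D p)"
proof -
  note D = homeomorphism_H2D[OF hom]
  have Lc: "continuous_on pair_cover \<Lambda>" and Le: "\<And>p s. p \<in> H2 \<Longrightarrow> Re s < 0 \<Longrightarrow> exp (\<Lambda> (p, s)) = upair (D p) (D (qpt p s))"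
    using L by (auto simp: pair_lift_def)
  have dt: "mdet M = 1" "mtr M \<ge> 2" "mdet M' = 1" "mtr M' \<ge> 2" and nf: "\<And>z. z \<in> H2 \<Longrightarrow> mob M z \<noteq> z"
    using M M' by (auto simp: ppos_def)
  have mob: "mact M p = mob M p" for p using dt by (simp add: mact_def)
  have fM: "mob M p \<in> H2" if "p \<in> H2" for p using mact_H2[of M p] dt that mob by simp
  have j: "jac M p \<noteq> 0" "jac M' p \<noteq> 0" if "p \<in> H2" for p using that dt by (simp_all add: jac_nonzero)
  have cmob: "continuous_on H2 (mob M)" using continuous_on_mact[of M] dt by (simp add: mob cong: continuous_on_cong)
  have up: "upair (mob M p) (mob M q) = exp (s - 2 * \<i> * ljac M p)"
    if "p \<in> H2" "q \<in> H2" "upair p q = exp s" for p q s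
    using upair_mob[OF dt(1) that(1,2)] that phase_exp[OF j(1)[OF that(1)]] by (simp add: exp_diff exp_minus field_simps)
  have up': "upair (mob M' p) (mob M' q) = exp (s - 2 * \<i> * ljac M' p)"
    if "p \<in> H2" "q \<in> H2" "upair p q = exp s" for p q s
    using upair_mob[OF dt(3) that(1,2)] that phase_exp[OF j(2)[OF that(1)]] by (simp add: exp_diff exp_minus field_simps)
  define f where "f x = (mob M (fst x), snd x - 2 * \<i> * ljac M (fst x))" for x
  have f: "f x \<in> pair_cover" if "x \<in> pair_cover" for x using that fM by (auto simp: f_def pair_cover_def)
  have fc: "continuous_on pair_cover f" unfolding f_def
    by (intro continuous_intros continuous_on_pair_cover_fst[OF cmob] continuous_on_pair_cover_fst[OF continuous_on_ljac[OF dt(1,2)]])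
  define \<delta> where "\<delta> x = \<Lambda> (f x) - \<Lambda> x + 2 * \<i> * ljac M' (D (fst x))" for x
  have cc: "continuous_on pair_cover \<delta>" unfolding \<delta>_def
    by (intro continuous_intros continuous_on_compose2[OF Lc fc] image_subsetI[OF f] Lc
        continuous_on_pair_cover_fst[of "\<lambda>z. ljac M' (D z)"]
        continuous_on_compose2[OF continuous_on_ljac[OF dt(3,4)] D(5)] image_subsetI[OF D(1)])
  have ee: "exp (\<delta> x) = 1" if mx: "x \<in> pair_cover" for x
  proof -
    obtain p s where x: "x = (p, s)" "p \<in> H2" "Re s < 0" using pair_coverE[OF mx] by metis
    have q: "qpt p s \<in> H2" using qpt_H2 x by simp
    have u: "upair (mob M p) (mob M (qpt p s)) = exp (s - 2 * \<i> * ljac M p)"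
      using up[OF x(2) q upair_qpt[OF x(2,3)]] .
    have "qpt (mob M p) (s - 2 * \<i> * ljac M p) = mob M (qpt p s)"
      by (rule qpt_unique(1)[OF fM[OF x(2)] fM[OF q] u])
    then have "exp (\<Lambda> (f x)) = upair (D (mob M p)) (D (mob M (qpt p s)))"
      using Le[of "mob M p" "s - 2 * \<i> * ljac M p"] fM x by (simp add: f_def)
    also have "\<dots> = upair (mob M' (D p)) (mob M' (D (qpt p s)))" using eq x q by simp
    also have "\<dots> = exp (\<Lambda> x - 2 * \<i> * ljac M' (D p))"
      using up'[OF D(1)[OF x(2)] D(1)[OF q]] Le[OF x(2,3)] by (simp add: x)
    finally show ?thesis by (simp add: \<delta>_def exp_diff exp_add x)
  qed
  obtain n :: int where n: "\<And>x. x \<in> pair_cover \<Longrightarrow> \<delta> x = 2 * pi * \<i> * n"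
    using exp_eq_one_constant[OF convex_connected[OF convex_pair_cover] cc ee] by blast
  txt \<open>The constant is computed on the lift of the pairs \<open>(p, M p)\<close>.\<close>
  have fc0: "upair p (mob M p) \<noteq> 0" if "p \<in> H2" for p using upair_eq_0 that fM nf by simp
  obtain \<sigma> where sg: "continuous_on H2 \<sigma>" "\<And>p. p \<in> H2 \<Longrightarrow> upair p (mob M p) = exp (\<sigma> p)"
    by (rule continuous_logarithm_on_contractible[of H2 "\<lambda>p. upair p (mob M p)"])
       (use fM fc0 cmob in \<open>auto intro!: continuous_intros convex_imp_contractible[OF convex_H2] simp del: H2_iff\<close>)
  have q: "qpt p (\<sigma> p) = mob M p" "Re (\<sigma> p) < 0" if "p \<in> H2" for p
    using qpt_unique[OF that fM[OF that] sg(2)[OF that]] by auto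
  have mem: "(p, \<sigma> p) \<in> pair_cover" if "p \<in> H2" for p using q that by (simp add: pair_cover_def)
  \<comment> \<open>The transport by \<open>D\<close> of the logarithm \<open>\<sigma>\<close>. It
    is a continuous logarithm for \<open>M'\<close>, so \<open>canonical_log\<close> applies to it
    as well.\<close>
  define \<mu> where "\<mu> p' = \<Lambda> (D' p', \<sigma> (D' p'))" for p'
  have "continuous_on H2 (\<lambda>p'. (D' p', \<sigma> (D' p')))"
    using D by (intro continuous_intros continuous_on_compose2[OF sg(1)]) auto
  then have "continuous_on H2 \<mu>" unfolding \<mu>_def
    using D mem by (intro continuous_on_compose2[OF Lc]) auto
  moreover have "exp (\<mu> p') = upair p' (mob M' p')" if "p' \<in> H2" for p'
    using Le[OF D(2)[OF that] q(2)[OF D(2)[OF that]]] q(1)[OF D(2)[OF that]] eq[OF D(2)[OF that]] D(4)[OF that]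
    by (simp add: \<mu>_def)
  ultimately have 1: "\<mu> (mob M' (D p)) = \<mu> (D p) - 2 * \<i> * ljac M' (D p)"
    using canonical_log[OF M'] D(1)[OF p] by blast
  have 2: "\<sigma> (mob M p) = \<sigma> p - 2 * \<i> * ljac M p" using canonical_log[OF M sg(1) _ p] sg(2) by simp
  have "\<delta> (p, \<sigma> p) = 0"
    using 1 by (simp add: \<delta>_def f_def \<mu>_def 2[symmetric] eq[OF p, symmetric] D(3)[OF p] D(3)[OF fM[OF p]])
  then have "n = 0" using n[OF mem[OF p]] by simp
  then have "\<delta> (p, s) = 0" using n[of "(p, s)"] p s by (simp add: pair_cover_def)
  then show ?thesis by (simp add: \<delta>_def f_def algebra_simps)
qed

text \<open>The arguments of the Jacobians of \<open>B\<close> and \<open>A\<close> add up to that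
  of \<open>mmul A B\<close> plus \<open>2 * pi * n\<close>, and doubling this phase shifts the
  cover by \<open>2 * n\<close> turns. The lift of \<open>D\<close> multiplies the number of turns
  by \<open>d\<close>, so it stays even, and the Jacobians on the primed side must also multiply
  with sign \<open>+ 1\<close>.\<close>

lemma conj_sign_invariant:
  assumes hom: "homeomorphism H2 H2 D D'"
    and M: "ppos A" "ppos B" "ppos (mmul A B)" and M': "ppos A'" "ppos B'" "ppos C'"
    and C': "C' = mscale \<epsilon> (mmul A' B')"
    and A: "\<And>z. z \<in> H2 \<Longrightarrow> D (mob A z) = mob A' (D z)"
    and B: "\<And>z. z \<in> H2 \<Longrightarrow> D (mob B z) = mob B' (D z)"
  shows "\<epsilon> = 1"
proof -
  note D = homeomorphism_H2D[OF hom]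
  obtain \<Lambda> d where L: "pair_lift D \<Lambda> d" using pair_lift_exists[OF hom] by blast
  have Ld: "\<And>p s n. p \<in> H2 \<Longrightarrow> Re s < 0 \<Longrightarrow> \<Lambda> (p, s + 2 * pi * \<i> * of_int n) = \<Lambda> (p, s) + 2 * pi * \<i> * of_int (d * n)"
    using L by (auto simp: pair_lift_def)
  let ?C = "mmul A B"
  have dt: "mdet A = 1" "mdet B = 1" "mdet A' = 1" "mdet B' = 1" "mdet C' = 1"
    using M M' by (auto simp: ppos_def)
  then have e2: "\<epsilon>\<^sup>2 = 1" using C' by (simp add: mdet_mscale mdet_mmul)
  then have e0: "\<epsilon> \<noteq> 0" by auto
  have H: "mob N z \<in> H2" if "mdet N = 1" "z \<in> H2" for N z using mact_H2[of N z] that by (simp add: mact_def)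
  have jn: "jac N z \<noteq> 0" if "mdet N = 1" "z \<in> H2" for N z using that by (simp add: jac_nonzero)
  define p where "p = \<i>"
  define p' where "p' = D p"
  define s :: complex where "s = - 1"
  have p: "p \<in> H2" and p': "p' \<in> H2" and s: "Re s < 0" using D(1)[of \<i>] by (auto simp: p_def p'_def s_def)
  have C: "D (mob ?C z) = mob C' (D z)" if "z \<in> H2" for z
    using mob_mmul[of B z A] mob_mmul[of B' "D z" A'] that A B D H jn dt
    by (simp add: C' mob_mscale[OF e0])
  have jC: "jac ?C p = jac A (mob B p) * jac B p" using jac_mmul jn dt p by blast
  have jC': "jac C' p' = \<epsilon> * (jac A' (mob B' p') * jac B' p')"
  proof -
    have "jac C' p' = \<epsilon> * jac (mmul A' B') p'" unfolding C' by (cases "mmul A' B'") (simp add: algebra_simps)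
    then show ?thesis using jac_mmul[of B' p' A'] jn dt p' by simp
  qed
  have "exp (Ln (jac A (mob B p)) + Ln (jac B p) - Ln (jac ?C p)) = 1"
    using jn dt p H jC by (simp add: exp_diff exp_add)
  then obtain n :: int where "Im (Ln (jac A (mob B p)) + Ln (jac B p) - Ln (jac ?C p)) = of_int (2 * n) * pi"
    unfolding exp_eq_1 by blast
  then have n: "ljac B p + ljac A (mob B p) = ljac ?C p + 2 * pi * n" by (simp add: ljac_def algebra_simps)
  have a: "\<Lambda> (mob A (mob B p), (s - 2 * \<i> * ljac B p) - 2 * \<i> * ljac A (mob B p))
      = \<Lambda> (p, s) - 2 * \<i> * ljac B' p' - 2 * \<i> * ljac A' (mob B' p')"
    using pair_lift_equivariant[OF hom L M(1) M'(1) A H[OF dt(2) p], of "s - 2 * \<i> * ljac B p"]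
      pair_lift_equivariant[OF hom L M(2) M'(2) B p s] B[OF p] s by (simp add: p'_def)
  have b: "(s - 2 * \<i> * ljac B p) - 2 * \<i> * ljac A (mob B p) = (s - 2 * \<i> * ljac ?C p) + 2 * pi * \<i> * of_int (- 2 * n)"
  proof -
    have "(s - 2 * \<i> * ljac B p) - 2 * \<i> * ljac A (mob B p) = s - 2 * \<i> * (ljac B p + ljac A (mob B p))"
      by (simp add: algebra_simps)
    also have "\<dots> = s - 2 * \<i> * complex_of_real (ljac ?C p + 2 * pi * n)" unfolding n[symmetric] by simp
    also have "\<dots> = (s - 2 * \<i> * ljac ?C p) + 2 * pi * \<i> * of_int (- 2 * n)" by (simp add: algebra_simps)
    finally show ?thesis .
  qed
  have c: "mob A (mob B p) = mob ?C p" using mob_mmul[of B p A] jn dt p by simp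
  have e: "\<Lambda> (mob ?C p, (s - 2 * \<i> * ljac ?C p) + 2 * pi * \<i> * of_int (- 2 * n))
     = \<Lambda> (p, s) - 2 * \<i> * ljac C' p' + 2 * pi * \<i> * of_int (d * (- 2 * n))"
  proof -
    have "\<Lambda> (mob ?C p, (s - 2 * \<i> * ljac ?C p) + 2 * pi * \<i> * of_int (- 2 * n))
       = \<Lambda> (mob ?C p, s - 2 * \<i> * ljac ?C p) + 2 * pi * \<i> * of_int (d * (- 2 * n))"
      using H[of ?C p] dt p s by (intro Ld) (auto simp: mdet_mmul)
    then show ?thesis using pair_lift_equivariant[OF hom L M(3) M'(3) C p s] by (simp add: p'_def)
  qed
  have "\<Lambda> (p, s) - 2 * \<i> * ljac B' p' - 2 * \<i> * ljac A' (mob B' p')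
      = \<Lambda> (p, s) - 2 * \<i> * ljac C' p' + 2 * pi * \<i> * of_int (d * (- 2 * n))"
    by (rule trans[OF sym[OF a]], unfold b c) (rule e)
  then have "2 * \<i> * ljac B' p' + 2 * \<i> * ljac A' (mob B' p') = 2 * \<i> * ljac C' p' + 2 * pi * \<i> * of_int (d * 2 * n)"
    by (simp add: algebra_simps)
  then have k: "ljac B' p' + ljac A' (mob B' p') - ljac C' p' = of_int (2 * (d * n)) * pi"
    by (simp add: complex_eq_iff algebra_simps)
  define x where "x = Ln (jac A' (mob B' p')) + Ln (jac B' p') - Ln (jac C' p')"
  have ex: "exp x * \<epsilon> = 1" unfolding x_def using jn dt p' H jC' e0 by (simp add: exp_diff exp_add)
  then have "norm (exp x) * \<bar>\<epsilon>\<bar> = 1" by (metis norm_mult norm_of_real norm_one)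
  moreover have "\<bar>\<epsilon>\<bar> = 1" using e2 by (simp add: abs_square_eq_1)
  ultimately have "Re x = 0" by simp
  moreover have "Im x = of_int (2 * (d * n)) * pi" using k by (simp add: x_def ljac_def)
  ultimately have "exp x = 1" unfolding exp_eq_1 by blast
  with ex show ?thesis by simp
qed

section \<open>Traces of Fricke representations\<close>

lemma fixed_point_of_small_trace:
  assumes "mdet M = 1" "\<bar>mtr M\<bar> < 2"
  shows "\<exists>z\<in>H2. mob M z = z"
proof -
  obtain a b c d where M: "M = (a, b, c, d)" by (cases M) auto
  have e: "a * d - b * c = 1" using assms M by simp
  have t: "(a + d)\<^sup>2 < 4" using power_strict_mono[of "\<bar>a + d\<bar>" 2 2] assms(2) M by simp
  have c: "c \<noteq> 0"
  proof
    assume "c = 0"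
    then have "(a + d)\<^sup>2 = (a - d)\<^sup>2 + 4" using e by (simp add: power2_eq_square algebra_simps)
    then show False using t zero_le_power2[of "a - d"] by linarith
  qed
  \<comment> \<open>The imaginary part of a root of \<open>fixq M\<close>; the absolute value
    selects the root in the upper half-plane.\<close>
  define y where "y = sqrt (4 - (a + d)\<^sup>2) / (2 * \<bar>c\<bar>)"
  define z where "z = Complex ((a - d) / (2 * c)) y"
  have y: "y > 0" using t c by (simp add: y_def)
  have y2: "c\<^sup>2 * y\<^sup>2 = (4 - (a + d)\<^sup>2) / 4" using t c by (simp add: y_def power_divide power_mult_distrib)
  have "c * fixq M z = 0"
  proof -
    have "Re (fixq M z) * c = ((a - d)\<^sup>2 / 4 - c\<^sup>2 * y\<^sup>2) - (a - d)\<^sup>2 / 2 - b * c"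
      using c by (simp add: M z_def power2_eq_square field_simps)
    also have "\<dots> = 0" unfolding y2 using e by (simp add: power2_eq_square field_simps)
    finally have "Re (fixq M z) = 0" using c by simp
    moreover have "Im (fixq M z) = 0" using c by (simp add: M z_def power2_eq_square field_simps)
    ultimately show ?thesis by (simp add: complex_eq_iff)
  qed
  then have "upair z (mob M z) = 0" using upair_mob_self[OF assms(1)] c y by (simp add: z_def)
  moreover have z: "z \<in> H2" using y by (simp add: z_def)
  moreover have "mob M z \<in> H2" using mact_H2[of M z] z assms by (simp add: mact_def)
  ultimately show ?thesis using upair_eq_0 by blast
qed

section \<open>The reference structure and the signs of the traces\<close>

definition XR :: mat2 where "XR = (2, 1, 1, 0)"
definition YR :: mat2 where "YR = (0, 1, 1, 2)"

lemma X0_mact: "X0 = mact XR" and Y0_mact: "Y0 = mact YR"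
  by (auto simp: X0_def Y0_def XR_def YR_def mact_def fun_eq_iff)

text \<open>The inverse, for matrices of determinant \<open>- 1\<close> only.\<close>
definition minv :: "mat2 \<Rightarrow> mat2" where "minv Y = mscale (- 1) (madj Y)"

lemma mdet_minv [simp]: "mdet (minv Y) = mdet Y"
  by (simp add: minv_def mdet_mscale)

lemma minv_mmul: "mdet Y = - 1 \<Longrightarrow> mmul Y (minv Y) = (1, 0, 0, 1)" "mdet Y = - 1 \<Longrightarrow> mmul (minv Y) Y = (1, 0, 0, 1)"
  by (simp_all add: minv_def mmul_mscale mmul_madj)

text \<open>By Cayley-Hamilton \<open>minv Y\<close> is \<open>Y\<close> minus \<open>mtr Y\<close>
  times the identity. This is the source of the length relation.\<close>

lemma mtr_minv_mmul: "mtr (mmul (minv Y) X) = mtr (mmul X Y) - mtr X * mtr Y"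
  by (cases X; cases Y) (simp add: minv_def algebra_simps)

lemma mmul_A_B: "mdet Y = - 1 \<Longrightarrow> mmul (mmul X Y) (mmul (minv Y) X) = mmul X X"
  by (metis minv_mmul(1) mmul_assoc mmul_one(1) mscale_one)

lemma mtr_square: "mtr (mmul X X) = (mtr X)\<^sup>2 - 2 * mdet X"
  by (cases X) (simp add: power2_eq_square algebra_simps)

lemma no_fixed_point_transfer:
  assumes hom: "homeomorphism H2 H2 D D'" and f: "\<And>z. z \<in> H2 \<Longrightarrow> f z \<in> H2"
    and eq: "\<And>z. z \<in> H2 \<Longrightarrow> D (f z) = g (D z)" and nf: "\<And>z. z \<in> H2 \<Longrightarrow> f z \<noteq> z" and z: "z \<in> H2"
  shows "g z \<noteq> z"
proof
  note D = homeomorphism_H2D[OF hom]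
  assume "g z = z"
  then have "D (f (D' z)) = z" using eq[OF D(2)[OF z]] D(4)[OF z] by simp
  then have "f (D' z) = D' z" using D(3)[OF f[OF D(2)[OF z]]] by simp
  then show False using nf D(2)[OF z] by blast
qed

lemma intertwine_inverse:
  assumes hom: "homeomorphism H2 H2 D D'" and f: "\<And>z. z \<in> H2 \<Longrightarrow> f z \<in> H2"
    and eq: "\<And>z. z \<in> H2 \<Longrightarrow> D (f z) = g (D z)" and z: "z \<in> H2"
  shows "D' (g z) = f (D' z)"
  using homeomorphism_H2D[OF hom] f eq z by metis

text \<open>Absence of fixed points makes the peripheral traces at least 2 in absolute value, and
  the topological invariant makes their signs opposite. The freedom of sign in \<open>X\<close> and
  \<open>Y\<close> is spent on making their own traces positive; that forces
  \<open>tr A > 0 > tr B\<close> and removes all absolute values.\<close>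

lemma fricke_matrices:
  assumes "(g, h) \<in> fricke"
  obtains X Y where "mdet X = - 1" "mdet Y = - 1" "mtr X > 0" "mtr Y > 0"
    "mtr (mmul X Y) \<ge> 2" "mtr X * mtr Y - mtr (mmul X Y) \<ge> 2"
    "\<And>z. z \<in> H2 \<Longrightarrow> g z = mact X z" "\<And>z. z \<in> H2 \<Longrightarrow> h z = mact Y z"
proof -
  obtain D D' where gh: "isom_H2 g" "isom_H2 h" and hom: "homeomorphism H2 H2 D D'"
    and Dg0: "\<And>z. z \<in> H2 \<Longrightarrow> D (X0 z) = g (D z)" and Dh0: "\<And>z. z \<in> H2 \<Longrightarrow> D (Y0 z) = h (D z)"
    using assms by (auto simp: fricke_def)
  note D = homeomorphism_H2D[OF hom]
  obtain X where X: "mdet X = 1 \<or> mdet X = - 1" "\<And>z. z \<in> H2 \<Longrightarrow> g z = mact X z"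
    using isom_H2_matrix[OF gh(1)] by metis
  obtain Y where Y: "mdet Y = 1 \<or> mdet Y = - 1" "\<And>z. z \<in> H2 \<Longrightarrow> h z = mact Y z"
    using isom_H2_matrix[OF gh(2)] by metis
  have R: "mdet XR = - 1" "mdet YR = - 1" by (auto simp: XR_def YR_def)
  have DX: "D (mact XR z) = mact X (D z)" if "z \<in> H2" for z
    using Dg0[OF that] X(2)[OF D(1)[OF that]] by (simp add: X0_mact)
  have DY: "D (mact YR z) = mact Y (D z)" if "z \<in> H2" for z
    using Dh0[OF that] Y(2)[OF D(1)[OF that]] by (simp add: Y0_mact)
  have RH: "mact XR z \<in> H2" "mact YR z \<in> H2" if "z \<in> H2" for z using mact_H2 R that by simp_all
  have dX: "mdet X = - 1"
  proof (rule ccontr)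
    assume "mdet X \<noteq> - 1"
    then have "mdet X = 1" using X by simp
    then show False
      using no_conj_preserving_reversing[OF homeomorphism_symD[OF hom] _ R(1)] intertwine_inverse[where f="mact XR" and g="mact X", OF hom RH(1) DX] by blast
  qed
  have dY: "mdet Y = - 1"
  proof (rule ccontr)
    assume "mdet Y \<noteq> - 1"
    then have "mdet Y = 1" using Y by simp
    then show False
      using no_conj_preserving_reversing[OF homeomorphism_symD[OF hom] _ R(2)] intertwine_inverse[where f="mact YR" and g="mact Y", OF hom RH(2) DY] by blast
  qed
  define A where "A = mmul X Y"
  define B where "B = mmul (minv Y) X"
  define C where "C = mmul X X"
  define AR where "AR = mmul XR YR"
  define BR where "BR = mmul (minv YR) XR"
  define CR where "CR = mmul XR XR"
  have dets: "mdet A = 1" "mdet B = 1" "mdet C = 1" "mdet AR = 1" "mdet BR = 1" "mdet CR = 1"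
    using dX dY R by (simp_all add: A_def B_def C_def AR_def BR_def CR_def mdet_mmul)
  have vals: "AR = (1, 4, 0, 1)" "BR = (- 3, - 2, 2, 1)" "CR = (5, 2, 2, 1)"
    by (simp_all add: AR_def BR_def CR_def XR_def YR_def minv_def)
  have DA: "D (mact AR z) = mact A (D z)" if "z \<in> H2" for z
    using that DX DY RH D R dX dY by (simp add: AR_def A_def mact_mmul)
  have DC: "D (mact CR z) = mact C (D z)" if "z \<in> H2" for z
    using that DX DY RH D R dX dY by (simp add: CR_def C_def mact_mmul)
  have RB: "mact BR z \<in> H2" "mact AR z \<in> H2" "mact CR z \<in> H2" if "z \<in> H2" for z
    using that dets mact_H2 by simp_all
  have DB: "D (mact BR z) = mact B (D z)" if z: "z \<in> H2" for z
  proof -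
    have "mact YR (mact BR z) = mact (mmul YR BR) z" using R dets z by (simp add: mact_mmul)
    also have "mmul YR BR = XR" unfolding BR_def using minv_mmul(1)[OF R(2)] by (simp flip: mmul_assoc add: mmul_one)
    finally have "mact Y (D (mact BR z)) = mact X (D z)" using DX[OF z] DY[OF RB(1)[OF z]] by simp
    then have "mact (minv Y) (mact Y (D (mact BR z))) = mact (minv Y) (mact X (D z))" by simp
    moreover have "mact (minv Y) (mact Y w) = w" if "w \<in> H2" for w
      using mact_mmul[of "minv Y" Y w] that dY minv_mmul(2)[OF dY] by simp
    moreover have "mact (minv Y) (mact X (D z)) = mact B (D z)"
      using mact_mmul[of "minv Y" X "D z"] dX dY D(1)[OF z] by (simp add: B_def)
    ultimately show ?thesis using D(1)[OF RB(1)[OF z]] by simp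
  qed
  have nfR: "mact AR z \<noteq> z" "mact BR z \<noteq> z" "mact CR z \<noteq> z" if "z \<in> H2" for z
  proof -
    obtain x y where z: "z = Complex x y" by (cases z)
    have y: "y > 0" using that z by simp
    show "mact AR z \<noteq> z" by (simp add: vals mact_def)
    have j: "jac BR z \<noteq> 0" "jac CR z \<noteq> 0" using that dets by (simp_all add: jac_nonzero)
    show "mact BR z \<noteq> z"
    proof
      assume "mact BR z = z"
      then have "- 3 * z - 2 = z * (2 * z + 1)" using j by (simp add: vals mact_def field_simps)
      then have "2 * (z + 1)\<^sup>2 = 0" by (simp add: power2_eq_square algebra_simps)
      then have "z = - 1" by (simp add: add_eq_0_iff2)
      then show False using that by simp
    qed
    show "mact CR z \<noteq> z"
    proof
      assume "mact CR z = z"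
      then have "5 * z + 2 = z * (2 * z + 1)" using j by (simp add: vals mact_def field_simps)
      then have "5 * y = 2 * (x * y + y * x) + y" and "5 * x + 2 = 2 * (x * x - y * y) + x"
        by (auto simp: z complex_eq_iff algebra_simps)
      then have x: "x = 1" using y by (auto simp: algebra_simps)
      then have "2 * (y * y) = - 4" using \<open>5 * x + 2 = _\<close> by (simp add: algebra_simps)
      then show False using zero_le_square[of y] by linarith
    qed
  qed
  have nf: "mact A z \<noteq> z" "mact B z \<noteq> z" "mact C z \<noteq> z" if "z \<in> H2" for z
    using no_fixed_point_transfer[where f="mact AR" and g="mact A", OF hom RB(2) DA nfR(1) that]
      no_fixed_point_transfer[where f="mact BR" and g="mact B", OF hom RB(1) DB nfR(2) that]
      no_fixed_point_transfer[where f="mact CR" and g="mact C", OF hom RB(3) DC nfR(3) that] by auto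
  have tA: "\<bar>mtr A\<bar> \<ge> 2" and tB: "\<bar>mtr B\<bar> \<ge> 2"
    using fixed_point_of_small_trace[OF dets(1)] fixed_point_of_small_trace[OF dets(2)] nf dets
    by (fastforce simp: mact_def not_le[symmetric])+
  have tC: "mtr C \<ge> 2" using dX by (simp add: C_def mtr_square)
  have AB: "mmul A B = C" unfolding A_def B_def C_def by (rule mmul_A_B[OF dY])
  \<comment> \<open>If the signs agreed, normalised lifts of \<open>A\<close> and \<open>B\<close>
    would have positive trace, and so would their product \<open>C\<close>. In the reference
    structure \<open>AR\<close> and \<open>- BR\<close> have positive trace while their product is
    \<open>- CR\<close>. The invariant, applied to the inverse homeomorphism, then equates
    \<open>- 1\<close> with 1.\<close>
  have opp: "mtr A * mtr B < 0"
  proof (rule ccontr)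
    assume "\<not> mtr A * mtr B < 0"
    then have "mtr A * mtr B > 0" using tA tB by (auto simp: mult_less_0_iff zero_less_mult_iff)
    then have "sgn (mtr A) * sgn (mtr B) = 1" by (simp flip: sgn_mult)
    define A1 where "A1 = mscale (sgn (mtr A)) A"
    define B1 where "B1 = mscale (sgn (mtr B)) B"
    have s0: "sgn (mtr A) \<noteq> 0" "sgn (mtr B) \<noteq> 0" using tA tB by (auto simp: sgn_zero_iff)
    have m1: "mact A1 z = mact A z" "mact B1 z = mact B z" for z
      using s0 by (simp_all add: A1_def B1_def mact_mscale)
    have s2: "(sgn (mtr A))\<^sup>2 = 1" "(sgn (mtr B))\<^sup>2 = 1" using tA tB by (auto simp: sgn_if)
    have d1: "mdet A1 = 1" "mdet B1 = 1" using s2 dets by (simp_all add: A1_def B1_def mdet_mscale)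
    have mm: "mact N z = mob N z" if "mdet N = 1" for N z using that by (simp add: mact_def)
    have C1: "mmul A1 B1 = C" unfolding A1_def B1_def
      using \<open>sgn (mtr A) * sgn (mtr B) = 1\<close> by (simp add: mmul_mscale mscale_mscale AB mult.commute[of "sgn (mtr B)"])
    have p: "ppos A1" "ppos B1" "ppos (mmul A1 B1)"
      unfolding ppos_def C1 using d1 dets nf tA tB tC m1
      by (auto simp: A1_def B1_def mtr_mscale abs_sgn[symmetric] mult.commute[of "sgn _"] simp flip: mm)
    define B2 where "B2 = mscale (- 1) BR"
    have d2: "mdet B2 = 1" using dets by (simp add: B2_def mdet_mscale)
    have m2: "mact B2 z = mact BR z" for z by (simp add: B2_def mact_mscale)
    have pp: "ppos N" if "mdet N = 1" "mtr N \<ge> 2" "\<And>z. z \<in> H2 \<Longrightarrow> mact N z \<noteq> z" for N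
      using that mm by (simp add: ppos_def)
    have p': "ppos AR" "ppos B2" "ppos CR"
      using d2 dets nfR m2 by (auto intro!: pp simp: B2_def vals mtr_mscale simp del: H2_iff)
    have "(- 1 :: real) = 1"
    proof (rule conj_sign_invariant[OF homeomorphism_symD[OF hom] p p'])
      show "CR = mscale (- 1) (mmul AR B2)" by (simp add: vals B2_def)
      show "D' (mob A1 z) = mob AR (D' z)" if "z \<in> H2" for z
        using intertwine_inverse[where f="mact AR" and g="mact A", OF hom RB(2) DA that] m1 d1 dets by (simp flip: mm)
      show "D' (mob B1 z) = mob B2 (D' z)" if "z \<in> H2" for z
        using intertwine_inverse[where f="mact BR" and g="mact B", OF hom RB(1) DB that] m1 m2 d1 d2 by (simp flip: mm)
    qed
    then show False by simp
  qed
  have trB: "mtr B = mtr A - mtr X * mtr Y" unfolding A_def B_def by (rule mtr_minv_mmul)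
  have XY0: "mtr X \<noteq> 0" "mtr Y \<noteq> 0" using opp trB by auto
  define X1 where "X1 = mscale (sgn (mtr X)) X"
  define Y1 where "Y1 = mscale (sgn (mtr Y)) Y"
  have s2: "(sgn (mtr X))\<^sup>2 = 1" "(sgn (mtr Y))\<^sup>2 = 1" using XY0 by (auto simp: sgn_if)
  define \<epsilon> where "\<epsilon> = sgn (mtr X) * sgn (mtr Y)"
  have t1: "mtr X1 = \<bar>mtr X\<bar>" "mtr Y1 = \<bar>mtr Y\<bar>" "mtr (mmul X1 Y1) = \<epsilon> * mtr A"
    by (simp_all add: X1_def Y1_def mtr_mscale mmul_mscale mscale_mscale A_def \<epsilon>_def abs_sgn mult_ac)
  have e1: "\<epsilon> = 1 \<or> \<epsilon> = - 1" using XY0 by (auto simp: \<epsilon>_def sgn_if)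
  have diff: "\<epsilon> * mtr A - \<epsilon> * mtr B = mtr X1 * mtr Y1"
    unfolding t1 trB \<epsilon>_def by (simp add: abs_sgn algebra_simps)
  have opp1: "(\<epsilon> * mtr A) * (\<epsilon> * mtr B) < 0" using e1 opp by auto
  have pos: "mtr X1 * mtr Y1 > 0" using XY0 t1 by simp
  have gA: "\<epsilon> * mtr A > 0" using opp1 pos diff by (smt (verit) mult_pos_pos mult_neg_neg mult_less_0_iff)
  have gB: "\<epsilon> * mtr B < 0" using opp1 gA by (smt (verit) mult_nonneg_nonneg)
  have "\<epsilon> * mtr A \<ge> 2" "\<epsilon> * mtr B \<le> - 2" using gA gB tA tB e1 by auto
  then show ?thesis
    using that[of X1 Y1] t1 diff dX dY s2 X(2) Y(2) XY0
    by (simp add: X1_def Y1_def mdet_mscale mact_mscale sgn_zero_iff)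
qed

lemma lengths_of_matrices:
  assumes d: "mdet X = - 1" "mdet Y = - 1" and t: "mtr X > 0" "mtr Y > 0"
    "mtr (mmul X Y) \<ge> 2" "mtr X * mtr Y - mtr (mmul X Y) \<ge> 2"
    and gh: "isom_H2 g" "isom_H2 h"
    and g: "\<And>z. z \<in> H2 \<Longrightarrow> g z = mact X z" and h: "\<And>z. z \<in> H2 \<Longrightarrow> h z = mact Y z"
  obtains a b x y where "lengths (g, h) = (a, b, x, y)" "a \<ge> 0" "b \<ge> 0" "x > 0" "y > 0"
    "cosh (a / 2) = mtr (mmul X Y) / 2" "cosh (b / 2) = (mtr X * mtr Y - mtr (mmul X Y)) / 2"
    "sinh (x / 2) = mtr X / 2" "sinh (y / 2) = mtr Y / 2"
proof -
  have H: "mact M z \<in> H2" if "mdet M \<noteq> 0" "z \<in> H2" for M z using mact_H2 that .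
  define B where "B = mmul (minv Y) X"
  have A: "tlen (holA (g, h)) = tlen (mact (mmul X Y))"
    using d g h H by (intro tlen_cong) (simp add: holA_def mact_mmul)
  have "holB (g, h) z = mact B z" if z: "z \<in> H2" for z
  proof -
    have Bz: "mact B z \<in> H2" using z d H by (simp add: B_def mdet_mmul)
    have Hz: "holB (g, h) z \<in> H2" using holB_isom[of "(g, h)"] gh isom_H2_hq(1) z by simp
    have "h (mact B z) = mact (mmul Y B) z" using h[OF Bz] z d by (simp add: mact_mmul B_def mdet_mmul)
    also have "mmul Y B = X" unfolding B_def using minv_mmul(1)[OF d(2)] by (simp flip: mmul_assoc add: mmul_one)
    finally have "h (mact B z) = h (holB (g, h) z)" using snd_holB[of "(g, h)" z] gh z g by simp
    then show ?thesis using isom_H2_inj[OF gh(2)] Bz Hz by (metis inj_onD)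
  qed
  then have B: "tlen (holB (g, h)) = tlen (mact B)" by (intro tlen_cong)
  have X: "tlen g = tlen (mact X)" and Y: "tlen h = tlen (mact Y)" using g h by (auto intro!: tlen_cong)
  have tB: "mtr B = - (mtr X * mtr Y - mtr (mmul X Y))" unfolding B_def mtr_minv_mmul by simp
  have dAB: "mdet (mmul X Y) = 1" "mdet B = 1" using d by (auto simp: B_def mdet_mmul)
  note PA = tlen_mact_pos[OF dAB(1)] and PB = tlen_mact_pos[OF dAB(2)]
  have sX: "sinh (tlen g / 2) = mtr X / 2" and sY: "sinh (tlen h / 2) = mtr Y / 2"
    using tlen_mact_neg(2)[OF d(1)] tlen_mact_neg(2)[OF d(2)] t X Y by simp_all
  have pX: "tlen g > 0" "tlen h > 0"
    using t sinh_real_pos_iff[of "tlen g / 2"] sinh_real_pos_iff[of "tlen h / 2"] unfolding sX sY by simp_all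
  show ?thesis
  proof (rule that)
    show "lengths (g, h) = (tlen (mact (mmul X Y)), tlen (mact B), tlen g, tlen h)"
      by (simp add: lengths_def A B)
  qed (use PA PB t tB sX sY pX in simp_all)
qed

section \<open>The normal form\<close>

text \<open>The axes of \<open>NX l\<close> and \<open>NY p s\<close> cross at \<open>\<i>\<close>, and the half-turn about \<open>\<i>\<close> inverts both.
  The inequalities of \<open>nform\<close> bound the traces of the two peripheral elements.\<close>
definition nform :: "real \<Rightarrow> real \<Rightarrow> real \<Rightarrow> bool" where
  "nform l p s \<longleftrightarrow> l > 1 \<and> l * p - s / l \<ge> 2 \<and> l * s - p / l \<ge> 2"

definition NX :: "real \<Rightarrow> mat2" where "NX l = (l, 0, 0, - 1 / l)"
definition NY :: "real \<Rightarrow> real \<Rightarrow> mat2" where "NY p s = (p, sqrt (p * s + 1), sqrt (p * s + 1), s)"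

text \<open>Adding \<open>l\<close> times the first inequality to \<open>1 / l\<close> times the
  second eliminates \<open>s\<close>; the roles of \<open>p\<close> and \<open>s\<close> are
  symmetric.\<close>

lemma nform_pos:
  assumes "nform l p s" shows "p > 0" "s > 0"
proof -
  have *: "p > 0" if n: "nform l p s" for l p s
  proof -
    have l: "l > 1" "l * p - s / l \<ge> 2" "l * s - p / l \<ge> 2" using n by (auto simp: nform_def)
    have "l * 2 \<le> l * (l * p - s / l)" using l by (intro mult_left_mono) auto
    then have 1: "2 * l \<le> l\<^sup>2 * p - s" using l by (simp add: power2_eq_square field_simps)
    have "2 / l \<le> (l * s - p / l) / l" using l by (intro divide_right_mono) auto
    then have 2: "2 / l \<le> s - p / l\<^sup>2" using l by (simp add: power2_eq_square field_simps)
    have "0 < 2 * l + 2 / l" using l(1) by (intro add_pos_pos) auto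
    also have "\<dots> \<le> p * (l\<^sup>2 - 1 / l\<^sup>2)" using 1 2 by (simp add: algebra_simps)
    finally have "0 < p * (l\<^sup>2 - 1 / l\<^sup>2)" .
    moreover have "1 / l\<^sup>2 < 1" "1 < l\<^sup>2" using l by (simp_all add: field_simps one_less_power)
    then have "l\<^sup>2 - 1 / l\<^sup>2 > 0" by simp
    ultimately show ?thesis by (simp add: zero_less_mult_iff)
  qed
  show "p > 0" using *[OF assms] .
  have "nform l s p" using assms by (auto simp: nform_def)
  then show "s > 0" by (rule *)
qed

lemma NXY_traces:
  assumes "nform l p s"
  shows "mdet (NX l) = - 1" "mdet (NY p s) = - 1" "mtr (NX l) = l - 1 / l" "mtr (NY p s) = p + s"
    "mtr (mmul (NX l) (NY p s)) = l * p - s / l"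
    "mtr (NX l) * mtr (NY p s) - mtr (mmul (NX l) (NY p s)) = l * s - p / l"
proof -
  have l: "l > 1" using assms by (simp add: nform_def)
  have "p * s + 1 \<ge> 0" using nform_pos[OF assms] by (simp add: add_nonneg_nonneg)
  then show "mdet (NX l) = - 1" "mdet (NY p s) = - 1" "mtr (NX l) = l - 1 / l" "mtr (NY p s) = p + s"
    "mtr (mmul (NX l) (NY p s)) = l * p - s / l"
    "mtr (NX l) * mtr (NY p s) - mtr (mmul (NX l) (NY p s)) = l * s - p / l"
    using l by (simp_all add: NX_def NY_def algebra_simps add_divide_distrib)
qed

text \<open>In \<open>mmul P X = mmul (NX l) P\<close> the rows of \<open>P\<close> are left
  eigenvectors of \<open>X\<close>, hence row vectors here.\<close>

lemma left_eigenvector: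
  fixes a b c d \<mu> :: real
  assumes "\<mu>\<^sup>2 - (a + d) * \<mu> + (a * d - b * c) = 0"
  shows "\<exists>x y. (x \<noteq> 0 \<or> y \<noteq> 0) \<and> x * a + y * c = \<mu> * x \<and> x * b + y * d = \<mu> * y"
proof -
  consider "c \<noteq> 0 \<or> \<mu> \<noteq> a" | "\<mu> \<noteq> d \<or> b \<noteq> 0" | "c = 0" "b = 0" "\<mu> = a" "\<mu> = d" by auto
  then show ?thesis
  proof cases
    case 1
    then show ?thesis using assms
      by (intro exI[of _ c] exI[of _ "\<mu> - a"]) (auto simp: power2_eq_square algebra_simps)
  next
    case 2
    then show ?thesis using assms
      by (intro exI[of _ "\<mu> - d"] exI[of _ b]) (auto simp: power2_eq_square algebra_simps)
  next
    case 3
    then show ?thesis by (intro exI[of _ 1] exI[of _ 0]) auto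
  qed
qed

text \<open>Determinant \<open>- 1\<close> gives \<open>X\<close> the distinct real eigenvalues
  \<open>l\<close> and \<open>- 1 / l\<close>, so \<open>X\<close> is diagonalisable. The traces of
  \<open>Y\<close> and \<open>X Y\<close> then fix the diagonal of the conjugated \<open>Y\<close>.
  What is left is conjugation by diagonal matrices, enough to equalise the off-diagonal entries
  since their product \<open>p * s + 1\<close> is positive.\<close>

lemma matrices_normal_form:
  assumes d: "mdet X = - 1" "mdet Y = - 1" and t: "mtr X > 0" "mtr Y > 0"
    "mtr (mmul X Y) \<ge> 2" "mtr X * mtr Y - mtr (mmul X Y) \<ge> 2"
  obtains l p s P where "nform l p s" "mdet P \<noteq> 0" "mmul P X = mmul (NX l) P" "mmul P Y = mmul (NY p s) P"
    "mtr X = l - 1 / l" "mtr Y = p + s" "mtr (mmul X Y) = l * p - s / l"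
proof -
  obtain a b c e where X: "X = (a, b, c, e)" by (cases X) auto
  define \<tau> where "\<tau> = mtr X"
  define l where "l = (\<tau> + sqrt (\<tau>\<^sup>2 + 4)) / 2"
  have "sqrt (\<tau>\<^sup>2 + 4) \<ge> sqrt 4" by (intro real_sqrt_le_mono) simp
  then have l: "l > 1" using t by (simp add: l_def \<tau>_def)
  have "2 * l - \<tau> = sqrt (\<tau>\<^sup>2 + 4)" by (simp add: l_def field_simps)
  then have sq: "(2 * l - \<tau>)\<^sup>2 = \<tau>\<^sup>2 + 4" by (simp add: add_nonneg_nonneg)
  then have leq: "l\<^sup>2 - \<tau> * l - 1 = 0" by (simp add: power2_eq_square algebra_simps)
  then have tl: "\<tau> = l - 1 / l" using l by (simp add: field_simps power2_eq_square)
  have Xd: "a * e - b * c = - 1" "a + e = \<tau>" using d X by (auto simp: \<tau>_def)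
  have e1: "l\<^sup>2 - (a + e) * l + (a * e - b * c) = 0" using leq Xd by simp
  have e2: "(- 1 / l)\<^sup>2 - (a + e) * (- 1 / l) + (a * e - b * c) = 0"
    unfolding Xd tl using l by (simp add: field_simps power2_eq_square)
  obtain x1 x2 where x: "x1 \<noteq> 0 \<or> x2 \<noteq> 0" "x1 * a + x2 * c = l * x1" "x1 * b + x2 * e = l * x2"
    using left_eigenvector[OF e1] by blast
  obtain y1 y2 where y: "y1 \<noteq> 0 \<or> y2 \<noteq> 0" "y1 * a + y2 * c = - 1 / l * y1" "y1 * b + y2 * e = - 1 / l * y2"
    using left_eigenvector[OF e2] by blast
  define Q where "Q = (x1, x2, y1, y2)"
  define \<delta> where "\<delta> = x1 * y2 - x2 * y1"
  have dl: "l + 1 / l \<noteq> 0" using l by (simp add: add_pos_pos pos_add_strict less_imp_neq[symmetric])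
  \<comment> \<open>If the two rows were proportional, one nonzero vector would be an eigenvector
    for both \<open>l\<close> and \<open>- 1 / l\<close>.\<close>
  have d0: "\<delta> \<noteq> 0"
  proof
    assume 0: "\<delta> = 0"
    have "(x1 * a + x2 * c) * y1 = l * (x1 * y1)" "(x1 * b + x2 * e) * y2 = l * (x2 * y2)"
      "(x1 * a + x2 * c) * y2 = l * (x1 * y2)" "(x1 * b + x2 * e) * y1 = l * (x2 * y1)" using x by simp_all
    moreover have "(y1 * a + y2 * c) * x1 = - 1 / l * (x1 * y1)" "(y1 * b + y2 * e) * x2 = - 1 / l * (x2 * y2)"
      "(y1 * a + y2 * c) * x2 = - 1 / l * (y1 * x2)" "(y1 * b + y2 * e) * x1 = - 1 / l * (y2 * x1)" using y by simp_all
    moreover have "x1 * y2 = x2 * y1" using 0 by (simp add: \<delta>_def)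
    ultimately have "(l + 1 / l) * (x1 * y1) = 0" "(l + 1 / l) * (x2 * y2) = 0" "(l + 1 / l) * (x1 * y2) = 0"
      by algebra+
    then show False using dl x y \<open>x1 * y2 = x2 * y1\<close> by auto
  qed
  have dQ: "mdet Q = \<delta>" by (simp add: Q_def \<delta>_def)
  have QX: "mmul Q X = mmul (NX l) Q" using x y by (simp add: Q_def X NX_def)
  define Y1 where "Y1 = mscale (1 / \<delta>) (mmul (mmul Q Y) (madj Q))"
  have Y1Q: "mmul Y1 Q = mmul Q Y"
    unfolding Y1_def mmul_mscale mmul_assoc mmul_madj dQ mmul_one mscale_mscale using d0 by simp
  have dY1: "mdet Y1 = - 1" using d d0 by (simp add: Y1_def mdet_mscale mdet_mmul dQ power2_eq_square)
  have tr: "mtr (mscale (1 / \<delta>) (mmul (mmul Q Z) (madj Q))) = mtr Z" for Z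
  proof -
    have "mtr (mmul (mmul Q Z) (madj Q)) = mtr (mmul (madj Q) (mmul Q Z))" by (rule mtr_mmul_comm)
    also have "\<dots> = \<delta> * mtr Z" unfolding mmul_assoc[symmetric] mmul_madj dQ mmul_one by (rule mtr_mscale)
    finally show ?thesis using d0 by (simp add: mtr_mscale)
  qed
  obtain p q r s where Y1: "Y1 = (p, q, r, s)" by (cases Y1) auto
  have ps: "mtr Y = p + s" using tr[of Y] by (fold Y1_def) (simp add: Y1)
  have "mmul (NX l) Y1 = mscale (1 / \<delta>) (mmul (mmul Q (mmul X Y)) (madj Q))"
    unfolding Y1_def mmul_mscale by (simp add: mmul_assoc[symmetric] QX)
  then have "mtr (mmul (NX l) Y1) = mtr (mmul X Y)" using tr by simp
  then have lp: "mtr (mmul X Y) = l * p - s / l" by (simp add: Y1 NX_def)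
  have n: "nform l p s" unfolding nform_def
    using l t ps lp tl unfolding \<tau>_def[symmetric] by (simp add: algebra_simps add_divide_distrib)
  define w where "w = sqrt (p * s + 1)"
  have psp: "p * s + 1 > 0" using nform_pos[OF n] by (simp add: add_pos_pos)
  have qr: "q * r = p * s + 1" using dY1 Y1 by simp
  then have qr0: "q * r > 0" using psp by simp
  then have q0: "q \<noteq> 0" "r \<noteq> 0" by auto
  have w: "w > 0" "w * w = q * r" using psp qr by (auto simp: w_def)
  txt \<open>Conjugation by \<open>diag u v\<close> multiplies the off-diagonal entries by \<open>u / v\<close> and \<open>v / u\<close>.\<close>
  define P where "P = (w * x1, w * x2, q * y1, q * y2)"
  have "mdet P = w * q * \<delta>" by (simp add: P_def \<delta>_def algebra_simps)
  then have dP: "mdet P \<noteq> 0" using w q0 d0 by simp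
  have PX: "mmul P X = mmul (NX l) P"
  proof -
    have "w * (x1 * a + x2 * c) = w * (l * x1)" "w * (x1 * b + x2 * e) = w * (l * x2)"
      "q * (y1 * a + y2 * c) = q * (- 1 / l * y1)" "q * (y1 * b + y2 * e) = q * (- 1 / l * y2)"
      unfolding x(2,3) y(2,3) by simp_all
    then show ?thesis by (simp add: P_def X NX_def algebra_simps)
  qed
  obtain a' b' c' e' where Y: "Y = (a', b', c', e')" by (cases Y) auto
  have NYw: "NY p s = (p, w, w, s)" by (simp add: NY_def w_def)
  have "mmul P Y = mmul (NY p s) P"
  proof -
    have rows: "p * x1 + q * y1 = x1 * a' + x2 * c'" "p * x2 + q * y2 = x1 * b' + x2 * e'"
      "r * x1 + s * y1 = y1 * a' + y2 * c'" "r * x2 + s * y2 = y1 * b' + y2 * e'"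
      using Y1Q by (auto simp: Y1 Q_def Y)
    have "w * x1 * a' + w * x2 * c' = w * (p * x1 + q * y1)" "w * x1 * b' + w * x2 * e' = w * (p * x2 + q * y2)"
      "q * y1 * a' + q * y2 * c' = q * (r * x1 + s * y1)" "q * y1 * b' + q * y2 * e' = q * (r * x2 + s * y2)"
      unfolding rows by (simp_all add: algebra_simps)
    then show ?thesis
      using w(2) unfolding P_def Y NYw by (simp add: algebra_simps)
  qed
  then show ?thesis using that[OF n dP PX] ps lp tl \<tau>_def by simp
qed

text \<open>\<open>l \<mapsto> l - 1 / l\<close> is injective for positive \<open>l\<close>. For
  fixed \<open>l\<close> the other two equations are linear in \<open>p\<close> and
  \<open>s\<close>, and nonsingular because \<open>l * l * (l * l) \<noteq> 1\<close>.\<close>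

lemma nform_unique:
  assumes "nform l p s" "nform l' p' s'" "l - 1 / l = l' - 1 / l'" "l * p - s / l = l' * p' - s' / l'"
    "l * s - p / l = l' * s' - p' / l'"
  shows "l = l'" "p = p'" "s = s'"
proof -
  have l: "l > 1" "l' > 1" using assms by (auto simp: nform_def)
  have "(l - l') * (1 + 1 / (l * l')) = 0" using assms(3) l by (simp add: field_simps)
  moreover have "1 + 1 / (l * l') > 0" using l by (simp add: add_pos_pos)
  ultimately show ll: "l = l'" by simp
  have 1: "l * (p - p') = (s - s') / l" and 2: "l * (s - s') = (p - p') / l"
    using assms(4,5) unfolding ll[symmetric] by (simp_all add: algebra_simps diff_divide_distrib)
  have "l * l * (p - p') = s - s'" "l * l * (s - s') = p - p'" using 1 2 l by (simp_all add: field_simps)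
  then have "(l * l * (l * l) - 1) * (p - p') = 0" by algebra
  moreover have "l * l * (l * l) > 1" using l by (simp add: less_1_mult)
  ultimately show "p = p'" by simp
  then show "s = s'" using \<open>l * l * (p - p') = s - s'\<close> by simp
qed

lemma conj_rep_trans_sym:
  assumes r: "isom_H2 (fst r)" "isom_H2 (snd r)" and s: "isom_H2 (fst s)" "isom_H2 (snd s)"
    and 1: "conj_rep r t" and 2: "conj_rep s t"
  shows "conj_rep r s"
proof -
  obtain f where f: "isom_H2 f" "\<And>z. z \<in> H2 \<Longrightarrow> f (fst r z) = fst t (f z)" "\<And>z. z \<in> H2 \<Longrightarrow> f (snd r z) = snd t (f z)"
    using 1 by (auto simp: conj_rep_def)
  obtain g where g: "isom_H2 g" "\<And>z. z \<in> H2 \<Longrightarrow> g (fst s z) = fst t (g z)" "\<And>z. z \<in> H2 \<Longrightarrow> g (snd s z) = snd t (g z)"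
    using 2 by (auto simp: conj_rep_def)
  have m: "k z \<in> H2" if "isom_H2 k" "z \<in> H2" for k z using isom_H2_hq(1)[OF that that(2)] .
  have gi: "inv_into H2 g z \<in> H2" "g (inv_into H2 g z) = z" if "z \<in> H2" for z
    using isom_H2_image[OF g(1)] that by (metis inv_into_into, metis f_inv_into_f)
  have gl: "inv_into H2 g (g z) = z" if "z \<in> H2" for z
    using isom_H2_inj[OF g(1)] that by (rule inv_into_f_f)
  have *: "inv_into H2 g (f (u z)) = v (inv_into H2 g (f z))"
    if u: "isom_H2 u" "isom_H2 v" "\<And>z. z \<in> H2 \<Longrightarrow> f (u z) = w (f z)" "\<And>z. z \<in> H2 \<Longrightarrow> g (v z) = w (g z)"
      and z: "z \<in> H2" for u v w z
  proof -
    have "f z \<in> H2" using m f z by blast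
    then have i: "inv_into H2 g (f z) \<in> H2" using gi by blast
    have "f (u z) = w (g (inv_into H2 g (f z)))" using u(3)[OF z] gi(2)[OF \<open>f z \<in> H2\<close>] by simp
    also have "\<dots> = g (v (inv_into H2 g (f z)))" using u(4)[OF i] by simp
    finally show ?thesis using gl[OF m[OF u(2) i]] by simp
  qed
  have "isom_H2 (inv_into H2 g \<circ> f)" by (intro isom_H2_comp isom_H2_inv_into f g)
  then show ?thesis unfolding conj_rep_def
    using *[OF r(1) s(1) f(2) g(2)] *[OF r(2) s(2) f(3) g(3)] by (intro exI[of _ "inv_into H2 g \<circ> f"]) auto
qed

section \<open>Tilings generated by reflections\<close>

type_synonym geod = "real \<times> real \<times> real"

text \<open>When \<open>\<beta>\<^sup>2 - \<alpha> * \<gamma> = 1\<close>, the zero set of \<open>gform (\<alpha>, \<beta>, \<gamma>)\<close> is a geodesic.\<close>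
fun gform :: "geod \<Rightarrow> complex \<Rightarrow> real" where
  "gform (\<alpha>, \<beta>, \<gamma>) z = \<alpha> * (cmod z)\<^sup>2 + 2 * \<beta> * Re z + \<gamma>"
fun gmat :: "geod \<Rightarrow> mat2" where
  "gmat (\<alpha>, \<beta>, \<gamma>) = (- \<beta>, - \<gamma>, \<alpha>, \<beta>)"

definition grefl :: "geod \<Rightarrow> complex \<Rightarrow> complex" where
  "grefl n = mact (gmat n)"

lemma continuous_on_gform [continuous_intros]:
  "continuous_on S f \<Longrightarrow> continuous_on S (\<lambda>x. gform n (f x))"
  by (cases n) (simp, intro continuous_intros)

context
  fixes n :: geod
  assumes n: "mdet (gmat n) = - 1"
begin

lemma grefl_H2: "z \<in> H2 \<Longrightarrow> grefl n z \<in> H2"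
  unfolding grefl_def using n by (intro mact_H2) auto

lemma grefl_invol: "z \<in> H2 \<Longrightarrow> grefl n (grefl n z) = z"
proof -
  assume z: "z \<in> H2"
  obtain \<alpha> \<beta> \<gamma> where N: "n = (\<alpha>, \<beta>, \<gamma>)" by (cases n) auto
  have "mmul (gmat n) (gmat n) = (1, 0, 0, 1)" using n by (simp add: N algebra_simps)
  then show ?thesis unfolding grefl_def using mact_mmul[of "gmat n" "gmat n" z] n z by simp
qed

text \<open>The sign of the added term tells which of \<open>z\<close> and its mirror image is
  nearer to \<open>w\<close>. It is the link between sides of a tile and the Dirichlet
  condition.\<close>

lemma hq_grefl:
  assumes z: "z \<in> H2" and w: "w \<in> H2"
  shows "hq (grefl n z) w = hq z w + gform n z * gform n w / (Im z * Im w)"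
proof -
  obtain a b c where N: "n = (a, b, c)" by (cases n) auto
  have e: "b\<^sup>2 - a * c = 1" using n by (simp add: N power2_eq_square mult.commute)
  obtain x y where xy: "z = Complex x y" by (cases z)
  obtain u v where uv: "w = Complex u v" by (cases w)
  have p: "y > 0" "v > 0" using z w xy uv by auto
  have j: "jac (gmat n) (cnj z) \<noteq> 0" using n z by (intro jac_nonzero) auto
  have m: "grefl n z = mob (gmat n) (cnj z)" using n by (simp add: grefl_def mact_def)
  have I: "Im (grefl n z) = y / (cmod (jac (gmat n) (cnj z)))\<^sup>2"
    unfolding m using Im_mob[OF j] n by (simp add: xy)
  have "grefl n z - w = ((- b * cnj z - c) - w * jac (gmat n) (cnj z)) / jac (gmat n) (cnj z)"
    unfolding m using j by (simp add: N diff_divide_distrib)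
  then have "hq (grefl n z) w = (cmod ((- b * cnj z - c) - w * jac (gmat n) (cnj z)))\<^sup>2 / (y * v)"
    using j p by (simp add: hq_def I norm_divide power_divide uv)
  also have "(cmod ((- b * cnj z - c) - w * jac (gmat n) (cnj z)))\<^sup>2
      = (b\<^sup>2 - a * c) * ((x - u)\<^sup>2 + (y - v)\<^sup>2) + gform n z * gform n w"
    unfolding cmod_power2 N gform.simps by (simp add: xy uv power2_eq_square) algebra
  finally show ?thesis using e p
    by (simp add: hq_def cmod_power2 xy uv add_divide_distrib)
qed

lemma gform_grefl:
  assumes z: "z \<in> H2"
  shows "gform n (grefl n z) * (cmod (jac (gmat n) (cnj z)))\<^sup>2 = - gform n z"
proof -
  obtain a b c where N: "n = (a, b, c)" by (cases n) auto
  have e: "b * b - a * c = 1" using n by (simp add: N mult.commute)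
  obtain x y where xy: "z = Complex x y" by (cases z)
  define J where "J = jac (gmat n) (cnj z)"
  have j: "J \<noteq> 0" unfolding J_def using n z by (intro jac_nonzero) auto
  define w where "w = grefl n z"
  have wJ: "w * J = - b * cnj z - c" using j n by (simp add: w_def grefl_def mact_def N J_def)
  have A: "(cmod w)\<^sup>2 * (cmod J)\<^sup>2 = (cmod (- b * cnj z - c))\<^sup>2"
    unfolding wJ[symmetric] by (simp add: norm_mult power_mult_distrib)
  have B: "Re w * (cmod J)\<^sup>2 = Re ((- b * cnj z - c) * cnj J)"
  proof -
    have "(- b * cnj z - c) * cnj J = w * of_real ((cmod J)\<^sup>2)"
      unfolding wJ[symmetric] complex_norm_square by simp
    then show ?thesis by simp
  qed
  have "gform n w * (cmod J)\<^sup>2 = a * ((cmod w)\<^sup>2 * (cmod J)\<^sup>2) + 2 * b * (Re w * (cmod J)\<^sup>2) + c * (cmod J)\<^sup>2"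
    by (simp add: N algebra_simps)
  then have "gform n w * (cmod J)\<^sup>2 = a * (cmod (- b * cnj z - c))\<^sup>2 + 2 * b * Re ((- b * cnj z - c) * cnj J) + c * (cmod J)\<^sup>2"
    unfolding A B .
  also have "\<dots> = - (b * b - a * c) * gform n z"
    unfolding cmod_power2 N gform.simps J_def by (simp add: xy power2_eq_square) algebra
  finally show ?thesis using e by (simp add: w_def J_def)
qed

lemma gform_grefl_neg_iff: "z \<in> H2 \<Longrightarrow> gform n (grefl n z) < 0 \<longleftrightarrow> gform n z > 0"
  and gform_grefl_pos_iff: "z \<in> H2 \<Longrightarrow> gform n (grefl n z) > 0 \<longleftrightarrow> gform n z < 0"
proof -
  assume z: "z \<in> H2"
  have "(cmod (jac (gmat n) (cnj z)))\<^sup>2 > 0" using n z jac_nonzero[of "cnj z" "gmat n"] by simp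
  then show "gform n (grefl n z) < 0 \<longleftrightarrow> gform n z > 0" "gform n (grefl n z) > 0 \<longleftrightarrow> gform n z < 0"
    using gform_grefl[OF z] by (smt (verit) zero_less_mult_iff mult_less_0_iff)+
qed

lemma grefl_fixed:
  assumes "z \<in> H2" "gform n z = 0" shows "grefl n z = z"
  using hq_grefl[OF assms(1,1)] assms hq_eq_0[OF grefl_H2[OF assms(1)] assms(1)] hq_eq_0[OF assms(1,1)]
  by simp

end

section \<open>Reduced words, ping-pong and the covering by tiles\<close>

lemma not_distinct_adjE:
  assumes "\<not> distinct_adj w" obtains a i b where "w = a @ [i, i] @ b"
proof -
  obtain k where k: "Suc k < length w" "w ! k = w ! Suc k"
    using assms by (auto simp: distinct_adj_conv_nth)
  have "w = take k w @ [w ! k, w ! k] @ drop (Suc (Suc k)) w"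
    using k by simp (metis Cons_nth_drop_Suc Suc_lessD append_take_drop_id)
  then show ?thesis by (rule that)
qed

lemma open_sides:
  fixes N :: "'i::finite \<Rightarrow> geod"
  shows "open (H2 \<inter> (\<Inter>i\<in>I. {z. gform (N i) z > 0}))"
  by (intro open_Int open_INT open_H2 ballI open_Collect_less continuous_intros) auto

text \<open>The closed half-planes beyond the sides are pairwise disjoint and avoid
  \<open>\<i>\<close>. Disjointness is asked inside \<open>H2\<close> only, so sides may share ideal
  endpoints, as they do at a cusp.\<close>

definition tiling :: "('i::finite \<Rightarrow> geod) \<Rightarrow> bool" where
  "tiling N \<longleftrightarrow> (\<forall>i. mdet (gmat (N i)) = - 1) \<and> (\<forall>i. gform (N i) \<i> > 0) \<and>
     (\<forall>i j z. i \<noteq> j \<longrightarrow> z \<in> H2 \<longrightarrow> gform (N i) z \<le> 0 \<longrightarrow> gform (N j) z > 0)"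

definition tile :: "('i \<Rightarrow> geod) \<Rightarrow> complex set" where
  "tile N = {z \<in> H2. \<forall>i. gform (N i) z \<ge> 0}"

primrec ract :: "('i \<Rightarrow> geod) \<Rightarrow> 'i list \<Rightarrow> complex \<Rightarrow> complex" where
  "ract N [] z = z"
| "ract N (i # w) z = grefl (N i) (ract N w z)"

lemma ract_append: "ract N (u @ v) z = ract N u (ract N v z)"
  by (induction u) auto

context
  fixes N :: "'i::finite \<Rightarrow> geod"
  assumes N: "tiling N"
begin

lemma tiling_det: "mdet (gmat (N i)) = - 1" and tiling_ii_pos: "gform (N i) \<i> > 0"
  and tiling_disjoint: "i \<noteq> j \<Longrightarrow> z \<in> H2 \<Longrightarrow> gform (N i) z \<le> 0 \<Longrightarrow> gform (N j) z > 0"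
  using N unfolding tiling_def by blast+

lemma ract_H2: "z \<in> H2 \<Longrightarrow> ract N w z \<in> H2"
  by (induction w) (auto simp del: H2_iff intro: grefl_H2[OF tiling_det])

lemma ract_rev: "z \<in> H2 \<Longrightarrow> ract N (rev w) (ract N w z) = z" "z \<in> H2 \<Longrightarrow> ract N w (ract N (rev w) z) = z"
proof -
  have *: "ract N (rev w) (ract N w z) = z" if "z \<in> H2" for w z
    using that by (induction w) (simp_all add: ract_append grefl_invol[OF tiling_det] ract_H2 del: H2_iff)
  show "z \<in> H2 \<Longrightarrow> ract N (rev w) (ract N w z) = z" by (rule *)
  show "z \<in> H2 \<Longrightarrow> ract N w (ract N (rev w) z) = z" using *[of z "rev w"] by simp
qed

lemma hq_ract: "z \<in> H2 \<Longrightarrow> z' \<in> H2 \<Longrightarrow> hq (ract N w z) (ract N w z') = hq z z'"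
proof (induction w)
  case (Cons i w)
  have "hq (mact (gmat (N i)) (ract N w z)) (mact (gmat (N i)) (ract N w z')) = hq (ract N w z) (ract N w z')"
    using tiling_det[of i] Cons ract_H2 by (intro hq_mact) auto
  then show ?case using Cons by (simp add: grefl_def)
qed simp

lemma continuous_on_ract: "continuous_on H2 (ract N w)"
proof (induction w)
  case (Cons i w)
  have "continuous_on H2 (mact (gmat (N i)))" using tiling_det[of i] by (intro continuous_on_mact) simp
  then have "continuous_on H2 (\<lambda>z. mact (gmat (N i)) (ract N w z))"
    by (rule continuous_on_compose2[OF _ Cons image_subsetI[OF ract_H2]])
  then show ?case by (simp add: grefl_def)
qed simp

lemma tile_subset: "z \<in> tile N \<Longrightarrow> z \<in> H2"
  by (simp add: tile_def)

lemma ii_tile: "\<i> \<in> tile N"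
  using tiling_ii_pos by (auto simp: tile_def intro: less_imp_le)

text \<open>Reflection in side \<open>i\<close> exchanges its two half-planes, and whatever lies
  beyond another side is strictly on the positive side of \<open>i\<close>. Equality is possible
  only when a single letter acts on a point of the side itself.\<close>

lemma ping_pong:
  assumes "distinct_adj (i # w)" "y \<in> tile N"
  shows "gform (N i) (ract N (i # w) y) \<le> 0"
    and "w \<noteq> [] \<or> (\<forall>j. gform (N j) y > 0) \<Longrightarrow> gform (N i) (ract N (i # w) y) < 0"
proof -
  have "gform (N i) (ract N (i # w) y) \<le> 0 \<and>
    (w \<noteq> [] \<or> (\<forall>j. gform (N j) y > 0) \<longrightarrow> gform (N i) (ract N (i # w) y) < 0)"
    using assms(1)
  proof (induction w arbitrary: i)
    case Nil
    have y: "y \<in> H2" "gform (N i) y \<ge> 0" using assms(2) by (auto simp: tile_def)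
    then have "gform (N i) (grefl (N i) y) \<le> 0"
      using gform_grefl_pos_iff[OF tiling_det y(1), of i] by linarith
    then show ?case using gform_grefl_neg_iff[OF tiling_det y(1), of i] by auto
  next
    case (Cons j w)
    then have "gform (N j) (ract N (j # w) y) \<le> 0" "i \<noteq> j" by auto
    then have "gform (N i) (ract N (j # w) y) > 0" using tiling_disjoint[of j i] ract_H2 tile_subset[OF assms(2)] by blast
    then show ?case using gform_grefl_neg_iff[OF tiling_det ract_H2[OF tile_subset[OF assms(2)]], of i "j # w"]
      by auto
  qed
  then show "gform (N i) (ract N (i # w) y) \<le> 0"
    and "w \<noteq> [] \<or> (\<forall>j. gform (N j) y > 0) \<Longrightarrow> gform (N i) (ract N (i # w) y) < 0" by auto
qed

lemma ract_reduce: "\<exists>u. distinct_adj u \<and> (\<forall>z\<in>H2. ract N w z = ract N u z)"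
proof (induction "length w" arbitrary: w rule: less_induct)
  case less
  show ?case
  proof (cases "distinct_adj w")
    case False
    then obtain a i b where w: "w = a @ [i, i] @ b" by (rule not_distinct_adjE)
    have "ract N w z = ract N (a @ b) z" if "z \<in> H2" for z
      using that ract_H2 by (simp add: w ract_append grefl_invol[OF tiling_det] del: H2_iff)
    moreover have "length (a @ b) < length w" by (simp add: w)
    ultimately show ?thesis using less[of "a @ b"] by metis
  qed auto
qed

text \<open>A nonempty reduced word throws \<open>\<i>\<close> out of the open tile, which contains
  a Euclidean ball about \<open>\<i>\<close>.\<close>

lemma orbit_separated:
  obtains \<delta> where "\<delta> > 0" "\<And>w. ract N w \<i> = \<i> \<or> hq \<i> (ract N w \<i>) \<ge> \<delta>"
proof -
  define U where "U = H2 \<inter> (\<Inter>i. {z. gform (N i) z > 0})"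
  have "open U" unfolding U_def by (rule open_sides)
  moreover have "\<i> \<in> U" using tiling_ii_pos by (simp add: U_def)
  ultimately obtain e where e: "e > 0" "ball \<i> e \<subseteq> U" by (meson openE)
  show ?thesis
  \<comment> \<open>An orbit point \<open>q\<close> at Euclidean distance \<open>x\<close> from
    \<open>\<i>\<close> has \<open>Im q \<le> 1 + x\<close>, so \<open>hq\<close> is at least
    \<open>x\<^sup>2 / (1 + x)\<close>, which increases with \<open>x \<ge> e\<close>.\<close>
  proof (rule that[of "e\<^sup>2 / (1 + e)"])
    fix w
    obtain u where u: "distinct_adj u" "\<And>z. z \<in> H2 \<Longrightarrow> ract N w z = ract N u z" using ract_reduce by blast
    show "ract N w \<i> = \<i> \<or> hq \<i> (ract N w \<i>) \<ge> e\<^sup>2 / (1 + e)"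
    proof (cases u)
      case Nil
      then show ?thesis using u by simp
    next
      case (Cons i v)
      define q where "q = ract N w \<i>"
      have "gform (N i) q \<le> 0" using ping_pong(1)[of i v \<i>] u ii_tile Cons by (simp add: q_def)
      then have "q \<notin> U" by (auto simp: U_def not_less)
      then have ge: "cmod (\<i> - q) \<ge> e" using e by (auto simp: dist_norm not_less subset_iff)
      have q: "q \<in> H2" unfolding q_def by (rule ract_H2) simp
      define x where "x = cmod (\<i> - q)"
      have "Im q - 1 \<le> x" using abs_Im_le_cmod[of "\<i> - q"] by (simp add: x_def)
      then have "Im q \<le> 1 + x" by simp
      then have "x\<^sup>2 / (1 + x) \<le> x\<^sup>2 / Im q" using q by (intro divide_left_mono) auto
      moreover have "e\<^sup>2 / (1 + e) \<le> x\<^sup>2 / (1 + x)"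
      proof -
        have "e\<^sup>2 * (1 + x) \<le> x\<^sup>2 * (1 + e)"
        proof -
          have "e * e \<le> x * x" "e * e * x \<le> x * x * e"
            using ge e mult_mono[of e x e x] mult_left_mono[of e x "e * x"]
            by (simp_all add: x_def[symmetric] mult_ac)
          then show ?thesis by (simp add: power2_eq_square algebra_simps)
        qed
        then show ?thesis using ge e x_def by (simp add: divide_simps)
      qed
      ultimately show ?thesis by (simp add: hq_def q_def[symmetric] x_def[symmetric])
    qed
  qed (use e in simp)
qed

text \<open>An \<open>hq\<close>-ball about \<open>z\<close> is bounded and stays away from the real
  axis. Distinct orbit points keep a uniform distance there, since the group moves either of them to
  \<open>\<i>\<close>, where \<open>orbit_separated\<close> applies. So only finitely many orbit
  points compete.\<close>

lemma orbit_closest: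
  assumes z: "z \<in> H2"
  obtains w where "\<And>u. hq z (ract N w \<i>) \<le> hq z (ract N u \<i>)"
proof -
  obtain \<delta> where d: "\<delta> > 0" "\<And>w. ract N w \<i> = \<i> \<or> hq \<i> (ract N w \<i>) \<ge> \<delta>" using orbit_separated by blast
  \<comment> \<open>A radius large enough for \<open>\<i>\<close> itself to compete, so that the
    finite set is nonempty.\<close>
  define c where "c = hq z \<i> + 1"
  have c: "c > 0" using hq_nonneg[of z \<i>] z by (simp add: c_def)
  define K where "K = {v \<in> H2. hq z v \<le> c} \<inter> range (\<lambda>w. ract N w \<i>)"
  define y where "y = Im z"
  have y: "y > 0" using z y_def by simp
  have K1: "(cmod (z - v))\<^sup>2 \<le> c * y * Im v" if "v \<in> K" for v
    using that y by (simp add: K_def hq_def y_def[symmetric] divide_simps mult.assoc)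
  \<comment> \<open>Below height \<open>y / 2\<close> the distance to \<open>z\<close> is at least
    \<open>y / 2\<close>, while \<open>K1\<close> bounds its square by
    \<open>c * y * Im v\<close>.\<close>
  define m where "m = min (y / 2) (y / (4 * c))"
  have m: "m > 0" using y c by (simp add: m_def)
  have Km: "Im v \<ge> m" if v: "v \<in> K" for v
  proof (cases "Im v \<ge> y / 2")
    case False
    then have "y / 2 \<le> cmod (z - v)" using abs_Im_le_cmod[of "z - v"] by (simp add: y_def)
    then have "(y / 2)\<^sup>2 \<le> c * y * Im v" using K1[OF v] y by (meson power_mono order_trans half_gt_zero less_imp_le)
    then have "y / (4 * c) \<le> Im v" using y c by (simp add: power2_eq_square field_simps)
    then show ?thesis by (simp add: m_def)
  qed (simp add: m_def)
  have Kb: "cmod (z - v) \<le> c * y + y" if v: "v \<in> K" for v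
  proof (rule ccontr)
    assume "\<not> ?thesis"
    then have x: "cmod (z - v) > c * y + y" by simp
    have "Im v \<le> y + cmod (z - v)" using abs_Im_le_cmod[of "z - v"] by (simp add: y_def)
    then have "c * y * Im v \<le> c * y * (y + cmod (z - v))" using c y by (intro mult_left_mono) auto
    then have "(cmod (z - v))\<^sup>2 \<le> c * y * (y + cmod (z - v))" using K1[OF v] by linarith
    also have "\<dots> < (c * y + y) * cmod (z - v)"
    proof -
      have "c * y < cmod (z - v)" using x y by linarith
      then show ?thesis using y by (simp add: algebra_simps)
    qed
    finally have "cmod (z - v) < c * y + y" using x c y
      by (simp add: power2_eq_square mult_less_cancel_right)
    then show False using x by simp
  qed
  have sep: "\<delta> * (m * m) \<le> (cmod (v - v'))\<^sup>2" if v: "v \<in> K" "v' \<in> K" "v \<noteq> v'" for v v'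
  proof -
    obtain a b where ab: "v = ract N a \<i>" "v' = ract N b \<i>" using v by (auto simp: K_def)
    have ii: "\<i> \<in> H2" by simp
    have "hq v v' = hq (ract N (rev a) v) (ract N (rev a) v')"
      using v by (intro hq_ract[symmetric]) (auto simp: K_def)
    also have "\<dots> = hq \<i> (ract N (rev a @ b) \<i>)"
      by (simp only: ab ract_rev(1)[OF ii] ract_append)
    finally have h: "hq v v' = hq \<i> (ract N (rev a @ b) \<i>)" .
    have "hq v v' \<noteq> 0" using v hq_eq_0 by (auto simp: K_def)
    then have "ract N (rev a @ b) \<i> \<noteq> \<i>" using h hq_eq_0[of \<i> \<i>] by auto
    then have "\<delta> \<le> hq v v'" using d(2) h by metis
    moreover have "0 < m * m" "m * m \<le> Im v * Im v'" using Km[OF v(1)] Km[OF v(2)] m by (auto intro!: mult_mono)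
    ultimately show ?thesis
    proof -
      assume 1: "\<delta> \<le> hq v v'" and 2: "0 < m * m" "m * m \<le> Im v * Im v'"
      have "\<delta> * (m * m) \<le> \<delta> * (Im v * Im v')" using d 2 by (intro mult_left_mono) auto
      also have "\<dots> \<le> hq v v' * (Im v * Im v')" using 1 2 by (intro mult_right_mono) auto
      also have "\<dots> = (cmod (v - v'))\<^sup>2" using 2 by (auto simp: hq_def)
      finally show ?thesis .
    qed
  qed
  have "finite K"
  proof (rule ccontr)
    assume inf: "infinite K"
    have "K \<subseteq> cball z (c * y + y)" using Kb by (auto simp: dist_norm)
    then obtain x where x: "x islimpt K"
      using inf compact_cball[of z "c * y + y"] compact_eq_Bolzano_Weierstrass by metis
    define r where "r = sqrt (\<delta> * (m * m)) / 2"
    have r: "r > 0" using d m by (simp add: r_def)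
    obtain v where v: "v \<in> K" "v \<noteq> x" "dist v x < r" using x r by (auto simp: islimpt_approachable)
    obtain v' where v': "v' \<in> K" "v' \<noteq> x" "dist v' x < min r (dist v x)"
      using x r v islimpt_approachable[of x K] by (metis min_less_iff_conj zero_less_dist_iff)
    have "v \<noteq> v'" using v' by auto
    have "dist v v' < 2 * r" using v v' dist_triangle2[of v v' x] by simp
    then have "cmod (v - v') < sqrt (\<delta> * (m * m))" by (simp add: dist_norm r_def)
    then have "(cmod (v - v'))\<^sup>2 < (sqrt (\<delta> * (m * m)))\<^sup>2" by (intro power_strict_mono) auto
    then show False using sep[OF v(1) v'(1) \<open>v \<noteq> v'\<close>] d m by simp
  qed
  moreover have "\<i> \<in> K"
  proof -
    have "\<i> = ract N [] \<i>" by simp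
    then have "\<i> \<in> range (\<lambda>w. ract N w \<i>)" by blast
    then show ?thesis by (simp add: K_def c_def)
  qed
  ultimately obtain v where v: "v \<in> K" "\<And>u. u \<in> K \<Longrightarrow> hq z v \<le> hq z u"
    using ex_is_arg_min_if_finite[of K "hq z"] by (auto simp: is_arg_min_linorder)
  obtain w where w: "v = ract N w \<i>" using v by (auto simp: K_def)
  show ?thesis
  proof (rule that)
    fix u
    show "hq z (ract N w \<i>) \<le> hq z (ract N u \<i>)"
    proof (cases "ract N u \<i> \<in> K")
      case True
      then show ?thesis using v w by simp
    next
      case False
      have "ract N u \<i> \<in> H2" by (rule ract_H2) simp
      with False have "hq z (ract N u \<i>) > c" by (auto simp: K_def)
      moreover have "hq z v \<le> c" using v by (auto simp: K_def)
      ultimately show ?thesis using w by simp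
    qed
  qed
qed

text \<open>Pull \<open>z\<close> back by the word leading to a closest orbit point. If the result
  were beyond side \<open>i\<close>, its reflection in that side would be nearer to
  \<open>\<i>\<close>, and extending the word by \<open>i\<close> would give a closer orbit
  point.\<close>

lemma tiles_cover:
  assumes z: "z \<in> H2" obtains w y where "y \<in> tile N" "z = ract N w y"
proof -
  obtain w where w: "\<And>u. hq z (ract N w \<i>) \<le> hq z (ract N u \<i>)" using orbit_closest[OF z] by blast
  define y where "y = ract N (rev w) z"
  have y: "y \<in> H2" unfolding y_def using ract_H2 z .
  have zy: "z = ract N w y" unfolding y_def using ract_rev z by simp
  have ii: "\<i> \<in> H2" by simp
  have "gform (N i) y \<ge> 0" for i
  proof (rule ccontr)
    assume "\<not> ?thesis"
    then have neg: "gform (N i) y < 0" by simp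
    have "hq (grefl (N i) y) \<i> = hq y \<i> + gform (N i) y * gform (N i) \<i> / (Im y * Im \<i>)"
      by (rule hq_grefl[OF tiling_det y ii])
    moreover have "gform (N i) y * gform (N i) \<i> / (Im y * Im \<i>) < 0"
      using neg tiling_ii_pos[of i] y by (intro divide_neg_pos mult_neg_pos) auto
    ultimately have "hq (grefl (N i) y) \<i> < hq y \<i>" by linarith
    moreover have "hq (grefl (N i) y) \<i> = hq z (ract N (w @ [i]) \<i>)"
    proof -
      have r: "grefl (N i) y \<in> H2" using grefl_H2[OF tiling_det y] .
      have "hq (grefl (N i) y) \<i> = hq (ract N (w @ [i]) (grefl (N i) y)) (ract N (w @ [i]) \<i>)"
        using hq_ract[OF r ii] by simp
      also have "ract N (w @ [i]) (grefl (N i) y) = z" using zy grefl_invol[OF tiling_det y] by (simp add: ract_append)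
      finally show ?thesis .
    qed
    moreover have "hq y \<i> = hq z (ract N w \<i>)" using hq_ract[OF y ii, of w] zy by simp
    ultimately show False using w[of "w @ [i]"] by simp
  qed
  then show ?thesis using that y zy by (auto simp: tile_def)
qed

end

text \<open>A map between tiles that respects the sides extends, because a tile meets only the tiles
  obtained by reflecting it in one side.\<close>
lemma ract_well_defined:
  assumes N: "tiling N" and N': "tiling N'"
    and D: "\<And>y. y \<in> tile N \<Longrightarrow> D y \<in> tile N'"
    and side: "\<And>y i. y \<in> tile N \<Longrightarrow> gform (N i) y = 0 \<Longrightarrow> gform (N' i) (D y) = 0"
    and y: "y1 \<in> tile N" "y2 \<in> tile N" and eq: "ract N w y1 = y2"
  shows "ract N' w (D y1) = D y2"
  using eq
proof (induction "length w" arbitrary: w rule: less_induct)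
  case less
  have H: "y1 \<in> H2" "D y1 \<in> H2" using y D tile_subset[OF N] tile_subset[OF N'] by blast+
  show ?case
  proof (cases "distinct_adj w")
    case False
    then obtain a i b where w: "w = a @ [i, i] @ b" by (rule not_distinct_adjE)
    have "ract N w y1 = ract N (a @ b) y1"
      using ract_H2[OF N H(1)] by (simp add: w ract_append grefl_invol[OF tiling_det[OF N]] del: H2_iff)
    moreover have "ract N' w (D y1) = ract N' (a @ b) (D y1)"
      using ract_H2[OF N' H(2)] by (simp add: w ract_append grefl_invol[OF tiling_det[OF N']] del: H2_iff)
    moreover have "length (a @ b) < length w" by (simp add: w)
    ultimately show ?thesis using less by simp
  next
    case True
    show ?thesis
    proof (cases w)
      case Nil
      then show ?thesis using less by simp
    next
      case (Cons i v)
      have p: "gform (N i) y2 \<le> 0" "v \<noteq> [] \<Longrightarrow> gform (N i) y2 < 0"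
        using ping_pong[OF N _ y(1), of i v] True Cons less by auto
      have "gform (N i) y2 \<ge> 0" using y by (simp add: tile_def)
      then have v: "v = []" and z: "gform (N i) y2 = 0" using p by force+
      have "y2 = grefl (N i) y1" using less v Cons by simp
      then have "y1 = grefl (N i) y2" using grefl_invol[OF tiling_det[OF N] H(1)] by simp
      also have "\<dots> = y2" using grefl_fixed[OF tiling_det[OF N] tile_subset[OF N y(2)] z] .
      finally have "y1 = y2" .
      moreover have "grefl (N' i) (D y2) = D y2"
        using grefl_fixed[OF tiling_det[OF N'] tile_subset[OF N' D[OF y(2)]] side[OF y(2) z]] .
      ultimately show ?thesis using v Cons by simp
    qed
  qed
qed

text \<open>Every point has an address \<open>(w, y)\<close>, and \<open>ract_well_defined\<close>
  makes the value independent of the one chosen. Near a point of a side only the tile and its mirror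
  image matter, because the other sides are disjoint from that one, so continuity there follows by
  pasting two closed sets; elsewhere it is transported by reflections.\<close>

lemma tile_map_extends:
  assumes N: "tiling N" and N': "tiling N'"
    and D: "\<And>y. y \<in> tile N \<Longrightarrow> D y \<in> tile N'" "continuous_on (tile N) D"
    and side: "\<And>y i. y \<in> tile N \<Longrightarrow> gform (N i) y = 0 \<Longrightarrow> gform (N' i) (D y) = 0"
  obtains E where "\<And>w y. y \<in> tile N \<Longrightarrow> E (ract N w y) = ract N' w (D y)" "continuous_on H2 E"
proof -
  define E where "E z = (SOME v. \<exists>w y. y \<in> tile N \<and> z = ract N w y \<and> v = ract N' w (D y))" for z
  have E: "E (ract N w y) = ract N' w (D y)" if y: "y \<in> tile N" for w y
  proof -
    have "\<exists>w' y'. y' \<in> tile N \<and> ract N w y = ract N w' y' \<and> E (ract N w y) = ract N' w' (D y')"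
      unfolding E_def by (rule someI[of _ "ract N' w (D y)"]) (use y in blast)
    then obtain w' y' where y': "y' \<in> tile N" "ract N w y = ract N w' y'" "E (ract N w y) = ract N' w' (D y')"
      by blast
    have H: "y \<in> H2" "y' \<in> H2" "D y \<in> H2" "D y' \<in> H2" using y y' D tile_subset[OF N] tile_subset[OF N'] by blast+
    have e: "ract N (rev w @ w') y' = y" using y' ract_rev(1)[OF N H(1)] by (simp add: ract_append flip: y'(2))
    have "ract N' (rev w @ w') (D y') = D y"
      by (rule ract_well_defined[OF N N' D(1) side y'(1) y e])
    then have "ract N' w (ract N' (rev w) (ract N' w' (D y'))) = ract N' w (D y)" by (simp add: ract_append)
    then show ?thesis using y'(3) ract_rev(2)[OF N' ract_H2[OF N' H(4)]] by simp
  qed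
  have E0: "E y = D y" if "y \<in> tile N" for y using E[OF that, of "[]"] by simp
  have Ew: "E (ract N w z) = ract N' w (E z)" if z: "z \<in> H2" for w z
  proof -
    obtain u y where uy: "y \<in> tile N" "z = ract N u y" using tiles_cover[OF N z] by blast
    have "E (ract N (w @ u) y) = ract N' (w @ u) (D y)" using E uy by blast
    then show ?thesis using E[OF uy(1), of u] uy(2) by (simp add: ract_append)
  qed
  have EH: "E z \<in> H2" if z: "z \<in> H2" for z
  proof -
    obtain u y where uy: "y \<in> tile N" "z = ract N u y" using tiles_cover[OF N z] by blast
    then show ?thesis using E[OF uy(1), of u] ract_H2[OF N'] D(1) tile_subset[OF N'] by simp
  qed
  have cont_tile: "isCont E y" if y: "y \<in> tile N" for y
  proof (cases "\<exists>i. gform (N i) y = 0")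
    case False
    then have pos: "\<And>i. gform (N i) y > 0" using y by (metis (mono_tags, lifting) tile_def mem_Collect_eq order_le_less)
    define U where "U = H2 \<inter> (\<Inter>i. {z. gform (N i) z > 0})"
    have "open U" unfolding U_def by (rule open_sides)
    moreover have "y \<in> U" using pos tile_subset[OF N y] by (simp add: U_def)
    moreover have "U \<subseteq> tile N" by (auto simp: U_def tile_def intro: less_imp_le)
    then have "continuous_on U E" using E0 D(2) by (metis continuous_on_cong continuous_on_subset subset_iff)
    ultimately show ?thesis by (simp add: continuous_on_eq_continuous_at)
  next
    case True
    then obtain i where i: "gform (N i) y = 0" by blast
    have yH: "y \<in> H2" using tile_subset[OF N y] .
    define V where "V = H2 \<inter> (\<Inter>j\<in>-{i}. {z. gform (N j) z > 0})"
    have oV: "open V" unfolding V_def by (rule open_sides)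
    have yV: "y \<in> V" using tiling_disjoint[OF N, of i _ y] i yH by (auto simp: V_def)
    have rc: "continuous_on H2 (grefl (N i))" using continuous_on_ract[OF N, of "[i]"] by simp
    have rH: "grefl (N i) z \<in> H2" if "z \<in> H2" for z using grefl_H2[OF tiling_det[OF N] that] .
    \<comment> \<open>On \<open>W\<close> both a point and its mirror image in side \<open>i\<close>
      are strictly inside all other sides, so one of the two lies in the tile.\<close>
    define W where "W = V \<inter> (H2 \<inter> grefl (N i) -` V)"
    have "open (H2 \<inter> grefl (N i) -` V)" using continuous_open_preimage[OF rc open_H2 oV] .
    then have oW: "open W" unfolding W_def using oV by blast
    have yW: "y \<in> W" using yV yH grefl_fixed[OF tiling_det[OF N] yH i] by (simp add: W_def)
    define W1 where "W1 = W \<inter> {z. gform (N i) z \<ge> 0}"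
    define W2 where "W2 = W \<inter> {z. gform (N i) z \<le> 0}"
    have WH: "z \<in> H2" if "z \<in> W" for z using that by (simp add: W_def V_def)
    have W1: "W1 \<subseteq> tile N"
    proof
      fix z assume z: "z \<in> W1"
      have "gform (N j) z \<ge> 0" for j
        using z by (cases "j = i") (auto simp: W1_def W_def V_def intro: less_imp_le)
      then show "z \<in> tile N" using z WH by (auto simp: W1_def tile_def)
    qed
    have W2: "grefl (N i) z \<in> tile N" if z: "z \<in> W2" for z
    proof -
      have zH: "z \<in> H2" using z WH by (auto simp: W2_def)
      have "gform (N j) (grefl (N i) z) \<ge> 0" for j
      proof (cases "j = i")
        case True
        have "gform (N i) z \<le> 0" using z by (simp add: W2_def)
        then show ?thesis using gform_grefl_neg_iff[OF tiling_det[OF N] zH, of i] True by (metis not_le)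
      next
        case False
        then show ?thesis using z by (auto simp: W2_def W_def V_def intro: less_imp_le)
      qed
      then show ?thesis using rH[OF zH] by (simp add: tile_def)
    qed
    have c1: "continuous_on W1 E" using W1 E0 D(2) by (metis continuous_on_cong continuous_on_subset subset_iff)
    have c2: "continuous_on W2 E"
    proof -
      have W2H: "W2 \<subseteq> H2" using WH by (auto simp: W2_def)
      have cA: "continuous_on W2 (\<lambda>z. D (grefl (N i) z))"
        using W2 continuous_on_subset[OF rc W2H] by (intro continuous_on_compose2[OF D(2)]) auto
      have cB: "continuous_on H2 (grefl (N' i))" using continuous_on_ract[OF N', of "[i]"] by simp
      have c: "continuous_on W2 (\<lambda>z. grefl (N' i) (D (grefl (N i) z)))"
        by (rule continuous_on_compose2[OF cB cA]) (use W2 D(1) tile_subset[OF N'] in blast)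
      have "E z = grefl (N' i) (D (grefl (N i) z))" if "z \<in> W2" for z
        using E[OF W2[OF that], of "[i]"] grefl_invol[OF tiling_det[OF N]] W2H that by auto
      then show ?thesis using c by (metis (mono_tags, lifting) continuous_on_cong)
    qed
    have WW: "W = W1 \<union> W2" by (auto simp: W1_def W2_def)
    have "closed {z. gform (N i) z \<ge> 0}" "closed {z. gform (N i) z \<le> 0}"
      by (intro closed_Collect_le continuous_intros)+
    then have "closedin (top_of_set W) W1" "closedin (top_of_set W) W2"
      unfolding W1_def W2_def by (simp_all add: closedin_closed_Int)
    then have "continuous_on W E" using c1 c2 unfolding WW by (intro continuous_on_Un_local) auto
    then show ?thesis using oW yW by (simp add: continuous_on_eq_continuous_at)
  qed
  have "isCont E z" if z: "z \<in> H2" for z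
  proof -
    obtain u y where uy: "y \<in> tile N" "z = ract N u y" using tiles_cover[OF N z] by blast
    have yH: "y \<in> H2" using tile_subset[OF N uy(1)] .
    have cont: "isCont (ract N w) x" "isCont (ract N' w) x" if "x \<in> H2" for w x
      using continuous_on_ract[OF N] continuous_on_ract[OF N'] that open_H2
      by (auto simp: continuous_on_eq_continuous_at)
    have zy: "ract N (rev u) z = y" using uy ract_rev(1)[OF N yH] by simp
    have "isCont E (ract N (rev u) z)" using cont_tile[OF uy(1)] zy by simp
    then have c: "isCont (\<lambda>x. E (ract N (rev u) x)) z" by (rule isCont_o2[OF cont(1)[OF z]])
    have "isCont (ract N' u) (E (ract N (rev u) z))" using cont(2)[OF EH[OF yH]] zy by simp
    then have c2: "isCont (\<lambda>x. ract N' u (E (ract N (rev u) x))) z" by (rule isCont_o2[OF c])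
    \<comment> \<open>Equivariance expresses \<open>E\<close> near \<open>z\<close> through its
      behaviour near the tile point \<open>y\<close>.\<close>
    have ev: "\<forall>\<^sub>F x in nhds z. ract N' u (E (ract N (rev u) x)) = E x"
    proof -
      have "\<forall>\<^sub>F x in nhds z. x \<in> H2" using z open_H2 by (rule eventually_nhds_in_open[rotated])
      then show ?thesis
      proof eventually_elim
        case (elim x)
        show ?case using Ew[OF ract_H2[OF N elim], of u "rev u"] ract_rev(2)[OF N elim] by simp
      qed
    qed
    show ?thesis using isCont_cong[OF ev] c2 by simp
  qed
  then have "continuous_on H2 E" by (simp add: continuous_at_imp_continuous_on)
  then show ?thesis using that E by blast
qed

lemma tile_homeomorphism_extends:
  assumes N: "tiling N" and N': "tiling N'"
    and hom: "homeomorphism (tile N) (tile N') D D'"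
    and side: "\<And>y i. y \<in> tile N \<Longrightarrow> gform (N i) y = 0 \<Longrightarrow> gform (N' i) (D y) = 0"
      "\<And>y i. y \<in> tile N' \<Longrightarrow> gform (N' i) y = 0 \<Longrightarrow> gform (N i) (D' y) = 0"
  obtains E E' where "homeomorphism H2 H2 E E'" "\<And>w y. y \<in> tile N \<Longrightarrow> E (ract N w y) = ract N' w (D y)"
proof -
  have D: "\<And>y. y \<in> tile N \<Longrightarrow> D y \<in> tile N'" "\<And>y. y \<in> tile N' \<Longrightarrow> D' y \<in> tile N"
    "continuous_on (tile N) D" "continuous_on (tile N') D'"
    "\<And>y. y \<in> tile N \<Longrightarrow> D' (D y) = y" "\<And>y. y \<in> tile N' \<Longrightarrow> D (D' y) = y"
    using hom unfolding homeomorphism_def by blast+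
  obtain E where E: "\<And>w y. y \<in> tile N \<Longrightarrow> E (ract N w y) = ract N' w (D y)" "continuous_on H2 E"
    using tile_map_extends[OF N N' D(1,3) side(1)] by blast
  obtain E' where E': "\<And>w y. y \<in> tile N' \<Longrightarrow> E' (ract N' w y) = ract N w (D' y)" "continuous_on H2 E'"
    using tile_map_extends[OF N' N D(2,4) side(2)] by blast
  have "E z \<in> H2 \<and> E' (E z) = z" if z: "z \<in> H2" for z
  proof -
    obtain w y where "y \<in> tile N" "z = ract N w y" using tiles_cover[OF N z] by blast
    then show ?thesis using E E' D ract_H2[OF N'] tile_subset[OF N'] by simp
  qed
  moreover have "E' z \<in> H2 \<and> E (E' z) = z" if z: "z \<in> H2" for z
  proof -
    obtain w y where "y \<in> tile N'" "z = ract N' w y" using tiles_cover[OF N' z] by blast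
    then show ?thesis using E E' D ract_H2[OF N] tile_subset[OF N] by simp
  qed
  ultimately have "homeomorphism H2 H2 E E'" using E(2) E'(2) by (intro homeomorphismI) auto
  then show ?thesis using that E(1) by blast
qed

section \<open>Homeomorphisms between the fundamental domains\<close>

text \<open>In the coordinates \<open>ln (cmod z)\<close> and \<open>Re z / cmod z\<close> the fundamental domain is the region
  \<open>\<bar>r\<bar> \<le> l\<close>, \<open>- k * cosh (r + m) \<le> c \<le> k * cosh (r - m)\<close> of the strip \<open>\<bar>c\<bar> < 1\<close>.\<close>
definition gparam :: "real \<Rightarrow> real \<Rightarrow> real \<Rightarrow> bool" where
  "gparam l m k \<longleftrightarrow> \<bar>m\<bar> < l \<and> 0 < k \<and> k < 1 \<and> k * cosh (l - m) \<ge> 1 \<and> k * cosh (l + m) \<ge> 1"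

definition region :: "real \<Rightarrow> real \<Rightarrow> real \<Rightarrow> (real \<times> real) set" where
  "region l m k = {x. \<bar>fst x\<bar> \<le> l \<and> \<bar>snd x\<bar> < 1 \<and> snd x \<le> k * cosh (fst x - m) \<and> - snd x \<le> k * cosh (fst x + m)}"

text \<open>The slice of the region at height \<open>c \<ge> 0\<close> consists of \<open>[edge m k c, l]\<close> and the
  mirror image of \<open>[edge (- m) k c, l]\<close>; below height \<open>k\<close> the two abut.\<close>
definition edge :: "real \<Rightarrow> real \<Rightarrow> real \<Rightarrow> real" where
  "edge m k c = m * min 1 (c / k) + arcosh (max 1 (c / k))"

definition quad :: "real \<Rightarrow> real \<Rightarrow> real \<Rightarrow> (real \<times> real) set" where
  "quad l m k = {x. 0 \<le> snd x \<and> snd x < 1 \<and> edge m k (snd x) \<le> fst x \<and> fst x \<le> l}"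

text \<open>The exponent is chosen so that the power map on heights fixes 0 and 1 and sends
  \<open>k\<close> to \<open>k'\<close>. Each horizontal slice is then mapped affinely, outer end to
  outer end and edge to edge.\<close>

definition qmap :: "real \<Rightarrow> real \<Rightarrow> real \<Rightarrow> real \<Rightarrow> real \<Rightarrow> real \<Rightarrow> real \<times> real \<Rightarrow> real \<times> real" where
  "qmap l m k l' m' k' x =
    (l' - (l' - edge m' k' (snd x powr (ln k' / ln k))) * ((l - fst x) / (l - edge m k (snd x))),
     snd x powr (ln k' / ln k))"

definition sgns :: "real set" where "sgns = {1, - 1}"

text \<open>Reversing one coordinate axis replaces \<open>m\<close> by \<open>- m\<close>, reversing
  both preserves it; hence the factor \<open>\<sigma> * \<tau>\<close>.\<close>

definition piece :: "real \<Rightarrow> real \<Rightarrow> real \<Rightarrow> real \<Rightarrow> real \<Rightarrow> (real \<times> real) set" where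
  "piece l m k \<sigma> \<tau> = {x. (\<sigma> * fst x, \<tau> * snd x) \<in> quad l (\<sigma> * \<tau> * m) k}"

definition pmap :: "real \<Rightarrow> real \<Rightarrow> real \<Rightarrow> real \<Rightarrow> real \<Rightarrow> real \<Rightarrow> real \<Rightarrow> real \<Rightarrow> real \<times> real \<Rightarrow> real \<times> real" where
  "pmap l m k l' m' k' \<sigma> \<tau> x =
    (let y = qmap l (\<sigma> * \<tau> * m) k l' (\<sigma> * \<tau> * m') k' (\<sigma> * fst x, \<tau> * snd x)
     in (\<sigma> * fst y, \<tau> * snd y))"

definition rmap :: "real \<Rightarrow> real \<Rightarrow> real \<Rightarrow> real \<Rightarrow> real \<Rightarrow> real \<Rightarrow> real \<times> real \<Rightarrow> real \<times> real" where
  "rmap l m k l' m' k' x =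
    (let (\<sigma>, \<tau>) = (SOME (\<sigma>, \<tau>). \<sigma> \<in> sgns \<and> \<tau> \<in> sgns \<and> x \<in> piece l m k \<sigma> \<tau>)
     in pmap l m k l' m' k' \<sigma> \<tau> x)"

lemma sgns_sq: "\<sigma> \<in> sgns \<Longrightarrow> \<sigma> * \<sigma> = 1" "\<sigma> \<in> sgns \<Longrightarrow> \<sigma> * (\<sigma> * x) = x" "\<sigma> \<in> sgns \<Longrightarrow> \<bar>\<sigma>\<bar> = 1"
  by (auto simp: sgns_def)

lemma sgns_mult: "\<sigma> \<in> sgns \<Longrightarrow> \<tau> \<in> sgns \<Longrightarrow> \<sigma> * \<tau> \<in> sgns"
  by (auto simp: sgns_def)

lemma gparam_flip: "gparam l m k \<Longrightarrow> \<sigma> \<in> sgns \<Longrightarrow> gparam l (\<sigma> * m) k"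
  by (auto simp: gparam_def sgns_def)

lemma edge_low: "c \<le> k \<Longrightarrow> 0 < k \<Longrightarrow> edge m k c = m * (c / k)"
  by (simp add: edge_def min_absorb2 max_absorb1 divide_le_eq_1)

lemma edge_high: "k \<le> c \<Longrightarrow> 0 < k \<Longrightarrow> edge m k c = m + arcosh (c / k)"
  by (simp add: edge_def min_absorb1 max_absorb2 le_divide_eq_1)

text \<open>The slices of a quadrilateral have positive length, which is what \<open>qmap\<close>
  divides by.\<close>

lemma edge_less:
  assumes "gparam l m k" "0 \<le> c" "c < 1" shows "edge m k c < l"
proof (cases "c \<le> k")
  case True
  have k: "0 < k" "\<bar>m\<bar> < l" using assms by (auto simp: gparam_def)
  have "\<bar>m * (c / k)\<bar> \<le> \<bar>m\<bar> * 1"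
    unfolding abs_mult using True k assms by (intro mult_left_mono) auto
  then have "m * (c / k) < l" using k by linarith
  then show ?thesis using k edge_low[OF True] by simp
next
  case False
  have k: "0 < k" "\<bar>m\<bar> < l" "1 \<le> k * cosh (l - m)" using assms by (auto simp: gparam_def)
  have "c / k < cosh (l - m)" using k assms by (simp add: field_simps)
  moreover have "c / k \<ge> 1" using False k by simp
  ultimately have "arcosh (c / k) < arcosh (cosh (l - m))" using arcosh_real_strict_mono by blast
  also have "\<dots> = l - m" using k by (intro arcosh_cosh_real) auto
  finally show ?thesis using edge_high[of k c m] False k by simp
qed

lemma edge_ge: "0 < k \<Longrightarrow> 0 \<le> c \<Longrightarrow> edge m k c \<ge> - \<bar>m\<bar>"
proof -
  assume k: "0 < k" "0 \<le> c"
  have "\<bar>m * min 1 (c / k)\<bar> \<le> \<bar>m\<bar> * 1"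
    unfolding abs_mult using k by (intro mult_left_mono) auto
  moreover have "arcosh (max 1 (c / k)) \<ge> 0" by simp
  ultimately show ?thesis unfolding edge_def
    using abs_ge_minus_self[of "m * min 1 (c / k)"] by linarith
qed

lemma continuous_on_edge [continuous_intros]:
  "continuous_on S f \<Longrightarrow> continuous_on S (\<lambda>x. edge m k (f x))"
proof -
  assume f: "continuous_on S f"
  have "continuous_on S (\<lambda>x. f x / k)"
    using continuous_on_mult_right[OF f, of "inverse k"] by (simp add: divide_inverse)
  then have c: "continuous_on S (\<lambda>x. min 1 (f x / k))" "continuous_on S (\<lambda>x. max 1 (f x / k))"
    by (intro continuous_on_min continuous_on_max continuous_on_const; assumption)+
  have "continuous_on S (\<lambda>x. arcosh (max 1 (f x / k)))"
    by (rule continuous_on_compose2[OF continuous_on_arcosh[of "{1..}"] c(2)]) auto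
  then show ?thesis unfolding edge_def by (intro continuous_on_add continuous_on_mult continuous_on_const c(1))
qed

text \<open>\<open>\<tau>\<close> is the sign of the height and \<open>\<sigma>\<close> the side of
  the common edge. Above height \<open>k\<close> the two edges separate, and the gap between them is
  exactly what the \<open>cosh\<close> curve cuts off.\<close>

lemma region_eq_pieces:
  assumes g: "gparam l m k"
  shows "x \<in> region l m k \<longleftrightarrow> (\<exists>\<sigma>\<in>sgns. \<exists>\<tau>\<in>sgns. x \<in> piece l m k \<sigma> \<tau>)"
proof
  have k: "0 < k" "\<bar>m\<bar> < l" using g by (auto simp: gparam_def)
  obtain r c where x: "x = (r, c)" by (cases x)
  {
    assume "x \<in> region l m k"
    then have R: "\<bar>r\<bar> \<le> l" "\<bar>c\<bar> < 1" "c \<le> k * cosh (r - m)" "- c \<le> k * cosh (r + m)"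
      by (auto simp: region_def x)
    define \<tau> :: real where "\<tau> = (if c \<ge> 0 then 1 else - 1)"
    have t: "\<tau> \<in> sgns" "0 \<le> \<tau> * c" "\<tau> * c < 1" using R by (auto simp: \<tau>_def sgns_def)
    have tc: "\<tau> * c \<le> k * cosh (r - \<tau> * m)" using R by (auto simp: \<tau>_def)
    \<comment> \<open>The horizontal offset from the interface: the slanted segment from the origin
      to the extremum of the curve up to height \<open>k\<close>, the vertical line through that
      extremum beyond.\<close>
    define u where "u = (if \<tau> * c \<le> k then r - \<tau> * m * (\<tau> * c / k) else r - \<tau> * m)"
    define \<sigma> :: real where "\<sigma> = (if u \<ge> 0 then 1 else - 1)"
    have s: "\<sigma> \<in> sgns" "\<sigma> * u = \<bar>u\<bar>" by (auto simp: \<sigma>_def sgns_def)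
    have "edge (\<sigma> * \<tau> * m) k (\<tau> * c) \<le> \<sigma> * r"
    proof (cases "\<tau> * c \<le> k")
      case True
      have "0 \<le> \<sigma> * u" using s by simp
      then show ?thesis using True k by (simp add: edge_low u_def algebra_simps)
    next
      case False
      have "\<tau> * c / k \<le> cosh \<bar>u\<bar>" using tc k False by (simp add: u_def field_simps)
      moreover have "1 \<le> \<tau> * c / k" using False k by simp
      ultimately have "arcosh (\<tau> * c / k) \<le> arcosh (cosh \<bar>u\<bar>)"
        by (meson arcosh_less_iff_real cosh_real_ge_1 not_less)
      also have "\<dots> = \<sigma> * u" using s by (simp only: arcosh_cosh_real abs_ge_zero)
      finally show ?thesis using False k by (simp add: edge_high u_def algebra_simps)
    qed
    moreover have "\<sigma> * r \<le> l" using R s by (auto simp: sgns_def)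
    ultimately have "x \<in> piece l m k \<sigma> \<tau>" using t by (simp add: piece_def quad_def x)
    then show "\<exists>\<sigma>\<in>sgns. \<exists>\<tau>\<in>sgns. x \<in> piece l m k \<sigma> \<tau>" using s t by blast
  next
    assume "\<exists>\<sigma>\<in>sgns. \<exists>\<tau>\<in>sgns. x \<in> piece l m k \<sigma> \<tau>"
    then obtain \<sigma> \<tau> where st: "\<sigma> \<in> sgns" "\<tau> \<in> sgns" and "x \<in> piece l m k \<sigma> \<tau>" by blast
    then have q: "0 \<le> \<tau> * c" "\<tau> * c < 1" "edge (\<sigma> * \<tau> * m) k (\<tau> * c) \<le> \<sigma> * r" "\<sigma> * r \<le> l"
      by (auto simp: piece_def quad_def x)
    have "- \<bar>m\<bar> \<le> edge (\<sigma> * \<tau> * m) k (\<tau> * c)"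
      using edge_ge[OF k(1) q(1), of "\<sigma> * \<tau> * m"] st by (simp add: abs_mult sgns_sq)
    then have "\<bar>r\<bar> \<le> l" using q k st by (auto simp: sgns_def)
    moreover have c1: "\<bar>c\<bar> < 1" using q st by (auto simp: sgns_def)
    moreover have "\<tau> * c \<le> k * cosh (r - \<tau> * m)"
    proof (cases "\<tau> * c \<le> k")
      case True
      have "k * 1 \<le> k * cosh (r - \<tau> * m)" using k by (intro mult_left_mono cosh_real_ge_1) auto
      then show ?thesis using True by simp
    next
      case False
      have "arcosh (\<tau> * c / k) \<le> \<sigma> * (r - \<tau> * m)" using q False k by (simp add: edge_high algebra_simps)
      also have "\<dots> \<le> \<bar>r - \<tau> * m\<bar>" using st by (auto simp: sgns_def)
      finally have "cosh (arcosh (\<tau> * c / k)) \<le> cosh \<bar>r - \<tau> * m\<bar>"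
        using False k by (subst cosh_real_nonneg_le_iff) auto
      then show ?thesis using False k by (simp add: field_simps)
    qed
    moreover have "- (\<tau> * c) \<le> k * cosh (r + \<tau> * m)" using q k cosh_real_ge_1[of "r + \<tau> * m"]
      by (smt (verit) mult_nonneg_nonneg)
    ultimately show "x \<in> region l m k" using st by (auto simp: region_def x sgns_def)
  }
qed

context
  fixes l m k l' m' k' :: real
  assumes g: "gparam l m k" and g': "gparam l' m' k'"
begin

lemma height_exponent: "ln k' / ln k > 0" "k powr (ln k' / ln k) = k'"
proof -
  have k: "0 < k" "k < 1" "0 < k'" "k' < 1" using g g' by (auto simp: gparam_def)
  then show "ln k' / ln k > 0" by (simp add: divide_neg_neg)
  show "k powr (ln k' / ln k) = k'" using k by (simp add: powr_def)
qed

lemma height_mono: "0 \<le> c \<Longrightarrow> c \<le> k \<Longrightarrow> c powr (ln k' / ln k) \<le> k'"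
  and height_mono': "k \<le> c \<Longrightarrow> k' \<le> c powr (ln k' / ln k)"
  using height_exponent powr_mono2[of "ln k' / ln k" c k] powr_mono2[of "ln k' / ln k" k c] g
  by (auto simp: gparam_def)

lemma height_range: "0 \<le> c \<Longrightarrow> c < 1 \<Longrightarrow> c powr (ln k' / ln k) < 1"
  using powr_less_mono2[of "ln k' / ln k" c 1] height_exponent by simp

lemma qmap_quad:
  assumes x: "x \<in> quad l m k"
  shows "qmap l m k l' m' k' x \<in> quad l' m' k'"
    and "qmap l' m' k' l m k (qmap l m k l' m' k' x) = x"
proof -
  obtain r c where xx: "x = (r, c)" by (cases x)
  have q: "0 \<le> c" "c < 1" "edge m k c \<le> r" "r \<le> l" using x by (auto simp: quad_def xx)
  define c' where "c' = c powr (ln k' / ln k)"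
  have c': "0 \<le> c'" "c' < 1" using height_range q by (auto simp: c'_def)
  define e where "e = edge m k c"
  define e' where "e' = edge m' k' c'"
  have e: "e < l" "e' < l'" using edge_less[OF g q(1,2)] edge_less[OF g' c'] by (auto simp: e_def e'_def)
  define t where "t = (l - r) / (l - e)"
  have t: "0 \<le> t" "t \<le> 1" using q e by (auto simp: t_def e_def[symmetric])
  have Q: "qmap l m k l' m' k' x = (l' - (l' - e') * t, c')"
    by (simp add: qmap_def xx c'_def e'_def e_def t_def)
  have "(l' - e') * t \<le> (l' - e') * 1" "0 \<le> (l' - e') * t" using t e by (auto intro: mult_left_mono)
  then show "qmap l m k l' m' k' x \<in> quad l' m' k'" using c' by (simp add: Q quad_def e'_def[symmetric])
  have k: "0 < k" "k < 1" "0 < k'" "k' < 1" using g g' by (auto simp: gparam_def)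
  then have "ln k \<noteq> 0" "ln k' \<noteq> 0" by auto
  then have cc: "c' powr (ln k / ln k') = c" using q by (simp add: c'_def powr_powr)
  have "(l - e) * t = l - r" using e by (simp add: t_def)
  then show "qmap l' m' k' l m k (qmap l m k l' m' k' x) = x"
    unfolding Q unfolding qmap_def using e by (simp add: cc e_def[symmetric] e'_def[symmetric] xx)
qed

lemma continuous_on_qmap: "continuous_on (quad l m k) (qmap l m k l' m' k')"
proof -
  have c: "continuous_on (quad l m k) (\<lambda>x. snd x powr (ln k' / ln k))"
    using height_exponent by (intro continuous_on_powr' continuous_intros) (auto simp: quad_def)
  have n: "l - edge m k (snd x) \<noteq> 0" if "x \<in> quad l m k" for x
    using edge_less[OF g] that by (force simp: quad_def)
  show ?thesis unfolding qmap_def using n by (intro continuous_intros c) auto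
qed

lemma qmap_edge:
  assumes "0 \<le> c" "c < 1"
  shows "qmap l m k l' m' k' (edge m k c, c) = (edge m' k' (c powr (ln k' / ln k)), c powr (ln k' / ln k))"
  using edge_less[OF g assms] by (simp add: qmap_def)

lemma qmap_zero: "qmap l m k l' m' k' (r, 0) = (l' * r / l, 0)"
proof -
  have "0 < l" "0 < k" "0 < k'" using g g' by (auto simp: gparam_def)
  then show ?thesis by (simp add: qmap_def edge_low field_simps)
qed

end

context
  fixes l m k l' m' k' :: real
  assumes g: "gparam l m k" and g': "gparam l' m' k'"
begin

lemma pmap_piece:
  assumes "\<sigma> \<in> sgns" "\<tau> \<in> sgns" "x \<in> piece l m k \<sigma> \<tau>"
  shows "pmap l m k l' m' k' \<sigma> \<tau> x \<in> piece l' m' k' \<sigma> \<tau>"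
    and "pmap l' m' k' l m k \<sigma> \<tau> (pmap l m k l' m' k' \<sigma> \<tau> x) = x"
proof -
  have st: "\<sigma> * \<tau> \<in> sgns" using sgns_mult assms by simp
  note G = gparam_flip[OF g st] gparam_flip[OF g' st]
  have q: "(\<sigma> * fst x, \<tau> * snd x) \<in> quad l (\<sigma> * \<tau> * m) k" using assms by (simp add: piece_def)
  note Q = qmap_quad[OF G q]
  show "pmap l m k l' m' k' \<sigma> \<tau> x \<in> piece l' m' k' \<sigma> \<tau>"
    using Q(1) assms by (simp add: pmap_def piece_def Let_def sgns_sq)
  show "pmap l' m' k' l m k \<sigma> \<tau> (pmap l m k l' m' k' \<sigma> \<tau> x) = x"
    using Q(2) assms by (simp add: pmap_def Let_def sgns_sq)
qed

lemma continuous_on_pmap: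
  assumes "\<sigma> \<in> sgns" "\<tau> \<in> sgns"
  shows "continuous_on (piece l m k \<sigma> \<tau>) (pmap l m k l' m' k' \<sigma> \<tau>)"
proof -
  have st: "\<sigma> * \<tau> \<in> sgns" using sgns_mult assms by simp
  have "continuous_on (piece l m k \<sigma> \<tau>) (\<lambda>x. qmap l (\<sigma> * \<tau> * m) k l' (\<sigma> * \<tau> * m') k' (\<sigma> * fst x, \<tau> * snd x))"
    by (intro continuous_on_compose2[OF continuous_on_qmap[OF gparam_flip[OF g st] gparam_flip[OF g' st]]] continuous_intros)
       (auto simp: piece_def)
  then show ?thesis unfolding pmap_def Let_def by (intro continuous_intros)
qed

text \<open>Pieces with the same \<open>\<tau>\<close> overlap along the slanted edge below height
  \<open>k\<close>, where \<open>edge\<close> is odd in \<open>m\<close>, so the images match.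
  Pieces with different \<open>\<tau>\<close> meet at height 0, where every piece uses the map
  \<open>r \<mapsto> l' * r / l\<close>.\<close>

lemma pmap_agree:
  assumes st: "\<sigma> \<in> sgns" "\<tau> \<in> sgns" "x \<in> piece l m k \<sigma> \<tau>"
    and st2: "\<sigma>2 \<in> sgns" "\<tau>2 \<in> sgns" "x \<in> piece l m k \<sigma>2 \<tau>2"
  shows "pmap l m k l' m' k' \<sigma> \<tau> x = pmap l m k l' m' k' \<sigma>2 \<tau>2 x"
proof -
  obtain r c where x: "x = (r, c)" by (cases x)
  have k: "0 < k" "0 < k'" using g g' by (auto simp: gparam_def)
  have q: "0 \<le> \<tau> * c" "\<tau> * c < 1" "edge (\<sigma> * \<tau> * m) k (\<tau> * c) \<le> \<sigma> * r"
    using st by (auto simp: piece_def quad_def x)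
  have q2: "0 \<le> \<tau>2 * c" "\<tau>2 * c < 1" "edge (\<sigma>2 * \<tau>2 * m) k (\<tau>2 * c) \<le> \<sigma>2 * r"
    using st2 by (auto simp: piece_def quad_def x)
  show ?thesis
  proof (cases "\<tau>2 = \<tau>")
    case t: True
    show ?thesis
    proof (cases "\<sigma>2 = \<sigma>")
      case False
      then have s: "\<sigma>2 = - \<sigma>" using st st2 by (auto simp: sgns_def)
      define M where "M = \<sigma> * \<tau> * m"
      define M' where "M' = \<sigma> * \<tau> * m'"
      define d where "d = \<tau> * c"
      have e1: "edge M k d \<le> \<sigma> * r" and e2: "edge (- M) k d \<le> - (\<sigma> * r)"
        using q q2 by (auto simp: M_def d_def s t)
      \<comment> \<open>Adding the two edge inequalities cancels the linear terms and leaves twice a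
        nonnegative number bounded by 0.\<close>
      have "arcosh (max 1 (d / k)) = 0"
        using e1 e2 arcosh_nonneg_real[of "max 1 (d / k)"] unfolding edge_def minus_mult_left[symmetric] by linarith
      then have "max 1 (d / k) = 1" by (simp add: arcosh_eq_0_iff_real)
      then have dk: "d \<le> k" using k by (simp add: max_def split: if_splits)
      then have r: "\<sigma> * r = edge M k d" "- \<sigma> * r = edge (- M) k d" using e1 e2 k by (auto simp: edge_low)
      define d' where "d' = d powr (ln k' / ln k)"
      have d': "d' \<le> k'" unfolding d'_def using height_mono[OF g g' _ dk] q by (simp add: d_def)
      have S: "\<sigma> * \<tau> \<in> sgns" "- \<sigma> * \<tau> \<in> sgns" using st by (auto simp: sgns_def)
      have "qmap l M k l' M' k' (\<sigma> * r, d) = (edge M' k' d', d')"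
        using qmap_edge[OF gparam_flip[OF g S(1)] gparam_flip[OF g' S(1)], of d] q r
        by (simp add: M_def M'_def d'_def d_def)
      moreover have "qmap l (- M) k l' (- M') k' (- \<sigma> * r, d) = (edge (- M') k' d', d')"
        using qmap_edge[OF gparam_flip[OF g S(2)] gparam_flip[OF g' S(2)], of d] q r
        by (simp add: M_def M'_def d'_def d_def)
      moreover have "edge (- M') k' d' = - edge M' k' d'" using d' k by (simp add: edge_low)
      ultimately show ?thesis by (simp add: pmap_def Let_def x s t M_def M'_def d_def)
    qed (simp add: t)
  next
    case False
    then have t: "\<tau>2 = - \<tau>" using st st2 by (auto simp: sgns_def)
    then have c: "c = 0" using q q2 st by (auto simp: sgns_def)
    have "pmap l m k l' m' k' s t x = (l' * r / l, 0)" if "s \<in> sgns" "t \<in> sgns" for s t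
    proof -
      have "qmap l (s * t * m) k l' (s * t * m') k' (s * r, 0) = (l' * (s * r) / l, 0)"
        by (rule qmap_zero[OF gparam_flip[OF g sgns_mult[OF that]] gparam_flip[OF g' sgns_mult[OF that]]])
      then have "pmap l m k l' m' k' s t x = (s * (l' * (s * r) / l), 0)"
        by (simp add: pmap_def Let_def x c)
      also have "s * (l' * (s * r) / l) = l' * r / l" using that(1) by (auto simp: sgns_def)
      finally show ?thesis .
    qed
    then show ?thesis using st st2 by simp
  qed
qed

lemma rmap_piece:
  assumes "\<sigma> \<in> sgns" "\<tau> \<in> sgns" "x \<in> piece l m k \<sigma> \<tau>"
  shows "rmap l m k l' m' k' x = pmap l m k l' m' k' \<sigma> \<tau> x"
proof -
  define st where "st = (SOME (\<sigma>, \<tau>). \<sigma> \<in> sgns \<and> \<tau> \<in> sgns \<and> x \<in> piece l m k \<sigma> \<tau>)"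
  have "case st of (\<sigma>, \<tau>) \<Rightarrow> \<sigma> \<in> sgns \<and> \<tau> \<in> sgns \<and> x \<in> piece l m k \<sigma> \<tau>"
    unfolding st_def by (rule someI[of _ "(\<sigma>, \<tau>)"]) (use assms in simp)
  then obtain \<sigma>2 \<tau>2 where s2: "st = (\<sigma>2, \<tau>2)" "\<sigma>2 \<in> sgns" "\<tau>2 \<in> sgns" "x \<in> piece l m k \<sigma>2 \<tau>2"
    by (cases st) auto
  have "rmap l m k l' m' k' x = pmap l m k l' m' k' \<sigma>2 \<tau>2 x"
    unfolding rmap_def st_def[symmetric] s2(1) by simp
  then show ?thesis using pmap_agree[OF s2(2,3,4) assms] by simp
qed

text \<open>In these coordinates the half-turn about \<open>\<i>\<close> is
  \<open>x \<mapsto> - x\<close>. Negating both signs keeps \<open>\<sigma> * \<tau>\<close>, so the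
  same quadrilateral map is used for \<open>x\<close> and \<open>- x\<close>.\<close>

lemma rmap_odd:
  assumes "x \<in> region l m k" shows "rmap l m k l' m' k' (- x) = - rmap l m k l' m' k' x"
proof -
  obtain \<sigma> \<tau> where st: "\<sigma> \<in> sgns" "\<tau> \<in> sgns" "x \<in> piece l m k \<sigma> \<tau>"
    using assms(1) unfolding region_eq_pieces[OF g] by blast
  have st2: "- \<sigma> \<in> sgns" "- \<tau> \<in> sgns" using st(1,2) by (auto simp: sgns_def)
  have p: "- x \<in> piece l m k (- \<sigma>) (- \<tau>)" using st(3) by (simp add: piece_def)
  have "pmap l m k l' m' k' (- \<sigma>) (- \<tau>) (- x) = - pmap l m k l' m' k' \<sigma> \<tau> x"
    by (simp add: pmap_def Let_def prod_eq_iff)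
  then show ?thesis by (simp only: rmap_piece[OF st] rmap_piece[OF st2 p])
qed

text \<open>Inside the region the strict and the outer bounds of a piece hold automatically, so only
  two weak inequalities cut it out. The pieces are therefore relatively closed and can be
  pasted.\<close>

lemma continuous_on_rmap: "continuous_on (region l m k) (rmap l m k l' m' k')"
proof -
  have closed: "closedin (top_of_set (region l m k)) (piece l m k \<sigma> \<tau>)" if "\<sigma> \<in> sgns" "\<tau> \<in> sgns" for \<sigma> \<tau>
  proof -
    have e: "piece l m k \<sigma> \<tau> = region l m k \<inter>
      ({x. 0 \<le> \<tau> * snd x} \<inter> {x. edge (\<sigma> * \<tau> * m) k (\<tau> * snd x) \<le> \<sigma> * fst x})"
    proof (rule set_eqI)
      fix x
      have a: "x \<in> region l m k \<Longrightarrow> \<tau> * snd x < 1 \<and> \<sigma> * fst x \<le> l"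
        using that by (auto simp: region_def sgns_def)
      have b: "x \<in> piece l m k \<sigma> \<tau> \<Longrightarrow> x \<in> region l m k"
        unfolding region_eq_pieces[OF g] using that by blast
      have pd: "x \<in> piece l m k \<sigma> \<tau> \<longleftrightarrow> 0 \<le> \<tau> * snd x \<and> \<tau> * snd x < 1 \<and>
          edge (\<sigma> * \<tau> * m) k (\<tau> * snd x) \<le> \<sigma> * fst x \<and> \<sigma> * fst x \<le> l"
        by (simp add: piece_def quad_def)
      show "x \<in> piece l m k \<sigma> \<tau> \<longleftrightarrow> x \<in> region l m k \<inter>
        ({x. 0 \<le> \<tau> * snd x} \<inter> {x. edge (\<sigma> * \<tau> * m) k (\<tau> * snd x) \<le> \<sigma> * fst x})"
        using a b pd unfolding Int_iff mem_Collect_eq by argo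
    qed
    have c: "closed ({x::real\<times>real. 0 \<le> \<tau> * snd x} \<inter> {x. edge (\<sigma> * \<tau> * m) k (\<tau> * snd x) \<le> \<sigma> * fst x})"
      by (intro closed_Int closed_Collect_le continuous_intros)
    show ?thesis unfolding e by (rule closedin_closed_Int[OF c])
  qed
  have cont: "continuous_on (piece l m k \<sigma> \<tau>) (rmap l m k l' m' k')" if "\<sigma> \<in> sgns" "\<tau> \<in> sgns" for \<sigma> \<tau>
    by (rule continuous_on_eq[OF continuous_on_pmap[OF that] rmap_piece[OF that, symmetric]])
  have s: "1 \<in> sgns" "- 1 \<in> sgns" by (auto simp: sgns_def)
  let ?P = "piece l m k"
  have R: "region l m k = (?P 1 1 \<union> ?P (-1) 1) \<union> (?P 1 (-1) \<union> ?P (-1) (-1))"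
    by (rule set_eqI) (unfold region_eq_pieces[OF g], auto simp: sgns_def)
  have mono: "closedin (top_of_set T) A" if "closedin (top_of_set (region l m k)) A" "A \<subseteq> T" "T \<subseteq> region l m k" for A T
    using closedin_subset_trans[OF that] .
  have sub: "?P \<sigma> \<tau> \<subseteq> region l m k" if "\<sigma> \<in> sgns" "\<tau> \<in> sgns" for \<sigma> \<tau>
    using closedin_subset[OF closed[OF that]] by simp
  have 1: "continuous_on (?P 1 \<tau> \<union> ?P (-1) \<tau>) (rmap l m k l' m' k')" if "\<tau> \<in> sgns" for \<tau>
    using sub[OF s(1) that] sub[OF s(2) that]
    by (intro continuous_on_Un_local mono[OF closed[OF s(1) that]] mono[OF closed[OF s(2) that]]
        cont[OF s(1) that] cont[OF s(2) that] Un_least Un_upper1 Un_upper2)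
  have 2: "closedin (top_of_set (region l m k)) (?P 1 \<tau> \<union> ?P (-1) \<tau>)" if "\<tau> \<in> sgns" for \<tau>
    by (intro closedin_Un closed s that)
  show ?thesis
    by (subst R, rule continuous_on_Un_local[OF _ _ 1[OF s(1)] 1[OF s(2)]])
       (use 2[OF s(1)] 2[OF s(2)] in \<open>simp_all only: R[symmetric]\<close>)
qed

lemma rmap_right:
  assumes "x \<in> region l m k" "fst x = l" shows "fst (rmap l m k l' m' k' x) = l'"
proof -
  obtain \<sigma> \<tau> where st: "\<sigma> \<in> sgns" "\<tau> \<in> sgns" "x \<in> piece l m k \<sigma> \<tau>"
    using assms(1) unfolding region_eq_pieces[OF g] by blast
  have "\<sigma> = 1"
  proof (rule ccontr)
    assume "\<sigma> \<noteq> 1"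
    then have s: "\<sigma> = - 1" using st by (simp add: sgns_def)
    have k: "0 < k" "\<bar>m\<bar> < l" using g by (auto simp: gparam_def)
    have "edge (\<sigma> * \<tau> * m) k (\<tau> * snd x) \<le> - l" "0 \<le> \<tau> * snd x" using st assms s by (auto simp: piece_def quad_def)
    moreover have "\<bar>\<sigma> * \<tau> * m\<bar> = \<bar>m\<bar>" using st by (simp add: abs_mult sgns_sq)
    ultimately show False using edge_ge[OF k(1), of "\<tau> * snd x" "\<sigma> * \<tau> * m"] k by linarith
  qed
  then show ?thesis using rmap_piece[OF st] assms by (simp add: pmap_def qmap_def)
qed

text \<open>On the curve \<open>arcosh (c / k)\<close> equals \<open>\<bar>r - m\<bar>\<close>,
  which forces equality in the edge condition of the piece. The point is thus the inner end of its
  slice, at height at least \<open>k\<close>, and \<open>qmap\<close> preserves both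
  properties.\<close>

lemma rmap_top:
  assumes x: "x \<in> region l m k" and t: "snd x = k * cosh (fst x - m)"
  shows "snd (rmap l m k l' m' k' x) = k' * cosh (fst (rmap l m k l' m' k' x) - m')"
proof -
  obtain r c where xx: "x = (r, c)" by (cases x)
  obtain \<sigma> \<tau> where st: "\<sigma> \<in> sgns" "\<tau> \<in> sgns" "x \<in> piece l m k \<sigma> \<tau>"
    using x unfolding region_eq_pieces[OF g] by blast
  have k: "0 < k" "0 < k'" using g g' by (auto simp: gparam_def)
  have c: "c = k * cosh (r - m)" using t xx by simp
  have kc: "k \<le> c" using mult_left_mono[OF cosh_real_ge_1, of k "r - m"] k c by simp
  then have "\<tau> = 1" using st k by (auto simp: piece_def quad_def xx sgns_def)
  then have q: "0 \<le> c" "c < 1" "edge (\<sigma> * m) k c \<le> \<sigma> * r" using st by (auto simp: piece_def quad_def xx)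
  have "c / k = cosh \<bar>r - m\<bar>" using c k by simp
  then have a: "arcosh (c / k) = \<bar>r - m\<bar>" by (simp only: arcosh_cosh_real abs_ge_zero)
  have "\<sigma> * (r - m) \<le> \<bar>r - m\<bar>" using st by (auto simp: sgns_def)
  then have e: "\<sigma> * r = edge (\<sigma> * m) k c" using q edge_high[OF kc k(1), of "\<sigma> * m"] a by (simp add: algebra_simps)
  define c' where "c' = c powr (ln k' / ln k)"
  have kc': "k' \<le> c'" unfolding c'_def using height_mono'[OF g g' kc] .
  have "rmap l m k l' m' k' x = (\<sigma> * edge (\<sigma> * m') k' c', c')"
    unfolding rmap_piece[OF st]
    using qmap_edge[OF gparam_flip[OF g st(1)] gparam_flip[OF g' st(1)] q(1,2)] e
    by (simp add: pmap_def Let_def xx \<open>\<tau> = 1\<close> c'_def)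
  moreover have "\<sigma> * edge (\<sigma> * m') k' c' = m' + \<sigma> * arcosh (c' / k')"
    using edge_high[OF kc' k(2)] st by (simp add: distrib_left sgns_sq)
  moreover have "cosh (\<sigma> * arcosh (c' / k')) = c' / k'" using st kc' k by (auto simp: sgns_def)
  ultimately show ?thesis using k by simp
qed

end

lemma rmap_region:
  assumes g: "gparam l m k" and g': "gparam l' m' k'" and x: "x \<in> region l m k"
  shows "rmap l m k l' m' k' x \<in> region l' m' k'"
    "rmap l' m' k' l m k (rmap l m k l' m' k' x) = x"
proof -
  obtain \<sigma> \<tau> where st: "\<sigma> \<in> sgns" "\<tau> \<in> sgns" "x \<in> piece l m k \<sigma> \<tau>"
    using x unfolding region_eq_pieces[OF g] by blast
  note p = pmap_piece[OF g g' st]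
  show "rmap l m k l' m' k' x \<in> region l' m' k'"
    unfolding region_eq_pieces[OF g'] rmap_piece[OF g g' st] using p(1) st(1,2) by blast
  show "rmap l' m' k' l m k (rmap l m k l' m' k' x) = x"
    unfolding rmap_piece[OF g g' st] rmap_piece[OF g' g st(1,2) p(1)] by (rule p(2))
qed

section \<open>Polar coordinates and the sides of the normal form\<close>

lemma cosh_neg: "cosh (- a - b) = cosh (a + b :: real)" "cosh (- a + b) = cosh (a - b :: real)"
  by (rule trans[OF arg_cong[of _ _ cosh] cosh_minus], simp)+

lemma cosh_diff_commute: "cosh (a - b) = cosh (b - a :: real)"
  by (rule trans[OF arg_cong[of _ _ cosh] cosh_minus]) simp

text \<open>Logarithm of the modulus and cosine of the argument: circles about 0 become vertical
  lines and the half-turn becomes a point reflection.\<close>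

definition crd :: "complex \<Rightarrow> real \<times> real" where
  "crd z = (ln (cmod z), Re z / cmod z)"

definition icrd :: "real \<times> real \<Rightarrow> complex" where
  "icrd x = of_real (exp (fst x)) * (of_real (snd x) + \<i> * of_real (sqrt (1 - (snd x)\<^sup>2)))"

text \<open>The half-turn \<open>z \<mapsto> - 1 / z\<close> about \<open>\<i>\<close>.\<close>

definition rot :: mat2 where "rot = (0, - 1, 1, 0)"

lemma abs_Re_less_cmod: "z \<in> H2 \<Longrightarrow> \<bar>Re z\<bar> < cmod z"
proof -
  assume "z \<in> H2"
  then have "(Re z)\<^sup>2 < (cmod z)\<^sup>2" by (simp add: cmod_power2)
  then show ?thesis by (metis abs_norm_cancel abs_less_iff power2_abs power_less_imp_less_base norm_ge_zero)
qed

lemma H2_cmod_pos: "z \<in> H2 \<Longrightarrow> cmod z > 0"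
  by auto

lemma snd_crd: "z \<in> H2 \<Longrightarrow> \<bar>snd (crd z)\<bar> < 1"
  using abs_Re_less_cmod[of z] H2_cmod_pos[of z] by (simp add: crd_def)

lemma icrd_H2: "\<bar>snd x\<bar> < 1 \<Longrightarrow> icrd x \<in> H2"
proof -
  assume "\<bar>snd x\<bar> < 1"
  then have "(snd x)\<^sup>2 < 1" by (simp add: abs_square_less_1)
  then show ?thesis by (simp add: icrd_def)
qed

lemma cmod_icrd: "\<bar>snd x\<bar> < 1 \<Longrightarrow> cmod (icrd x) = exp (fst x)"
proof -
  assume "\<bar>snd x\<bar> < 1"
  then have "(snd x)\<^sup>2 < 1" by (simp add: abs_square_less_1)
  then have "cmod (of_real (snd x) + \<i> * of_real (sqrt (1 - (snd x)\<^sup>2))) = 1" by (simp add: cmod_def)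
  then show ?thesis by (simp add: icrd_def norm_mult)
qed

lemma crd_icrd: "\<bar>snd x\<bar> < 1 \<Longrightarrow> crd (icrd x) = x"
  using cmod_icrd[of x] by (simp add: crd_def prod_eq_iff) (simp add: icrd_def)

lemma icrd_crd:
  assumes z: "z \<in> H2" shows "icrd (crd z) = z"
proof -
  have p: "cmod z > 0" "Im z > 0" using z by auto
  have "1 - (Re z / cmod z)\<^sup>2 = (Im z / cmod z)\<^sup>2"
    using p by (simp add: power_divide cmod_power2 field_simps)
  then have "sqrt (1 - (Re z / cmod z)\<^sup>2) = Im z / cmod z" using p by simp
  then show ?thesis using p by (simp add: icrd_def crd_def complex_eq_iff)
qed

lemma continuous_on_crd: "continuous_on H2 crd"
  unfolding crd_def using H2_cmod_pos by (intro continuous_intros) force+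

lemma continuous_on_icrd: "continuous_on S icrd"
  unfolding icrd_def by (intro continuous_intros)

lemma rot_det: "mdet rot = 1"
  by (simp add: rot_def)

lemma crd_rot:
  assumes "z \<in> H2" shows "crd (mact rot z) = - crd z"
proof -
  have z: "z \<noteq> 0" using assms by auto
  have m: "mact rot z = - 1 / z" by (simp add: mact_def rot_def)
  have "cmod (- 1 / z) = 1 / cmod z" by (simp add: norm_divide)
  moreover have "Re (- 1 / z) = - Re z / (cmod z)\<^sup>2" by (simp add: Re_divide cmod_power2)
  ultimately show ?thesis using z by (simp add: m crd_def ln_div power2_eq_square)
qed

text \<open>The first index names the generator, the second one of the two sides it pairs; the
  half-turn exchanges the latter, which is \<open>flp\<close>. For \<open>NX l\<close> the sides are
  the circles of radius \<open>l\<close> and \<open>1 / l\<close> about 0.\<close>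

definition nside :: "real \<Rightarrow> real \<Rightarrow> real \<Rightarrow> bool \<times> bool \<Rightarrow> geod" where
  "nside l p s i =
    (if fst i then (if snd i then (- 1 / l, 0, l) else (l, 0, - 1 / l))
     else (if snd i then (s, - sqrt (p * s + 1), p) else (p, sqrt (p * s + 1), s)))"

definition flp :: "bool \<times> bool \<Rightarrow> bool \<times> bool" where "flp i = (fst i, \<not> snd i)"

text \<open>Shift and height of the \<open>cosh\<close> curve. They appear when
  \<open>s * R\<^sup>2 + p\<close>, with \<open>R = exp r\<close>, is divided by
  \<open>2 * R * sqrt (p * s + 1)\<close>.\<close>

definition npar :: "real \<Rightarrow> real \<Rightarrow> real" where "npar p s = ln (p / s) / 2"
definition nkap :: "real \<Rightarrow> real \<Rightarrow> real" where "nkap p s = sqrt (p * s) / sqrt (p * s + 1)"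

lemma cosh_npar:
  assumes "p > 0" "s > 0"
  shows "2 * sqrt (p * s) * cosh (r - npar p s) = s * exp r + p * exp (- r)"
    and "2 * sqrt (p * s) * cosh (r + npar p s) = p * exp r + s * exp (- r)"
proof -
  have a: "exp (npar p s) = sqrt p / sqrt s"
  proof -
    have "npar p s = ln (sqrt (p / s))" using assms by (simp add: npar_def ln_sqrt)
    then show ?thesis using assms by (simp add: real_sqrt_divide)
  qed
  then have b: "exp (- npar p s) = sqrt s / sqrt p" by (simp add: exp_minus)
  have pp: "p = sqrt p * sqrt p" "s = sqrt s * sqrt s" using assms by auto
  have "sqrt p \<noteq> 0" "sqrt s \<noteq> 0" using assms by auto
  then have 1: "sqrt (p * s) * exp (npar p s) = p" "sqrt (p * s) * exp (- npar p s) = s"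
    unfolding a b using pp by (simp_all add: real_sqrt_mult field_simps)
  have "2 * sqrt (p * s) * cosh (r - npar p s) = exp r * (sqrt (p * s) * exp (- npar p s)) + exp (- r) * (sqrt (p * s) * exp (npar p s))"
    by (simp add: cosh_def exp_diff exp_minus field_simps)
  then show "2 * sqrt (p * s) * cosh (r - npar p s) = s * exp r + p * exp (- r)" unfolding 1 by simp
  have "2 * sqrt (p * s) * cosh (r + npar p s) = exp r * (sqrt (p * s) * exp (npar p s)) + exp (- r) * (sqrt (p * s) * exp (- npar p s))"
    by (simp add: cosh_def exp_add exp_minus exp_diff field_simps)
  then show "2 * sqrt (p * s) * cosh (r + npar p s) = p * exp r + s * exp (- r)" unfolding 1 by simp
qed

context
  fixes l p s :: real
  assumes n: "nform l p s"
begin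

abbreviation "qq \<equiv> sqrt (p * s + 1)"

lemma nform_gt_1: "l > 1" and nform_pos_p: "p > 0" and nform_pos_s: "s > 0"
  using n nform_pos[OF n] by (auto simp: nform_def)

lemma nform_sqrt_sq: "qq * qq = p * s + 1" and nform_sqrt_gt_1: "qq > 1"
  using nform_pos_p nform_pos_s by (auto simp: add_pos_pos less_imp_le)

text \<open>The trace inequalities say that the four sides are disjoint.\<close>
lemma nform_sqrt_le: "qq + 1 \<le> l * p" "qq + 1 \<le> l * s"
proof -
  have *: "sqrt (p * s + 1) + 1 \<le> l * p" if "nform l p s" for l p s :: real
  proof -
    have l: "l > 1" "l * p - s / l \<ge> 2" and ps: "p > 0" "s > 0" using that nform_pos[OF that] by (auto simp: nform_def)
    have "s / l > 0" using l ps by simp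
    then have lp: "l * p \<ge> 2" using l by linarith
    have "l * 2 \<le> l * (l * p - s / l)" using l by (intro mult_left_mono) auto
    then have "s \<le> l * l * p - 2 * l" using l by (simp add: field_simps)
    then have "p * s \<le> p * (l * l * p - 2 * l)" using ps by (intro mult_left_mono) auto
    then have "p * s + 1 \<le> (l * p - 1)\<^sup>2" by (simp add: power2_eq_square algebra_simps)
    then have "sqrt (p * s + 1) \<le> l * p - 1" using lp by (intro real_le_lsqrt) (auto simp: ps)
    then show ?thesis by simp
  qed
  show "qq + 1 \<le> l * p" by (rule *[OF n])
  have "nform l s p" using n by (auto simp: nform_def)
  from *[OF this] show "qq + 1 \<le> l * s" by (simp add: mult.commute)
qed

lemma gparam_npar: "gparam (ln l) (npar p s) (nkap p s)"
proof -
  note P = nform_gt_1 nform_pos_p nform_pos_s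
  have sq: "0 < sqrt (p * s)" "sqrt (p * s) < qq" using P by simp_all
  have qp: "0 < qq" using nform_sqrt_gt_1 by linarith
  have k1: "0 < nkap p s" unfolding nkap_def by (rule divide_pos_pos[OF sq(1) qp])
  have k2: "nkap p s < 1" unfolding nkap_def divide_less_eq_1_pos[OF qp] by (rule sq(2))
  note k = k1 k2
  have "s / l < l * p" "p / l < l * s" using n by (auto simp: nform_def)
  then have "p / s < l\<^sup>2" "s / p < l\<^sup>2" using P by (auto simp: field_simps power2_eq_square)
  then have "ln (p / s) < ln (l\<^sup>2)" "ln (s / p) < ln (l\<^sup>2)" using P by (auto intro!: ln_less_cancel_iff[THEN iffD2])
  then have m: "\<bar>npar p s\<bar> < ln l" using P by (simp add: npar_def ln_realpow ln_div abs_less_iff)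
  \<comment> \<open>Taken at \<open>u = l * p\<close> and \<open>u = l * s\<close>, this yields the
    two \<open>cosh\<close> bounds of \<open>gparam\<close>; it amounts to
    \<open>(u - qq)\<^sup>2 \<ge> 1\<close>.\<close>
  have key: "u + (qq\<^sup>2 - 1) / u \<ge> 2 * qq" if "u \<ge> qq + 1" for u
  proof -
    have u: "u > 0" using that nform_sqrt_gt_1 by linarith
    have "1\<^sup>2 \<le> (u - qq)\<^sup>2" using that by (intro power_mono) auto
    then have "0 \<le> ((u - qq)\<^sup>2 - 1) / u" using u by simp
    also have "\<dots> = u + (qq\<^sup>2 - 1) / u - 2 * qq" using u by (simp add: power2_eq_square field_simps)
    finally show ?thesis by simp
  qed
  have q2: "qq\<^sup>2 - 1 = p * s" using nform_sqrt_sq by (simp add: power2_eq_square)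
  have A: "s * exp (ln l) + p * exp (- ln l) \<ge> 2 * qq" "p * exp (ln l) + s * exp (- ln l) \<ge> 2 * qq"
    using key[OF nform_sqrt_le(1)] key[OF nform_sqrt_le(2)] P unfolding q2 by (simp_all add: exp_minus field_simps)
  have "nkap p s * cosh (ln l - npar p s) = (s * exp (ln l) + p * exp (- ln l)) / (2 * qq)"
    "nkap p s * cosh (ln l + npar p s) = (p * exp (ln l) + s * exp (- ln l)) / (2 * qq)"
    unfolding cosh_npar[OF P(2,3), symmetric] by (simp_all add: nkap_def)
  then show ?thesis unfolding gparam_def using A k m nform_sqrt_gt_1 by (simp add: le_divide_eq_1)
qed

lemma gform_nside:
  assumes z: "z \<in> H2"
  shows "gform (nside l p s (True, True)) z = l - (cmod z)\<^sup>2 / l"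
    "gform (nside l p s (True, False)) z = l * (cmod z)\<^sup>2 - 1 / l"
    "gform (nside l p s (False, True)) z = 2 * qq * cmod z * (nkap p s * cosh (fst (crd z) - npar p s) - snd (crd z))"
    "gform (nside l p s (False, False)) z = 2 * qq * cmod z * (nkap p s * cosh (fst (crd z) + npar p s) + snd (crd z))"
proof -
  have c: "cmod z > 0" using z by auto
  have e: "exp (fst (crd z)) = cmod z" "exp (- fst (crd z)) = 1 / cmod z"
    using c by (simp_all add: crd_def exp_minus field_simps)
  have q0: "qq > 0" using nform_sqrt_gt_1 by simp
  have a: "2 * qq * cmod z * (nkap p s * cosh v) = cmod z * (2 * sqrt (p * s) * cosh v)" for v
    using q0 by (simp add: nkap_def)
  show "gform (nside l p s (True, True)) z = l - (cmod z)\<^sup>2 / l"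
    "gform (nside l p s (True, False)) z = l * (cmod z)\<^sup>2 - 1 / l"
    by (simp_all add: nside_def)
  show "gform (nside l p s (False, True)) z = 2 * qq * cmod z * (nkap p s * cosh (fst (crd z) - npar p s) - snd (crd z))"
    unfolding right_diff_distrib a cosh_npar[OF nform_pos_p nform_pos_s] e
    using c by (simp add: nside_def crd_def power2_eq_square algebra_simps)
  show "gform (nside l p s (False, False)) z = 2 * qq * cmod z * (nkap p s * cosh (fst (crd z) + npar p s) + snd (crd z))"
    unfolding distrib_left a cosh_npar[OF nform_pos_p nform_pos_s] e
    using c by (simp add: nside_def crd_def power2_eq_square algebra_simps)
qed

text \<open>Since \<open>\<bar>x\<bar> < R\<close>, the forms \<open>C\<close> and \<open>E\<close>
  exceed quadratics \<open>t * R\<^sup>2 - 2 * qq * R + u\<close> with \<open>t * u = p * s\<close>.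
  Their roots are \<open>(qq + 1) / t\<close> and \<open>u / (qq + 1)\<close>, and
  \<open>nform_sqrt_le\<close> places these in the interval from \<open>1 / l\<close> to
  \<open>l\<close>; hence nonnegativity beyond either circle. \<open>C\<close> and \<open>E\<close>
  exclude each other because their sum is positive.\<close>

lemma tiling_nside: "tiling (nside l p s)"
proof -
  note P = nform_gt_1 nform_pos_p nform_pos_s
  have det: "mdet (gmat (nside l p s i)) = - 1" for i
    using nform_sqrt_sq P by (auto simp: nside_def algebra_simps)
  have "1 / l < l" using P by (simp add: field_simps less_1_mult)
  then have ii: "gform (nside l p s i) \<i> > 0" for i
    using P by (auto simp: nside_def)
  have disj: "gform (nside l p s i) z \<le> 0 \<longrightarrow> gform (nside l p s j) z > 0"
    if z: "z \<in> H2" and "i \<noteq> j" for i j z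
  proof -
    define R where "R = cmod z"
    define x where "x = Re z"
    have R: "R > 0" "\<bar>x\<bar> < R" using z H2_cmod_pos abs_Re_less_cmod by (auto simp: R_def x_def simp del: H2_iff)
    define A where "A = l - R\<^sup>2 / l"
    define B where "B = l * R\<^sup>2 - 1 / l"
    define C where "C = s * R\<^sup>2 - 2 * qq * x + p"
    define E where "E = p * R\<^sup>2 + 2 * qq * x + s"
    have g: "gform (nside l p s (True, True)) z = A" "gform (nside l p s (True, False)) z = B"
      "gform (nside l p s (False, True)) z = C" "gform (nside l p s (False, False)) z = E"
      by (simp_all add: nside_def A_def B_def C_def E_def R_def x_def)
    have qp: "0 < qq" using nform_sqrt_gt_1 by linarith
    have "x < R" "- x < R" using R by auto
    then have "qq * x < qq * R" "qq * (- x) < qq * R" using qp by (meson mult_strict_left_mono)+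
    then have qx: "qq * x < qq * R" "- (qq * x) < qq * R" unfolding mult_minus_right .
    have RA: "R \<ge> l" if "A \<le> 0"
    proof -
      have "l\<^sup>2 \<le> R\<^sup>2" using that P by (simp add: A_def field_simps power2_eq_square)
      then show ?thesis using R P by (simp add: power2_le_iff_abs_le)
    qed
    have RB: "R \<le> 1 / l" if "B \<le> 0"
    proof -
      have "R\<^sup>2 \<le> (1 / l)\<^sup>2" using that P by (simp add: B_def field_simps power2_eq_square)
      then show ?thesis using R P by (simp add: power2_le_iff_abs_le)
    qed
    have AB: "B > 0" if "A \<le> 0"
    proof (rule ccontr)
      assume "\<not> B > 0"
      then have "R \<le> 1 / l" using RB by simp
      then show False using RA[OF that] \<open>1 / l < l\<close> by linarith
    qed
    have big: "t * R\<^sup>2 - 2 * qq * R + u \<ge> 0" if "R \<ge> l" "qq + 1 \<le> l * t" "t * u = p * s" "t > 0" for t u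
    proof -
      have "l * t \<le> t * R" using that by (simp add: mult.commute)
      then have "1\<^sup>2 \<le> (t * R - qq)\<^sup>2" using that by (intro power_mono) linarith+
      then have "0 \<le> (t * R - qq)\<^sup>2 - 1" by simp
      also have "\<dots> = t * (t * R\<^sup>2 - 2 * qq * R) + (qq * qq - 1)" by (simp add: power2_eq_square algebra_simps)
      also have "\<dots> = t * (t * R\<^sup>2 - 2 * qq * R + u)" unfolding nform_sqrt_sq using that by (simp add: algebra_simps)
      finally show ?thesis using that by (simp add: zero_le_mult_iff)
    qed
    have small: "t * R\<^sup>2 - 2 * qq * R + u \<ge> 0" if "R \<le> 1 / l" "qq + 1 \<le> l * u" "t * u = p * s" "u > 0" for t u
    proof -
      have "(qq + 1) * R \<le> (qq + 1) * (1 / l)" using that nform_sqrt_gt_1 by (intro mult_left_mono) auto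
      also have "\<dots> \<le> u" using that P by (simp add: field_simps)
      finally have "R \<le> u - qq * R" by (simp add: algebra_simps)
      then have "R\<^sup>2 \<le> (u - qq * R)\<^sup>2" using R by (intro power_mono) auto
      then have "0 \<le> (u - qq * R)\<^sup>2 - R\<^sup>2" by simp
      also have "\<dots> = u * (u - 2 * qq * R) + (qq * qq - 1) * R\<^sup>2" by (simp add: power2_eq_square algebra_simps)
      also have "\<dots> = u * (t * R\<^sup>2 - 2 * qq * R + u)" unfolding nform_sqrt_sq using that(3)[symmetric] by (simp add: algebra_simps)
      finally show ?thesis using that by (simp add: zero_le_mult_iff)
    qed
    have AC: "C > 0" if "A \<le> 0" using big[OF RA[OF that] nform_sqrt_le(2), of p] P qx by (simp add: C_def mult.commute)
    have AE: "E > 0" if "A \<le> 0" using big[OF RA[OF that] nform_sqrt_le(1), of s] P qx by (simp add: E_def)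
    have BC: "C > 0" if "B \<le> 0" using small[OF RB[OF that] nform_sqrt_le(1), of s] P qx by (simp add: C_def mult.commute)
    have BE: "E > 0" if "B \<le> 0" using small[OF RB[OF that] nform_sqrt_le(2), of p] P qx by (simp add: E_def)
    have "C + E = (p + s) * (R\<^sup>2 + 1)" by (simp add: C_def E_def algebra_simps)
    also have "\<dots> > 0" using P by (intro mult_pos_pos add_pos_pos add_nonneg_pos) auto
    finally have CE: "E > 0" if "C \<le> 0" using that by linarith
    obtain i1 i2 where i: "i = (i1, i2)" by (cases i)
    obtain j1 j2 where j: "j = (j1, j2)" by (cases j)
    show ?thesis using AB AC AE BC BE CE \<open>i \<noteq> j\<close> unfolding i j
      by (cases i1; cases i2; cases j1; cases j2; simp add: g not_le[symmetric] not_less) linarith+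
  qed
  show ?thesis unfolding tiling_def using det ii disj by blast
qed

lemma gform_nside_sign:
  assumes z: "z \<in> H2"
  shows "gform (nside l p s (True, True)) z \<ge> 0 \<longleftrightarrow> fst (crd z) \<le> ln l"
    "gform (nside l p s (True, False)) z \<ge> 0 \<longleftrightarrow> - ln l \<le> fst (crd z)"
    "gform (nside l p s (False, True)) z \<ge> 0 \<longleftrightarrow> snd (crd z) \<le> nkap p s * cosh (fst (crd z) - npar p s)"
    "gform (nside l p s (False, False)) z \<ge> 0 \<longleftrightarrow> - snd (crd z) \<le> nkap p s * cosh (fst (crd z) + npar p s)"
    "gform (nside l p s (True, True)) z = 0 \<longleftrightarrow> fst (crd z) = ln l"
    "gform (nside l p s (True, False)) z = 0 \<longleftrightarrow> fst (crd z) = - ln l"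
    "gform (nside l p s (False, True)) z = 0 \<longleftrightarrow> snd (crd z) = nkap p s * cosh (fst (crd z) - npar p s)"
    "gform (nside l p s (False, False)) z = 0 \<longleftrightarrow> - snd (crd z) = nkap p s * cosh (fst (crd z) + npar p s)"
proof -
  note P = nform_gt_1 nform_pos_p nform_pos_s
  have c: "cmod z > 0" using z by auto
  have k: "2 * qq * cmod z > 0" using c nform_sqrt_gt_1 by simp
  have f: "fst (crd z) = ln (cmod z)" by (simp add: crd_def)
  have A: "l - (cmod z)\<^sup>2 / l = (l - cmod z) * ((l + cmod z) / l)" using P by (simp add: field_simps power2_eq_square)
  have B: "l * (cmod z)\<^sup>2 - 1 / l = (l * cmod z - 1) * ((l * cmod z + 1) / l)" using P by (simp add: field_simps power2_eq_square)
  have m: "0 \<le> x * k \<longleftrightarrow> 0 \<le> x" "x * k = 0 \<longleftrightarrow> x = 0" if "k > 0" for x k :: real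
    using that by (auto simp: zero_le_mult_iff)
  have m': "0 \<le> k * x \<longleftrightarrow> 0 \<le> x" "k * x = 0 \<longleftrightarrow> x = 0" if "k > 0" for x k :: real
    using that by (auto simp: zero_le_mult_iff)
  have pA: "(l + cmod z) / l > 0" and pB: "(l * cmod z + 1) / l > 0" using P c by (simp_all add: add_pos_pos)
  have lnc: "- ln l \<le> ln (cmod z) \<longleftrightarrow> 1 \<le> l * cmod z" "ln (cmod z) = - ln l \<longleftrightarrow> l * cmod z = 1"
  proof -
    have "ln (l * cmod z) = ln l + ln (cmod z)" using P c by (simp add: ln_mult)
    moreover have "0 \<le> ln (l * cmod z) \<longleftrightarrow> 1 \<le> l * cmod z" "ln (l * cmod z) = 0 \<longleftrightarrow> l * cmod z = 1"
      using P c by (simp_all add: ln_ge_zero_iff)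
    ultimately show "- ln l \<le> ln (cmod z) \<longleftrightarrow> 1 \<le> l * cmod z" "ln (cmod z) = - ln l \<longleftrightarrow> l * cmod z = 1" by auto
  qed
  show "gform (nside l p s (True, True)) z \<ge> 0 \<longleftrightarrow> fst (crd z) \<le> ln l"
    "gform (nside l p s (True, True)) z = 0 \<longleftrightarrow> fst (crd z) = ln l"
    unfolding gform_nside[OF z] A f m[OF pA] using P c by auto
  show "gform (nside l p s (True, False)) z \<ge> 0 \<longleftrightarrow> - ln l \<le> fst (crd z)"
    "gform (nside l p s (True, False)) z = 0 \<longleftrightarrow> fst (crd z) = - ln l"
    unfolding gform_nside[OF z] B f lnc m[OF pB] by auto
  show "gform (nside l p s (False, True)) z \<ge> 0 \<longleftrightarrow> snd (crd z) \<le> nkap p s * cosh (fst (crd z) - npar p s)"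
    "gform (nside l p s (False, True)) z = 0 \<longleftrightarrow> snd (crd z) = nkap p s * cosh (fst (crd z) - npar p s)"
    "gform (nside l p s (False, False)) z \<ge> 0 \<longleftrightarrow> - snd (crd z) \<le> nkap p s * cosh (fst (crd z) + npar p s)"
    "gform (nside l p s (False, False)) z = 0 \<longleftrightarrow> - snd (crd z) = nkap p s * cosh (fst (crd z) + npar p s)"
    unfolding gform_nside[OF z] m'[OF k] by auto
qed

lemma tile_nside: "z \<in> tile (nside l p s) \<longleftrightarrow> z \<in> H2 \<and> crd z \<in> region (ln l) (npar p s) (nkap p s)"
proof (cases "z \<in> H2")
  case True
  have all: "(\<forall>i. P i) \<longleftrightarrow> P (True, True) \<and> P (True, False) \<and> P (False, True) \<and> P (False, False)"
    for P :: "bool \<times> bool \<Rightarrow> bool"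
    by (auto simp: all_bool_eq)
  have "z \<in> tile (nside l p s) \<longleftrightarrow> (\<forall>i. 0 \<le> gform (nside l p s i) z)"
    using True by (simp add: tile_def)
  also have "\<dots> \<longleftrightarrow> crd z \<in> region (ln l) (npar p s) (nkap p s)"
    unfolding all gform_nside_sign[OF True] region_def mem_Collect_eq abs_le_iff[of "fst _"]
    using snd_crd[OF True] by linarith
  finally show ?thesis using True by blast
qed (simp add: tile_def)

lemma rot_grefl:
  assumes "z \<in> H2"
  shows "mact rot (grefl (nside l p s i) z) = grefl (nside l p s (flp i)) (mact rot z)"
proof -
  have d: "mdet (gmat (nside l p s i)) = - 1" for i by (rule tiling_det[OF tiling_nside])
  have "mmul rot (gmat (nside l p s i)) = mmul (gmat (nside l p s (flp i))) rot"
    by (auto simp: nside_def flp_def rot_def)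
  then show ?thesis
    using mact_mmul[of rot "gmat (nside l p s i)" z] mact_mmul[of "gmat (nside l p s (flp i))" rot z] d assms rot_det
    by (simp add: grefl_def)
qed

lemma rot_ract:
  assumes "z \<in> H2"
  shows "mact rot (ract (nside l p s) w z) = ract (nside l p s) (map flp w) (mact rot z)"
  using assms
proof (induction w)
  case (Cons i w)
  then show ?case using rot_grefl[OF ract_H2[OF tiling_nside Cons.prems]] by simp
qed simp

lemma NXY_reflections:
  assumes "z \<in> H2"
  shows "mact (NX l) z = grefl (nside l p s (True, True)) (mact rot z)"
    "mact (NY p s) z = grefl (nside l p s (False, True)) (mact rot z)"
proof -
  have d: "mdet (gmat (nside l p s i)) = - 1" for i by (rule tiling_det[OF tiling_nside])
  have e: "mmul (gmat (nside l p s (True, True))) rot = mscale (- 1) (NX l)"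
    "mmul (gmat (nside l p s (False, True))) rot = mscale (- 1) (NY p s)"
    by (auto simp: nside_def rot_def NX_def NY_def)
  have "mact (mmul (gmat (nside l p s i)) rot) z = grefl (nside l p s i) (mact rot z)" for i
    unfolding grefl_def by (rule mact_mmul) (use d[of i] rot_det assms in simp_all)
  from this[of "(True, True)"] this[of "(False, True)"]
  show "mact (NX l) z = grefl (nside l p s (True, True)) (mact rot z)"
    "mact (NY p s) z = grefl (nside l p s (False, True)) (mact rot z)"
    unfolding e by (simp_all add: mact_mscale)
qed

end

text \<open>Sides are tracked directly on the right and at the top only; the other two are their
  images under \<open>x \<mapsto> - x\<close>, and \<open>rmap\<close> is odd.\<close>

lemma nform_tile_map:
  assumes n: "nform l p s" and n': "nform l' p' s'"
  defines "D \<equiv> \<lambda>z. icrd (rmap (ln l) (npar p s) (nkap p s) (ln l') (npar p' s') (nkap p' s') (crd z))"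
    and "D' \<equiv> \<lambda>z. icrd (rmap (ln l') (npar p' s') (nkap p' s') (ln l) (npar p s) (nkap p s) (crd z))"
  shows "z \<in> tile (nside l p s) \<Longrightarrow> D z \<in> tile (nside l' p' s')"
    "z \<in> tile (nside l p s) \<Longrightarrow> D' (D z) = z"
    "continuous_on (tile (nside l p s)) D"
    "z \<in> tile (nside l p s) \<Longrightarrow> gform (nside l p s i) z = 0 \<Longrightarrow> gform (nside l' p' s' i) (D z) = 0"
    "z \<in> tile (nside l p s) \<Longrightarrow> mact rot z \<in> tile (nside l p s) \<and> D (mact rot z) = mact rot (D z)"
proof -
  let ?r = "rmap (ln l) (npar p s) (nkap p s) (ln l') (npar p' s') (nkap p' s')"
  let ?R = "region (ln l) (npar p s) (nkap p s)"
  let ?R' = "region (ln l') (npar p' s') (nkap p' s')"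
  note g = gparam_npar[OF n] and g' = gparam_npar[OF n']
  have T: "z \<in> H2 \<and> crd z \<in> ?R" if "z \<in> tile (nside l p s)" for z using that by (simp only: tile_nside[OF n])
  have r: "?r x \<in> ?R'" if "x \<in> ?R" for x using rmap_region(1)[OF g g' that] .
  have sR: "\<bar>snd x\<bar> < 1" if "x \<in> ?R" for x using that by (simp add: region_def)
  have sR': "\<bar>snd x\<bar> < 1" if "x \<in> ?R'" for x using that by (simp add: region_def)
  have cD: "crd (D z) = ?r (crd z)" "D z \<in> H2" if "z \<in> tile (nside l p s)" for z
    using crd_icrd icrd_H2 sR'[OF r] T[OF that] unfolding D_def by blast+
  show t: "D z \<in> tile (nside l' p' s')" if "z \<in> tile (nside l p s)" for z
    using cD[OF that] r T[OF that] by (simp only: tile_nside[OF n'])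
  show "D' (D z) = z" if z: "z \<in> tile (nside l p s)"
    unfolding D'_def cD(1)[OF z] using rmap_region(2)[OF g g'] T[OF z] icrd_crd by simp
  show "continuous_on (tile (nside l p s)) D"
  proof -
    have sub: "tile (nside l p s) \<subseteq> H2" using T by blast
    have "continuous_on (tile (nside l p s)) (\<lambda>z. ?r (crd z))"
      by (rule continuous_on_compose2[OF continuous_on_rmap[OF g g'] continuous_on_subset[OF continuous_on_crd sub]])
         (use T in blast)
    then show ?thesis unfolding D_def by (rule continuous_on_compose2[OF continuous_on_icrd[of UNIV]]) simp
  qed
  have odd: "?r (- x) = - ?r x" if "x \<in> ?R" for x using rmap_odd[OF g g' that] .
  have neg: "- x \<in> ?R" if "x \<in> ?R" for x using that
    by (simp add: region_def cosh_neg cosh_diff_commute[of "npar p s"])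
  show "gform (nside l' p' s' i) (D z) = 0" if z: "z \<in> tile (nside l p s)" and i: "gform (nside l p s i) z = 0"
  proof -
    note Z = T[OF z]
    have zH: "z \<in> H2" and zR: "crd z \<in> ?R" using Z by auto
    have minus: "?r (crd z) = - ?r (- crd z)" using odd[OF zR] by simp
    consider "i = (True, True)" | "i = (True, False)" | "i = (False, True)" | "i = (False, False)"
      by (cases i) auto
    then show ?thesis
    proof cases
      case 1
      then show ?thesis using i rmap_right[OF g g' zR]
        unfolding 1 gform_nside_sign[OF n zH] gform_nside_sign[OF n' cD(2)[OF z]] cD(1)[OF z] by simp
    next
      case 2
      then have "fst (- crd z) = ln l" using i unfolding 2 gform_nside_sign[OF n zH] by simp
      then have "fst (?r (- crd z)) = ln l'" by (rule rmap_right[OF g g' neg[OF zR]])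
      then show ?thesis
        unfolding 2 gform_nside_sign[OF n' cD(2)[OF z]] cD(1)[OF z] minus by simp
    next
      case 3
      then show ?thesis using i rmap_top[OF g g' zR]
        unfolding 3 gform_nside_sign[OF n zH] gform_nside_sign[OF n' cD(2)[OF z]] cD(1)[OF z] by simp
    next
      case 4
      have "snd (- crd z) = nkap p s * cosh (fst (- crd z) - npar p s)"
        using i unfolding 4 gform_nside_sign[OF n zH] by (simp add: cosh_neg)
      then have "snd (?r (- crd z)) = nkap p' s' * cosh (fst (?r (- crd z)) - npar p' s')"
        by (rule rmap_top[OF g g' neg[OF zR]])
      then show ?thesis
        unfolding 4 gform_nside_sign[OF n' cD(2)[OF z]] cD(1)[OF z] minus
        by (simp add: cosh_neg cosh_diff_commute[of "npar p' s'"])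
    qed
  qed
  show "mact rot z \<in> tile (nside l p s) \<and> D (mact rot z) = mact rot (D z)" if z: "z \<in> tile (nside l p s)"
  proof
    have zH: "z \<in> H2" and zR: "crd z \<in> ?R" using T[OF z] by auto
    have m: "mact rot v \<in> H2" if "v \<in> H2" for v using mact_H2[of rot] rot_det that by simp
    show "mact rot z \<in> tile (nside l p s)"
      unfolding tile_nside[OF n] crd_rot[OF zH] using m zH neg zR by simp
    have "D (mact rot z) = icrd (- ?r (crd z))" unfolding D_def crd_rot[OF zH] odd[OF zR] ..
    also have "- ?r (crd z) = crd (mact rot (D z))" using crd_rot[OF cD(2)[OF z]] cD(1)[OF z] by simp
    also have "icrd \<dots> = mact rot (D z)" using icrd_crd m cD(2)[OF z] by simp
    finally show "D (mact rot z) = mact rot (D z)" .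
  qed
qed

lemma nform_conjugate:
  assumes n: "nform l p s" and n': "nform l' p' s'"
  obtains E E' where "homeomorphism H2 H2 E E'"
    "\<And>z. z \<in> H2 \<Longrightarrow> E (mact (NX l) z) = mact (NX l') (E z)"
    "\<And>z. z \<in> H2 \<Longrightarrow> E (mact (NY p s) z) = mact (NY p' s') (E z)"
proof -
  let ?N = "nside l p s" and ?N' = "nside l' p' s'"
  note T = tiling_nside[OF n] and T' = tiling_nside[OF n']
  define D where "D z = icrd (rmap (ln l) (npar p s) (nkap p s) (ln l') (npar p' s') (nkap p' s') (crd z))" for z
  define D' where "D' z = icrd (rmap (ln l') (npar p' s') (nkap p' s') (ln l) (npar p s) (nkap p s) (crd z))" for z
  note M = nform_tile_map[OF n n', folded D_def D'_def]
  note M' = nform_tile_map[OF n' n, folded D_def D'_def]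
  have "homeomorphism (tile ?N) (tile ?N') D D'"
    using M(1,2,3) M'(1,2,3) by (intro homeomorphismI) auto
  then obtain E E' where E: "homeomorphism H2 H2 E E'" "\<And>w y. y \<in> tile ?N \<Longrightarrow> E (ract ?N w y) = ract ?N' w (D y)"
    using tile_homeomorphism_extends[where D = D and D' = D', OF T T' _ M(4) M'(4)] by blast
  have key: "E (grefl (?N i) (mact rot z)) = grefl (?N' i) (mact rot (E z))" if z: "z \<in> H2" for i z
  proof -
    obtain w y where y: "y \<in> tile ?N" "z = ract ?N w y" using tiles_cover[OF T z] by blast
    have yH: "y \<in> H2" "D y \<in> H2" using tile_subset[OF T y(1)] tile_subset[OF T' M(1)[OF y(1)]] by auto
    \<comment> \<open>\<open>E\<close> is known only on words of reflections applied to tile points,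
      so the half-turn is moved through the word, permuting its letters, until it acts on
      \<open>y\<close>.\<close>
    have a: "grefl (?N i) (mact rot z) = ract ?N (i # map flp w) (mact rot y)"
      unfolding y(2) rot_ract[OF n yH(1)] by simp
    have "E (grefl (?N i) (mact rot z)) = ract ?N' (i # map flp w) (D (mact rot y))"
      unfolding a by (rule E(2)[OF conjunct1[OF M(5)[OF y(1)]]])
    also have "\<dots> = grefl (?N' i) (mact rot (ract ?N' w (D y)))"
      unfolding rot_ract[OF n' yH(2)] conjunct2[OF M(5)[OF y(1)]] by simp
    finally show ?thesis using E(2)[OF y(1)] y(2) by simp
  qed
  have EH: "E z \<in> H2" if "z \<in> H2" for z using homeomorphism_H2D(1)[OF E(1) that] .
  show ?thesis
  proof (rule that[OF E(1)])
    show "E (mact (NX l) z) = mact (NX l') (E z)" if "z \<in> H2" for z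
      using key[OF that] NXY_reflections(1)[OF n that] NXY_reflections(1)[OF n' EH[OF that]] by simp
    show "E (mact (NY p s) z) = mact (NY p' s') (E z)" if "z \<in> H2" for z
      using key[OF that] NXY_reflections(2)[OF n that] NXY_reflections(2)[OF n' EH[OF that]] by simp
  qed
qed

section \<open>Length coordinates\<close>

definition nlengths :: "real \<Rightarrow> real \<Rightarrow> real \<Rightarrow> real \<times> real \<times> real \<times> real \<Rightarrow> bool" where
  "nlengths l p s = (\<lambda>(a, b, x, y). a \<ge> 0 \<and> b \<ge> 0 \<and> x > 0 \<and> y > 0 \<and>
     cosh (a / 2) = (l * p - s / l) / 2 \<and> cosh (b / 2) = (l * s - p / l) / 2 \<and>
     sinh (x / 2) = (l - 1 / l) / 2 \<and> sinh (y / 2) = (p + s) / 2)"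

lemma fricke_isom: "r \<in> fricke \<Longrightarrow> isom_H2 (fst r)" "r \<in> fricke \<Longrightarrow> isom_H2 (snd r)"
  by (auto simp: fricke_def)

lemma lengths_nform_matrices:
  assumes n: "nform l p s" and d: "mdet X = - 1" "mdet Y = - 1"
    and t: "mtr X = l - 1 / l" "mtr Y = p + s" "mtr (mmul X Y) = l * p - s / l"
    and r: "isom_H2 (fst r)" "isom_H2 (snd r)"
    and XY: "\<And>z. z \<in> H2 \<Longrightarrow> fst r z = mact X z" "\<And>z. z \<in> H2 \<Longrightarrow> snd r z = mact Y z"
  shows "nlengths l p s (lengths r)"
proof -
  have l: "l > 1" using n by (simp add: nform_def)
  have B: "mtr X * mtr Y - mtr (mmul X Y) = l * s - p / l"
    unfolding t using l by (simp add: field_simps)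
  have "1 / l < l" using l by (simp add: field_simps less_1_mult)
  then have pos: "mtr X > 0" "mtr Y > 0" using nform_pos[OF n] by (auto simp: t)
  have "mtr (mmul X Y) \<ge> 2" using n unfolding t(3) by (simp add: nform_def)
  moreover have "mtr X * mtr Y - mtr (mmul X Y) \<ge> 2" using n unfolding B by (simp add: nform_def)
  ultimately have T: "mtr (mmul X Y) \<ge> 2" "mtr X * mtr Y - mtr (mmul X Y) \<ge> 2" .
  from lengths_of_matrices[OF d pos T r XY]
  obtain a b x y where "lengths (fst r, snd r) = (a, b, x, y)" "a \<ge> 0" "b \<ge> 0" "x > 0" "y > 0"
    "cosh (a / 2) = mtr (mmul X Y) / 2" "cosh (b / 2) = (mtr X * mtr Y - mtr (mmul X Y)) / 2"
    "sinh (x / 2) = mtr X / 2" "sinh (y / 2) = mtr Y / 2" by metis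
  then show ?thesis using B unfolding t by (simp add: nlengths_def)
qed

lemma fricke_nform:
  assumes r: "r \<in> fricke"
  obtains l p s where "nform l p s" "conj_rep r (mact (NX l), mact (NY p s))" "nlengths l p s (lengths r)"
proof -
  have "(fst r, snd r) \<in> fricke" using r by simp
  then obtain X Y where XY: "mdet X = - 1" "mdet Y = - 1" "mtr X > 0" "mtr Y > 0"
    "mtr (mmul X Y) \<ge> 2" "mtr X * mtr Y - mtr (mmul X Y) \<ge> 2"
    "\<And>z. z \<in> H2 \<Longrightarrow> fst r z = mact X z" "\<And>z. z \<in> H2 \<Longrightarrow> snd r z = mact Y z"
    using fricke_matrices by metis
  obtain l p s P where P: "nform l p s" "mdet P \<noteq> 0" "mmul P X = mmul (NX l) P" "mmul P Y = mmul (NY p s) P"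
    "mtr X = l - 1 / l" "mtr Y = p + s" "mtr (mmul X Y) = l * p - s / l"
    using matrices_normal_form[OF XY(1-6)] by metis
  have N: "mdet (NX l) = - 1" "mdet (NY p s) = - 1" using NXY_traces[OF P(1)] by auto
  have "mact P (mact X z) = mact (NX l) (mact P z)" "mact P (mact Y z) = mact (NY p s) (mact P z)"
    if "z \<in> H2" for z
    using mact_mmul[of P X z] mact_mmul[of "NX l" P z] mact_mmul[of P Y z] mact_mmul[of "NY p s" P z] P(2-4) XY(1,2) N that
    by simp_all
  then have "conj_rep r (mact (NX l), mact (NY p s))"
    unfolding conj_rep_def using isom_H2_mact[OF P(2)] XY(7,8) by (intro exI[of _ "mact P"]) simp
  then show ?thesis
    using that[OF P(1)] lengths_nform_matrices[OF P(1) XY(1,2) P(5-7) fricke_isom[OF r] XY(7,8)] by blast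
qed

text \<open>The reference pair satisfies the same trace inequalities, so it has a normal form of its
  own. Conjugating into that form and then applying \<open>nform_conjugate\<close> gives the
  required equivariant homeomorphism.\<close>

lemma nform_fricke:
  assumes n: "nform l p s"
  shows "(mact (NX l), mact (NY p s)) \<in> fricke"
proof -
  have R: "mdet XR = - 1" "mdet YR = - 1" "mtr XR > 0" "mtr YR > 0"
    "mtr (mmul XR YR) \<ge> 2" "mtr XR * mtr YR - mtr (mmul XR YR) \<ge> 2"
    by (auto simp: XR_def YR_def)
  obtain l0 p0 s0 P where P: "nform l0 p0 s0" "mdet P \<noteq> 0" "mmul P XR = mmul (NX l0) P" "mmul P YR = mmul (NY p0 s0) P"
    using matrices_normal_form[OF R] by metis
  obtain E E' where E: "homeomorphism H2 H2 E E'"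
    "\<And>z. z \<in> H2 \<Longrightarrow> E (mact (NX l0) z) = mact (NX l) (E z)"
    "\<And>z. z \<in> H2 \<Longrightarrow> E (mact (NY p0 s0) z) = mact (NY p s) (E z)"
    using nform_conjugate[OF P(1) n] by metis
  have N0: "mdet (NX l0) = - 1" "mdet (NY p0 s0) = - 1" using NXY_traces[OF P(1)] by auto
  have N: "mdet (NX l) = - 1" "mdet (NY p s) = - 1" using NXY_traces[OF n] by auto
  have PH: "mact P z \<in> H2" "mact (madj P) z \<in> H2" if "z \<in> H2" for z using mact_H2 P(2) that by simp_all
  have "homeomorphism H2 H2 (mact P) (mact (madj P))"
    using continuous_on_mact P(2) PH mact_madj by (intro homeomorphismI) auto
  from homeomorphism_compose[OF this E(1)]
  have hom: "homeomorphism H2 H2 (E \<circ> mact P) (mact (madj P) \<circ> E')" .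
  have PX: "mact P (mact XR z) = mact (NX l0) (mact P z)" "mact P (mact YR z) = mact (NY p0 s0) (mact P z)"
    if "z \<in> H2" for z
    using mact_mmul[of P XR z] mact_mmul[of "NX l0" P z] mact_mmul[of P YR z] mact_mmul[of "NY p0 s0" P z] P(2-4) R(1,2) N0 that
    by simp_all
  have "(E \<circ> mact P) (X0 z) = mact (NX l) ((E \<circ> mact P) z)" "(E \<circ> mact P) (Y0 z) = mact (NY p s) ((E \<circ> mact P) z)"
    if "z \<in> H2" for z
    using PX[OF that] E(2,3)[OF PH(1)[OF that]] by (simp_all add: X0_mact Y0_mact)
  then show ?thesis
    unfolding fricke_def using hom isom_H2_mact N by auto
qed

lemma half_cosh_inj: "a \<ge> 0 \<Longrightarrow> b \<ge> 0 \<Longrightarrow> cosh (a / 2) = cosh (b / 2) \<Longrightarrow> a = (b::real)"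
  by simp

lemma nlengths_admissible:
  assumes n: "nform l p s" and L: "nlengths l p s q" shows "q \<in> admissible"
proof -
  obtain a b x y where q: "q = (a, b, x, y)" by (cases q)
  have l: "l > 1" using n by (simp add: nform_def)
  have L': "a \<ge> 0" "b \<ge> 0" "x > 0" "y > 0" "cosh (a / 2) = (l * p - s / l) / 2" "cosh (b / 2) = (l * s - p / l) / 2"
     "sinh (x / 2) = (l - 1 / l) / 2" "sinh (y / 2) = (p + s) / 2"
    using L by (auto simp: nlengths_def q)
  have "cosh (a / 2) + cosh (b / 2) = 2 * sinh (x / 2) * sinh (y / 2)"
    unfolding L'(5-8) using l by (simp add: field_simps)
  then show ?thesis using L'(1-4) unfolding admissible_def q by blast
qed

lemma admissible_last_unique:
  assumes "(a, b, x, y) \<in> admissible" "(a, b, x, y') \<in> admissible" shows "y = y'"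
proof -
  have "2 * sinh (x / 2) * sinh (y / 2) = 2 * sinh (x / 2) * sinh (y' / 2)" "x > 0"
    using assms by (auto simp: admissible_def)
  then show ?thesis by simp
qed

text \<open>The length of \<open>Y\<close> is left open because the length relation recovers it from
  the other three.\<close>

lemma exists_nform:
  assumes "a \<ge> 0" "b \<ge> 0" "x > 0"
  obtains l p s where "nform l p s" "\<And>q. nlengths l p s q \<Longrightarrow> \<exists>y. q = (a, b, x, y)"
proof -
  define l where "l = exp (x / 2)"
  define u where "u = l\<^sup>2 - 1 / l\<^sup>2"
  define A where "A = cosh (a / 2)"
  define B where "B = cosh (b / 2)"
  \<comment> \<open>\<open>p\<close> and \<open>s\<close> solve the linear system
    \<open>l * p - s / l = 2 * A\<close>, \<open>l * s - p / l = 2 * B\<close>, whose determinant is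
    \<open>u\<close>.\<close>
  define p where "p = 2 * (l * A + B / l) / u"
  define s where "s = 2 * (l * B + A / l) / u"
  have l: "l > 1" using assms by (simp add: l_def)
  then have "1 / l\<^sup>2 < 1" "1 < l\<^sup>2" by (simp_all add: field_simps one_less_power)
  then have u: "u > 0" by (simp add: u_def)
  have AB: "A \<ge> 1" "B \<ge> 1" by (auto simp: A_def B_def cosh_real_ge_1)
  have "l * p - s / l = 2 * A * (l\<^sup>2 - 1 / l\<^sup>2) / u"
    using l u by (simp add: p_def s_def power2_eq_square field_simps)
  then have 1: "l * p - s / l = 2 * A" using u by (simp add: u_def)
  have "l * s - p / l = 2 * B * (l\<^sup>2 - 1 / l\<^sup>2) / u"
    using l u by (simp add: p_def s_def power2_eq_square field_simps)
  then have 2: "l * s - p / l = 2 * B" using u by (simp add: u_def)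
  have 3: "(l - 1 / l) / 2 = sinh (x / 2)" by (simp add: l_def sinh_def exp_minus field_simps)
  show ?thesis
  proof (rule that)
    show "nform l p s" using l 1 2 AB by (simp add: nform_def)
    show "\<exists>y. q = (a, b, x, y)" if "nlengths l p s q" for q
    proof -
      obtain a' b' x' y' where q: "q = (a', b', x', y')" by (cases q)
      have "a' \<ge> 0" "b' \<ge> 0" "cosh (a' / 2) = cosh (a / 2)" "cosh (b' / 2) = cosh (b / 2)" "sinh (x' / 2) = sinh (x / 2)"
        using that 1 2 3 unfolding nlengths_def q A_def B_def by auto
      then have "a' = a" "b' = b" "x' = x" using half_cosh_inj assms by auto
      then show ?thesis using q by simp
    qed
  qed
qed

lemma exists_fricke:
  assumes "a \<ge> 0" "b \<ge> 0" "x > 0"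
  obtains r y where "r \<in> fricke" "lengths r = (a, b, x, y)" "(a, b, x, y) \<in> admissible"
proof -
  obtain l p s where n: "nform l p s" "\<And>q. nlengths l p s q \<Longrightarrow> \<exists>y. q = (a, b, x, y)"
    using exists_nform[OF assms] by metis
  define r where "r = (mact (NX l), mact (NY p s))"
  have r: "r \<in> fricke" unfolding r_def by (rule nform_fricke[OF n(1)])
  have "nlengths l p s (lengths r)"
    by (rule lengths_nform_matrices[OF n(1) NXY_traces(1-5)[OF n(1)] fricke_isom[OF r]]) (simp_all add: r_def)
  then show ?thesis using that[OF r] n(2) nlengths_admissible[OF n(1)] by metis
qed

lemma fricke_lengths_inj:
  assumes r: "r \<in> fricke" and s: "s \<in> fricke" and eq: "lengths r = lengths s"
  shows "conj_rep r s"
proof -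
  obtain l p t where n: "nform l p t" "conj_rep r (mact (NX l), mact (NY p t))" "nlengths l p t (lengths r)"
    using fricke_nform[OF r] by metis
  obtain l' p' t' where n': "nform l' p' t'" "conj_rep s (mact (NX l'), mact (NY p' t'))" "nlengths l' p' t' (lengths s)"
    using fricke_nform[OF s] by metis
  have "l - 1 / l = l' - 1 / l'" "l * p - t / l = l' * p' - t' / l'" "l * t - p / l = l' * t' - p' / l'"
    using n(3) n'(3) unfolding eq nlengths_def by (auto split: prod.splits)
  then have "l = l'" "p = p'" "t = t'" using nform_unique[OF n(1) n'(1)] by auto
  then show ?thesis using conj_rep_trans_sym[OF fricke_isom[OF r] fricke_isom[OF s] n(2)] n'(2) by simp
qed

theorem theorem3p1:
  shows "(\<forall>r\<in>fricke. \<forall>s\<in>fricke. conj_rep r s \<longrightarrow> lengths r = lengths s)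
    \<and> (\<forall>r\<in>fricke. lengths r \<in> admissible)
    \<and> (\<forall>q\<in>admissible. \<exists>r\<in>fricke. lengths r = q)
    \<and> (\<forall>r\<in>fricke. \<forall>s\<in>fricke. lengths r = lengths s \<longrightarrow> conj_rep r s)
    \<and> (\<forall>a b x. a \<ge> 0 \<longrightarrow> b \<ge> 0 \<longrightarrow> x > 0 \<longrightarrow>
         (\<exists>r\<in>fricke. (\<lambda>(la, lb, lx, ly). (la, lb, lx)) (lengths r) = (a, b, x)))
    \<and> (\<forall>r\<in>fricke. \<forall>s\<in>fricke.
         (\<lambda>(la, lb, lx, ly). (la, lb, lx)) (lengths r) = (\<lambda>(la, lb, lx, ly). (la, lb, lx)) (lengths s)
         \<longrightarrow> conj_rep r s)"
proof (intro conjI ballI allI impI)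
  show "lengths r = lengths s" if "r \<in> fricke" "s \<in> fricke" "conj_rep r s" for r s
    using conj_rep_lengths[OF fricke_isom[OF that(1)] fricke_isom[OF that(2)] that(3)] .
  show adm: "lengths r \<in> admissible" if r: "r \<in> fricke" for r
    using fricke_nform[OF r] nlengths_admissible by metis
  show "\<exists>r\<in>fricke. lengths r = q" if q: "q \<in> admissible" for q
  proof -
    obtain a b x y where Q: "q = (a, b, x, y)" by (cases q)
    then have "a \<ge> 0" "b \<ge> 0" "x > 0" using q by (auto simp: admissible_def)
    then obtain r y' where r: "r \<in> fricke" "lengths r = (a, b, x, y')" "(a, b, x, y') \<in> admissible"
      using exists_fricke by metis
    then have "y' = y" using admissible_last_unique q Q by blast
    then show ?thesis using r Q by blast
  qed
  show inj: "conj_rep r s" if "r \<in> fricke" "s \<in> fricke" "lengths r = lengths s" for r s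
    using fricke_lengths_inj that .
  show "\<exists>r\<in>fricke. (\<lambda>(la, lb, lx, ly). (la, lb, lx)) (lengths r) = (a, b, x)"
    if abx: "a \<ge> 0" "b \<ge> 0" "x > 0" for a b x
  proof -
    obtain r y where "r \<in> fricke" "lengths r = (a, b, x, y)" using exists_fricke[OF abx] by metis
    then show ?thesis by force
  qed
  show "conj_rep r s" if rs: "r \<in> fricke" "s \<in> fricke"
    and eq: "(\<lambda>(la, lb, lx, ly). (la, lb, lx)) (lengths r) = (\<lambda>(la, lb, lx, ly). (la, lb, lx)) (lengths s)" for r s
  proof -
    obtain a b x y where R: "lengths r = (a, b, x, y)" by (cases "lengths r")
    obtain y' where S: "lengths s = (a, b, x, y')" using eq R by (cases "lengths s") auto
    have "y = y'" using admissible_last_unique adm[OF rs(1)] adm[OF rs(2)] unfolding R S by blast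
    then show ?thesis using inj rs R S by simp
  qed
qed

end
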